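(* Let $(R,\mathfrak{m})$ be a commutative complete local noetherian integral domain with Krull dimension one, $K$ its field of fractions, $\Lambda$ a module-finite $R$-algebra, and $A=K\otimes_R\Lambda$. Then $\operatorname{tors}\Lambda$ is a finite set if and only if $\operatorname{tors}(\Lambda/\mathfrak{m}\Lambda)$ and $\operatorname{tors}A$ are finite sets.
   Context: A module-finite $R$-algebra is a ring $\Lambda$ with a ring homomorphism $R\to\Lambda$ whose image is in the center of $\Lambda$ such that $\Lambda$ is finitely generated as an $R$-module. For a ring $\Gamma$ among $\Lambda$, $\Lambda/\mathfrak{m}\Lambda$, $A$, $\operatorname{tors}\Gamma$ denotes the set of torsion classes of the category $\operatorname{mod}\Gamma$ of finitely generated left $\Gamma$-modules, i.e. nonempty full subcategories closed under isomorphisms, factor modules and extensions. *)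

theory Defs
  imports "HOL-Algebra.Algebra" "HOL-Library.Extended_Nat"
begin

section \<open>Commutative algebra\<close>

locale local_ring = cring R + maximalideal \<mm> R for \<mm> and R (structure) +
  assumes unique_maximalideal: "maximalideal I R \<Longrightarrow> I = \<mm>"

text \<open>Powers of an ideal are taken in the library monoid \<^const>\<open>ideals_set\<close> of ideals.
  The two axioms say that the canonical map from \<open>R\<close> to the inverse limit of the rings
  \<open>R / \<mm>^n\<close> is injective and surjective, respectively.\<close>

locale complete_local_ring = local_ring +
  assumes separated: "(\<Inter>n::nat. \<mm> [^]\<^bsub>ideals_set R\<^esub> n) = {\<zero>}"
    and complete: "\<lbrakk> \<And>n. x n \<in> carrier R;
        \<And>n::nat. x (Suc n) \<ominus> x n \<in> \<mm> [^]\<^bsub>ideals_set R\<^esub> n \<rbrakk>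
      \<Longrightarrow> \<exists>y \<in> carrier R. \<forall>n. y \<ominus> x n \<in> \<mm> [^]\<^bsub>ideals_set R\<^esub> n"

text \<open>Supremum of the lengths of chains of prime ideals; the zero ring gets the value \<open>0\<close>.\<close>

definition krull_dim :: "('a, 'b) ring_scheme \<Rightarrow> enat"
  where "krull_dim R = Sup {enat n | n. \<exists>P :: nat \<Rightarrow> 'a set.
    (\<forall>i\<le>n. primeideal (P i) R) \<and> (\<forall>i<n. P i \<subset> P (Suc i))}"

locale fraction_field = ring_hom_ring R K \<iota> + domain R + K: field K
  for R (structure) and K (structure) and \<iota> +
  assumes inj: "inj_on \<iota> (carrier R)"
    and fraction: "x \<in> carrier K \<Longrightarrow>
      \<exists>a \<in> carrier R. \<exists>b \<in> carrier R - {\<zero>}. x = \<iota> a \<otimes>\<^bsub>K\<^esub> inv\<^bsub>K\<^esub> \<iota> b"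


section \<open>Left modules over a ring\<close>

text \<open>The library locale \<^locale>\<open>module\<close> requires a commutative ring of scalars, so it is restated
  here for arbitrary rings, on the same record type. The multiplicative fields \<^const>\<open>monoid.mult\<close> and
  \<^const>\<open>one\<close> of such a record play no role.\<close>

locale left_module = R?: ring R + M?: abelian_group M
  for R :: "('a, 'm) ring_scheme" (structure) and M :: "('a, 'b, 'n) module_scheme" (structure) +
  assumes smult_closed: "\<lbrakk> a \<in> carrier R; x \<in> carrier M \<rbrakk> \<Longrightarrow> a \<odot>\<^bsub>M\<^esub> x \<in> carrier M"
    and smult_l_distr: "\<lbrakk> a \<in> carrier R; b \<in> carrier R; x \<in> carrier M \<rbrakk> \<Longrightarrow>
      (a \<oplus> b) \<odot>\<^bsub>M\<^esub> x = a \<odot>\<^bsub>M\<^esub> x \<oplus>\<^bsub>M\<^esub> b \<odot>\<^bsub>M\<^esub> x"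
    and smult_r_distr: "\<lbrakk> a \<in> carrier R; x \<in> carrier M; y \<in> carrier M \<rbrakk> \<Longrightarrow>
      a \<odot>\<^bsub>M\<^esub> (x \<oplus>\<^bsub>M\<^esub> y) = a \<odot>\<^bsub>M\<^esub> x \<oplus>\<^bsub>M\<^esub> a \<odot>\<^bsub>M\<^esub> y"
    and smult_assoc1: "\<lbrakk> a \<in> carrier R; b \<in> carrier R; x \<in> carrier M \<rbrakk> \<Longrightarrow>
      (a \<otimes> b) \<odot>\<^bsub>M\<^esub> x = a \<odot>\<^bsub>M\<^esub> (b \<odot>\<^bsub>M\<^esub> x)"
    and smult_one: "x \<in> carrier M \<Longrightarrow> \<one> \<odot>\<^bsub>M\<^esub> x = x"

definition fin_gen_module :: "('a, 'm) ring_scheme \<Rightarrow> ('a, 'b, 'n) module_scheme \<Rightarrow> bool"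
  where "fin_gen_module R M \<longleftrightarrow> (\<exists>S. finite S \<and> S \<subseteq> carrier M \<and>
    (\<forall>x \<in> carrier M. \<exists>c \<in> S \<rightarrow> carrier R. x = (\<Oplus>\<^bsub>M\<^esub>s\<in>S. c s \<odot>\<^bsub>M\<^esub> s)))"

definition module_hom :: "('a, 'm) ring_scheme \<Rightarrow> ('a, 'b, 'n) module_scheme \<Rightarrow>
    ('a, 'c, 'p) module_scheme \<Rightarrow> ('b \<Rightarrow> 'c) set"
  where "module_hom R M N = {f \<in> carrier M \<rightarrow> carrier N.
    (\<forall>x \<in> carrier M. \<forall>y \<in> carrier M. f (x \<oplus>\<^bsub>M\<^esub> y) = f x \<oplus>\<^bsub>N\<^esub> f y) \<and>
    (\<forall>a \<in> carrier R. \<forall>x \<in> carrier M. f (a \<odot>\<^bsub>M\<^esub> x) = a \<odot>\<^bsub>N\<^esub> f x)}"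

definition module_iso :: "('a, 'm) ring_scheme \<Rightarrow> ('a, 'b, 'n) module_scheme \<Rightarrow>
    ('a, 'c, 'p) module_scheme \<Rightarrow> ('b \<Rightarrow> 'c) set"
  where "module_iso R M N = {f \<in> module_hom R M N. bij_betw f (carrier M) (carrier N)}"

definition short_exact :: "('a, 'm) ring_scheme \<Rightarrow> ('a, 'b, 'n) module_scheme \<Rightarrow>
    ('a, 'c, 'p) module_scheme \<Rightarrow> ('a, 'd, 'q) module_scheme \<Rightarrow> ('b \<Rightarrow> 'c) \<Rightarrow> ('c \<Rightarrow> 'd) \<Rightarrow> bool"
  where "short_exact R L M N f g \<longleftrightarrow> f \<in> module_hom R L M \<and> g \<in> module_hom R M N \<and>
    inj_on f (carrier L) \<and> f ` carrier L = {x \<in> carrier M. g x = \<zero>\<^bsub>N\<^esub>} \<and>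
    g ` carrier M = carrier N"


section \<open>Torsion classes\<close>

text \<open>Finitely generated left modules are quotients of some \<open>R^n\<close>, that is, their elements can be
  taken to be cosets, which are sets of vectors \<^typ>\<open>nat \<Rightarrow> 'a\<close>. Hence the modules carried by
  \<^typ>\<open>(nat \<Rightarrow> 'a) set\<close> represent all isomorphism classes (see \<open>fg_modules_universal\<close> below), and the
  isomorphism-closed subclasses of mod R correspond to the isomorphism-closed subsets of
  \<open>fg_modules R\<close>.\<close>

definition fg_modules :: "('a, 'm) ring_scheme \<Rightarrow> ('a, (nat \<Rightarrow> 'a) set) module set"
  where "fg_modules R = {M. left_module R M \<and> fin_gen_module R M}"

lemma fg_modules_universal:
  fixes R :: "('a, 'm) ring_scheme" and M :: "('a, 'b, 'n) module_scheme"
  assumes "left_module R M" "fin_gen_module R M"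
  shows "\<exists>N \<in> fg_modules R. module_iso R M N \<noteq> {}"
proof -
  interpret left_module R M by fact
  obtain S where S: "finite S" "S \<subseteq> carrier M"
    and gen: "\<And>x. x \<in> carrier M \<Longrightarrow> \<exists>c \<in> S \<rightarrow> carrier R. x = (\<Oplus>\<^bsub>M\<^esub>s\<in>S. c s \<odot>\<^bsub>M\<^esub> s)"
    using assms(2) unfolding fin_gen_module_def by blast
  obtain e :: "'b \<Rightarrow> nat" where e: "inj_on e S"
    using finite_imp_inj_to_nat_seg[OF S(1)] by blast
  define p where "p v = (\<Oplus>\<^bsub>M\<^esub>s\<in>S. v (e s) \<odot>\<^bsub>M\<^esub> s)" for v :: "nat \<Rightarrow> 'a"
  define h where "h x = {v. (\<forall>s\<in>S. v (e s) \<in> carrier R) \<and> p v = x}" for x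
  have ne: "h x \<noteq> {}" if x: "x \<in> carrier M" for x
  proof -
    obtain c where c: "c \<in> S \<rightarrow> carrier R" "x = (\<Oplus>\<^bsub>M\<^esub>s\<in>S. c s \<odot>\<^bsub>M\<^esub> s)"
      using gen[OF x] by blast
    have "p (\<lambda>n. c (inv_into S e n)) = x"
      unfolding p_def c(2) using c(1) S(2) e
      by (intro M.finsum_cong') (auto intro!: smult_closed)
    then show ?thesis
      using c(1) e unfolding h_def by (auto intro!: exI[of _ "\<lambda>n. c (inv_into S e n)"])
  qed
  have inj: "inj_on h (carrier M)"
    using ne by (fastforce simp: inj_on_def h_def)
  define g where "g = the_inv_into (carrier M) h"
  have gh[simp]: "g (h x) = x" if "x \<in> carrier M" for x
    unfolding g_def using the_inv_into_f_f[OF inj that] .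
  define N :: "('a, (nat \<Rightarrow> 'a) set) module" where
    "N = \<lparr>carrier = h ` carrier M, monoid.mult = undefined, one = undefined, ring.zero = h \<zero>\<^bsub>M\<^esub>,
      add = (\<lambda>u w. h (g u \<oplus>\<^bsub>M\<^esub> g w)), smult = (\<lambda>a u. h (a \<odot>\<^bsub>M\<^esub> g u))\<rparr>"
  note [simp] = smult_closed
  have N: "abelian_group N"
  proof (rule abelian_groupI)
    fix u assume "u \<in> carrier N"
    then obtain x where "x \<in> carrier M" "u = h x" by (auto simp: N_def)
    then show "\<exists>w\<in>carrier N. w \<oplus>\<^bsub>N\<^esub> u = \<zero>\<^bsub>N\<^esub>"
      by (intro bexI[of _ "h (\<ominus>\<^bsub>M\<^esub> x)"]) (auto simp: N_def M.l_neg)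
  qed (auto simp: N_def M.a_ac)
  have LN: "left_module R N"
    by (intro left_module.intro N left_module_axioms.intro R.ring_axioms)
      (auto simp: N_def smult_l_distr smult_r_distr smult_assoc1 smult_one)
  interpret N: abelian_group N by fact
  have hom: "h \<in> module_hom R M N"
    by (auto simp: module_hom_def N_def)
  have iso: "h \<in> module_iso R M N"
    using hom inj by (auto simp: module_iso_def bij_betw_def N_def)
  have sum: "h (\<Oplus>\<^bsub>M\<^esub>s\<in>F. f s) = (\<Oplus>\<^bsub>N\<^esub>s\<in>F. h (f s))"
    if "finite F" "f \<in> F \<rightarrow> carrier M" for F :: "'b set" and f
    using that
  proof (induction F)
    case empty
    have "h \<zero>\<^bsub>M\<^esub> = \<zero>\<^bsub>N\<^esub>" by (simp add: N_def)
    then show ?case by simp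
  next
    case (insert s F)
    moreover have "h (x \<oplus>\<^bsub>M\<^esub> y) = h x \<oplus>\<^bsub>N\<^esub> h y" if "x \<in> carrier M" "y \<in> carrier M" for x y
      using that by (simp add: N_def)
    moreover have "(\<lambda>s. h (f s)) \<in> insert s F \<rightarrow> carrier N"
      using insert.prems by (auto simp: N_def)
    ultimately show ?case
      by (simp add: Pi_iff)
  qed
  have "fin_gen_module R N"
    unfolding fin_gen_module_def
  proof (intro exI[of _ "h ` S"] conjI ballI)
    show "h ` S \<subseteq> carrier N" using S(2) by (auto simp: N_def)
    fix u assume "u \<in> carrier N"
    then obtain x where x: "x \<in> carrier M" "u = h x" by (auto simp: N_def)
    obtain c where c: "c \<in> S \<rightarrow> carrier R" "x = (\<Oplus>\<^bsub>M\<^esub>s\<in>S. c s \<odot>\<^bsub>M\<^esub> s)"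
      using gen[OF x(1)] by blast
    have "inj_on h S" using inj S(2) by (rule inj_on_subset)
    have "u = (\<Oplus>\<^bsub>N\<^esub>s\<in>S. h (c s \<odot>\<^bsub>M\<^esub> s))"
      unfolding x(2) c(2) using c(1) S by (intro sum) (auto simp: subset_iff Pi_iff)
    also have "\<dots> = (\<Oplus>\<^bsub>N\<^esub>s\<in>S. c (g (h s)) \<odot>\<^bsub>N\<^esub> h s)"
      using c(1) S(2) by (intro N.finsum_cong') (auto simp: N_def subset_iff Pi_iff)
    also have "\<dots> = (\<Oplus>\<^bsub>N\<^esub>w\<in>h ` S. c (g w) \<odot>\<^bsub>N\<^esub> w)"
      using c(1) S(2) \<open>inj_on h S\<close>
      by (intro N.finsum_reindex[symmetric]) (auto simp: N_def subset_iff Pi_iff)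
    finally show "\<exists>d\<in>h ` S \<rightarrow> carrier R. u = (\<Oplus>\<^bsub>N\<^esub>w\<in>h ` S. d w \<odot>\<^bsub>N\<^esub> w)"
      using c(1) S(2) by (intro bexI[of _ "\<lambda>w. c (g w)"]) (auto simp: subset_iff Pi_iff)
  qed (use S(1) in simp)
  with LN iso show ?thesis by (auto simp: fg_modules_def)
qed

text \<open>Factor modules of \<open>M\<close> are rendered as targets of surjective homomorphisms from \<open>M\<close>.\<close>

definition torsion_class :: "('a, 'm) ring_scheme \<Rightarrow> ('a, (nat \<Rightarrow> 'a) set) module set \<Rightarrow> bool"
  where "torsion_class R T \<longleftrightarrow> T \<subseteq> fg_modules R \<and> T \<noteq> {} \<and>
    (\<forall>M \<in> T. \<forall>N \<in> fg_modules R. module_iso R M N \<noteq> {} \<longrightarrow> N \<in> T) \<and>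
    (\<forall>M \<in> T. \<forall>N \<in> fg_modules R.
      (\<exists>f \<in> module_hom R M N. f ` carrier M = carrier N) \<longrightarrow> N \<in> T) \<and>
    (\<forall>L \<in> T. \<forall>N \<in> T. \<forall>M \<in> fg_modules R. (\<exists>f g. short_exact R L M N f g) \<longrightarrow> M \<in> T)"

definition tors :: "('a, 'm) ring_scheme \<Rightarrow> ('a, (nat \<Rightarrow> 'a) set) module set set"
  where "tors R = {T. torsion_class R T}"


section \<open>Algebras over a commutative ring\<close>

text \<open>An \<open>R\<close>-algebra is a ring with a structure homomorphism from \<open>R\<close> into its centre; this is
  its underlying \<open>R\<close>-module.\<close>

definition alg_module :: "('b, 'n) ring_scheme \<Rightarrow> ('a \<Rightarrow> 'b) \<Rightarrow> ('a, 'b) module"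
  where "alg_module \<Lambda> \<phi> = \<lparr>carrier = carrier \<Lambda>, monoid.mult = monoid.mult \<Lambda>, one = one \<Lambda>,
    ring.zero = ring.zero \<Lambda>, add = add \<Lambda>, smult = (\<lambda>r x. \<phi> r \<otimes>\<^bsub>\<Lambda>\<^esub> x)\<rparr>"

locale module_finite_algebra = cring R + ring_hom_ring R \<Lambda> \<phi>
  for R (structure) and \<Lambda> (structure) and \<phi> +
  assumes central: "\<lbrakk> r \<in> carrier R; x \<in> carrier \<Lambda> \<rbrakk> \<Longrightarrow> \<phi> r \<otimes>\<^bsub>\<Lambda>\<^esub> x = x \<otimes>\<^bsub>\<Lambda>\<^esub> \<phi> r"
    and fin_gen: "fin_gen_module R (alg_module \<Lambda> \<phi>)"

text \<open>\<open>I\<Lambda>\<close>, the set of finite sums of products \<open>\<phi> a \<otimes> x\<close> with \<open>a \<in> I\<close> and \<open>x \<in> \<Lambda>\<close>.\<close>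

definition extend_ideal :: "('b, 'n) ring_scheme \<Rightarrow> ('a \<Rightarrow> 'b) \<Rightarrow> 'a set \<Rightarrow> 'b set"
  where "extend_ideal \<Lambda> \<phi> I = ideal_prod \<Lambda> (\<phi> ` I) (carrier \<Lambda>)"

text \<open>The tensor product \<open>B \<otimes>\<^sub>R C\<close> of two \<open>R\<close>-algebras with structure maps \<open>\<beta>\<close> and \<open>\<gamma>\<close> is the free
  abelian group on \<open>B \<times> C\<close> modulo the subgroup generated by the bilinearity relations. The product
  \<open>(b \<otimes> c)(b' \<otimes> c') = bb' \<otimes> cc'\<close> is already defined, by biadditive extension, on the free abelian
  group, which it turns into a ring; the relations span an ideal of that ring.\<close>

definition tensor_free :: "('b, 'n) ring_scheme \<Rightarrow> ('c, 'p) ring_scheme \<Rightarrow> ('b \<times> 'c \<Rightarrow>\<^sub>0 int) ring"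
  where "tensor_free B C =
    \<lparr>carrier = carrier (free_Abelian_group (carrier B \<times> carrier C)),
     monoid.mult = (\<lambda>u v. frag_extend (\<lambda>(b, c). frag_extend (\<lambda>(b', c').
       frag_of (b \<otimes>\<^bsub>B\<^esub> b', c \<otimes>\<^bsub>C\<^esub> c')) v) u),
     one = frag_of (\<one>\<^bsub>B\<^esub>, \<one>\<^bsub>C\<^esub>), ring.zero = 0, add = (+)\<rparr>"

definition tensor_relations :: "('a, 'm) ring_scheme \<Rightarrow> ('b, 'n) ring_scheme \<Rightarrow>
    ('c, 'p) ring_scheme \<Rightarrow> ('a \<Rightarrow> 'b) \<Rightarrow> ('a \<Rightarrow> 'c) \<Rightarrow> ('b \<times> 'c \<Rightarrow>\<^sub>0 int) set"
  where "tensor_relations R B C \<beta> \<gamma> =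
    {frag_of (b \<oplus>\<^bsub>B\<^esub> b', c) - frag_of (b, c) - frag_of (b', c) | b b' c.
      b \<in> carrier B \<and> b' \<in> carrier B \<and> c \<in> carrier C} \<union>
    {frag_of (b, c \<oplus>\<^bsub>C\<^esub> c') - frag_of (b, c) - frag_of (b, c') | b c c'.
      b \<in> carrier B \<and> c \<in> carrier C \<and> c' \<in> carrier C} \<union>
    {frag_of (\<beta> r \<otimes>\<^bsub>B\<^esub> b, c) - frag_of (b, \<gamma> r \<otimes>\<^bsub>C\<^esub> c) | r b c.
      r \<in> carrier R \<and> b \<in> carrier B \<and> c \<in> carrier C}"

definition tensor_algebra :: "('a, 'm) ring_scheme \<Rightarrow> ('b, 'n) ring_scheme \<Rightarrow>
    ('c, 'p) ring_scheme \<Rightarrow> ('a \<Rightarrow> 'b) \<Rightarrow> ('a \<Rightarrow> 'c) \<Rightarrow> ('b \<times> 'c \<Rightarrow>\<^sub>0 int) set ring"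
  where "tensor_algebra R B C \<beta> \<gamma> = tensor_free B C Quot
    generate (add_monoid (tensor_free B C)) (tensor_relations R B C \<beta> \<gamma>)"

end

theory Submission
  imports Defs
begin


text \<open>
  Write \<open>\<Gamma>\<close> for either of the \<open>\<Lambda>\<close>-rings \<open>\<Lambda> / \<mm>\<Lambda>\<close> and \<open>A = K \<otimes>\<^sub>R \<Lambda>\<close>. A torsion class \<open>T\<close> of \<open>\<Lambda>\<close> extends
  to the class of all \<open>\<Gamma>\<close>-modules that are generated by a \<open>\<Lambda>\<close>-submodule belonging to \<open>T\<close>
  (\<open>extended_class\<close>), and a torsion class \<open>U\<close> of \<open>\<Gamma>\<close> contracts to the class of all \<open>Y\<close> with
  \<open>\<Gamma> \<otimes>\<^sub>\<Lambda> Y \<in> U\<close> (\<open>contracted_class\<close>).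

  If \<open>tors \<Lambda>\<close> is finite, so is \<open>tors \<Gamma>\<close>: contractions are torsion classes because
  \<open>\<Gamma> \<otimes>\<^sub>\<Lambda> -\<close> is right exact (\<open>torsion_class_contracted\<close>), and the extension of the contraction of
  \<open>U\<close> is \<open>U\<close> because every finitely generated \<open>\<Gamma>\<close>-module has the form \<open>\<Gamma> \<otimes>\<^sub>\<Lambda> W\<close> for a finitely generated
  \<open>\<Lambda>\<close>-module \<open>W\<close> (\<open>finite_tors_of_scalar_extension\<close>). So extension maps \<open>tors \<Lambda>\<close> to a set that
  includes \<open>tors \<Gamma>\<close>.

  Conversely, extensions of torsion classes are torsion classes (\<open>torsion_class_extended_surj\<close>,
  \<open>torsion_class_extended_localization\<close>), and \<open>T\<close> is determined by its two extensions
  (\<open>torsion_class_le_if_extended_le\<close>), so that \<open>tors \<Lambda>\<close> embeds into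
  \<open>tors (\<Lambda> / \<mm>\<Lambda>) \<times> tors A\<close>. The reason is that a finitely generated \<open>\<Lambda>\<close>-module \<open>Y\<close> lies in \<open>T\<close> if and
  only if \<open>Y / \<mm>Y\<close> lies in \<open>T\<close> and \<open>K \<otimes> Y\<close> is generated by a module \<open>Z\<close> in \<open>T\<close>. Indeed, after
  multiplication by a nonzero element of \<open>R\<close> the module \<open>Z\<close> maps onto a submodule \<open>D \<in> T\<close> of \<open>Y\<close> with
  torsion quotient, so that \<open>Y / D\<close> is a factor module of \<open>Y / s Y\<close> for some nonzero \<open>s \<in> R\<close>. The only
  nonzero prime ideal of \<open>R\<close> is \<open>\<mm>\<close>, and noetherian induction on \<open>I\<close> shows that \<open>Y / I Y\<close> belongs to
  \<open>T\<close> for every nonzero ideal \<open>I\<close> as soon as \<open>Y / \<mm>Y\<close> does (\<open>subquot_in_ideal_smult\<close>).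

  Finite generation of \<open>\<Lambda>\<close> over \<open>R\<close> is used to see that a torsion quotient \<open>L / U\<close> is annihilated by a
  single nonzero element of \<open>R\<close> when \<open>L\<close> is a submodule of a finitely generated \<open>\<Lambda>\<close>-module
  (\<open>bounded_torsion\<close>). Tensor products with modules are avoided: \<open>\<Gamma> \<otimes>\<^sub>\<Lambda> Y\<close> is replaced by the
  \<open>\<Gamma>\<close>-modules generated by an image of \<open>Y\<close>, and \<open>K \<otimes> Y\<close> by a localization of \<open>Y\<close> on which \<open>A\<close>
  acts (\<open>localization_exists\<close>).
\<close>

section \<open>Submodules, homomorphisms and quotients of left modules\<close>

context left_module
begin

lemma smult_zero_left: "x \<in> carrier M \<Longrightarrow> \<zero> \<odot>\<^bsub>M\<^esub> x = \<zero>\<^bsub>M\<^esub>"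
  using smult_l_distr[of \<zero> \<zero> x] smult_closed[of \<zero> x] M.add.l_cancel_one' by auto

lemma smult_zero_right: "a \<in> carrier R \<Longrightarrow> a \<odot>\<^bsub>M\<^esub> \<zero>\<^bsub>M\<^esub> = \<zero>\<^bsub>M\<^esub>"
  using smult_r_distr[of a "\<zero>\<^bsub>M\<^esub>" "\<zero>\<^bsub>M\<^esub>"] smult_closed[of a "\<zero>\<^bsub>M\<^esub>"] M.add.l_cancel_one' by auto

lemma add_smult_minus_one: "x \<in> carrier M \<Longrightarrow> x \<oplus>\<^bsub>M\<^esub> (\<ominus> \<one>) \<odot>\<^bsub>M\<^esub> x = \<zero>\<^bsub>M\<^esub>"
  by (metis R.r_neg R.one_closed R.a_inv_closed smult_l_distr smult_one smult_zero_left)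

end

text \<open>Closure under negation is omitted, since \<open>- x = (- 1) x\<close>. The submodule as a module of its own is
  \<open>M\<lparr>carrier := H\<rparr>\<close>.\<close>

definition left_submodule :: "('a, 'm) ring_scheme \<Rightarrow> ('a, 'b, 'n) module_scheme \<Rightarrow> 'b set \<Rightarrow> bool"
  where "left_submodule R M H \<longleftrightarrow> H \<subseteq> carrier M \<and> \<zero>\<^bsub>M\<^esub> \<in> H \<and>
    (\<forall>x\<in>H. \<forall>y\<in>H. x \<oplus>\<^bsub>M\<^esub> y \<in> H) \<and> (\<forall>a\<in>carrier R. \<forall>x\<in>H. a \<odot>\<^bsub>M\<^esub> x \<in> H)"

lemma left_submoduleI:
  assumes "\<And>x. x \<in> H \<Longrightarrow> x \<in> carrier M" "\<zero>\<^bsub>M\<^esub> \<in> H"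
    "\<And>x y. \<lbrakk>x \<in> H; y \<in> H\<rbrakk> \<Longrightarrow> x \<oplus>\<^bsub>M\<^esub> y \<in> H"
    "\<And>a x. \<lbrakk>a \<in> carrier R; x \<in> H\<rbrakk> \<Longrightarrow> a \<odot>\<^bsub>M\<^esub> x \<in> H"
  shows "left_submodule R M H"
  using assms by (auto simp: left_submodule_def)

lemma left_submoduleD:
  assumes "left_submodule R M H"
  shows "x \<in> H \<Longrightarrow> x \<in> carrier M" "\<zero>\<^bsub>M\<^esub> \<in> H" "\<lbrakk>x \<in> H; y \<in> H\<rbrakk> \<Longrightarrow> x \<oplus>\<^bsub>M\<^esub> y \<in> H"
    "\<lbrakk>a \<in> carrier R; x \<in> H\<rbrakk> \<Longrightarrow> a \<odot>\<^bsub>M\<^esub> x \<in> H"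
  using assms by (auto simp: left_submodule_def)

lemma left_submodule_carrier:
  "left_module R M \<Longrightarrow> left_submodule R M (carrier M)"
proof -
  assume "left_module R M"
  then interpret left_module R M .
  show ?thesis by (auto simp: left_submodule_def smult_closed)
qed

lemma left_submodule_zero:
  "left_module R M \<Longrightarrow> left_submodule R M {\<zero>\<^bsub>M\<^esub>}"
proof -
  assume "left_module R M"
  then interpret left_module R M .
  show ?thesis by (auto simp: left_submodule_def smult_zero_right)
qed

lemma left_submodule_Int:
  "\<lbrakk>left_submodule R M H; left_submodule R M H'\<rbrakk> \<Longrightarrow> left_submodule R M (H \<inter> H')"
  by (auto simp: left_submodule_def)

lemma left_module_restrict:
  assumes "left_module R M" "left_submodule R M H"
  shows "left_module R (M\<lparr>carrier := H\<rparr>)"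
proof -
  interpret left_module R M by fact
  note D = left_submoduleD[OF assms(2)]
  have "abelian_group (M\<lparr>carrier := H\<rparr>)"
  proof (rule abelian_groupI)
    fix x assume "x \<in> carrier (M\<lparr>carrier := H\<rparr>)"
    then have "x \<in> H" by simp
    then show "\<exists>y\<in>carrier (M\<lparr>carrier := H\<rparr>). y \<oplus>\<^bsub>M\<lparr>carrier := H\<rparr>\<^esub> x = \<zero>\<^bsub>M\<lparr>carrier := H\<rparr>\<^esub>"
      using D add_smult_minus_one[of x]
      by (intro bexI[of _ "(\<ominus>\<^bsub>R\<^esub> \<one>\<^bsub>R\<^esub>) \<odot>\<^bsub>M\<^esub> x"]) (auto simp: M.a_comm)
  qed (use D in \<open>auto simp: M.a_ac\<close>)
  then show ?thesis
    by (intro left_module.intro left_module_axioms.intro R.ring_axioms)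
      (use D in \<open>auto simp: smult_l_distr smult_r_distr smult_assoc1 smult_one\<close>)
qed

lemma left_submodule_restrict_iff:
  assumes "left_submodule R M H"
  shows "left_submodule R (M\<lparr>carrier := H\<rparr>) H' \<longleftrightarrow> left_submodule R M H' \<and> H' \<subseteq> H"
  using left_submoduleD(1)[OF assms] by (auto simp: left_submodule_def)

lemma module_homI:
  assumes "\<And>x. x \<in> carrier M \<Longrightarrow> f x \<in> carrier N"
    "\<And>x y. \<lbrakk>x \<in> carrier M; y \<in> carrier M\<rbrakk> \<Longrightarrow> f (x \<oplus>\<^bsub>M\<^esub> y) = f x \<oplus>\<^bsub>N\<^esub> f y"
    "\<And>a x. \<lbrakk>a \<in> carrier R; x \<in> carrier M\<rbrakk> \<Longrightarrow> f (a \<odot>\<^bsub>M\<^esub> x) = a \<odot>\<^bsub>N\<^esub> f x"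
  shows "f \<in> module_hom R M N"
  using assms by (auto simp: module_hom_def)

lemma module_homD:
  assumes "f \<in> module_hom R M N"
  shows "x \<in> carrier M \<Longrightarrow> f x \<in> carrier N"
    "\<lbrakk>x \<in> carrier M; y \<in> carrier M\<rbrakk> \<Longrightarrow> f (x \<oplus>\<^bsub>M\<^esub> y) = f x \<oplus>\<^bsub>N\<^esub> f y"
    "\<lbrakk>a \<in> carrier R; x \<in> carrier M\<rbrakk> \<Longrightarrow> f (a \<odot>\<^bsub>M\<^esub> x) = a \<odot>\<^bsub>N\<^esub> f x"
  using assms by (auto simp: module_hom_def)

lemma module_hom_zero:
  assumes "left_module R M" "left_module R N" "f \<in> module_hom R M N"
  shows "f \<zero>\<^bsub>M\<^esub> = \<zero>\<^bsub>N\<^esub>"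
proof -
  interpret M: left_module R M by fact
  interpret N: left_module R N by fact
  show ?thesis
    using module_homD[OF assms(3)] M.smult_zero_left[of "\<zero>\<^bsub>M\<^esub>"] N.smult_zero_left
    by (metis M.M.zero_closed M.R.zero_closed)
qed

lemma module_hom_compose:
  "\<lbrakk>f \<in> module_hom R L M; g \<in> module_hom R M N\<rbrakk> \<Longrightarrow> (\<lambda>x. g (f x)) \<in> module_hom R L N"
  by (auto simp: module_hom_def Pi_iff)

lemma module_hom_restrict:
  "\<lbrakk>f \<in> module_hom R M N; left_submodule R M H\<rbrakk> \<Longrightarrow> f \<in> module_hom R (M\<lparr>carrier := H\<rparr>) N"
  by (intro module_homI) (simp_all add: module_homD left_submoduleD)

lemma module_hom_restrict_target:
  "\<lbrakk>f \<in> module_hom R M N; f ` carrier M \<subseteq> H\<rbrakk> \<Longrightarrow> f \<in> module_hom R M (N\<lparr>carrier := H\<rparr>)"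
  by (auto simp: module_hom_def Pi_iff)

lemma module_hom_id_restrict:
  "H \<subseteq> carrier M \<Longrightarrow> (\<lambda>x. x) \<in> module_hom R (M\<lparr>carrier := H\<rparr>) M"
  by (auto simp: module_hom_def)

lemma left_submodule_image:
  assumes "left_module R M" "left_module R N" "f \<in> module_hom R M N" "left_submodule R M H"
  shows "left_submodule R N (f ` H)"
proof -
  note f = module_homD[OF assms(3)] and D = left_submoduleD[OF assms(4)]
  show ?thesis
  proof (rule left_submoduleI)
    show "\<zero>\<^bsub>N\<^esub> \<in> f ` H"
      using module_hom_zero[OF assms(1-3)] D(2) by force
    fix x y assume "x \<in> f ` H" "y \<in> f ` H"
    then obtain u v where "u \<in> H" "v \<in> H" "x = f u" "y = f v" by blast
    then show "x \<oplus>\<^bsub>N\<^esub> y \<in> f ` H"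
      using f(2)[of u v] D(1,3) by (metis image_eqI)
  next
    fix a x assume "a \<in> carrier R" "x \<in> f ` H"
    then obtain u where "a \<in> carrier R" "u \<in> H" "x = f u" by blast
    then show "a \<odot>\<^bsub>N\<^esub> x \<in> f ` H"
      using f(3)[of a u] D(1,4) by (metis image_eqI)
  qed (use f D in auto)
qed

lemma left_submodule_vimage:
  assumes "left_module R M" "left_module R N" "f \<in> module_hom R M N" "left_submodule R N H"
  shows "left_submodule R M {x \<in> carrier M. f x \<in> H}"
proof -
  interpret M: left_module R M by fact
  note f = module_homD[OF assms(3)] and D = left_submoduleD[OF assms(4)]
  show ?thesis
    using f D module_hom_zero[OF assms(1-3)]
    by (intro left_submoduleI) (auto simp: M.smult_closed)
qed

text \<open>The least submodule containing \<open>S\<close>.\<close>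

definition lspan :: "('a, 'm) ring_scheme \<Rightarrow> ('a, 'b, 'n) module_scheme \<Rightarrow> 'b set \<Rightarrow> 'b set"
  where "lspan R M S = \<Inter>{H. left_submodule R M H \<and> S \<subseteq> H}"

lemma lspan_minimal: "\<lbrakk>left_submodule R M H; S \<subseteq> H\<rbrakk> \<Longrightarrow> lspan R M S \<subseteq> H"
  by (auto simp: lspan_def)

lemma lspan_superset: "S \<subseteq> lspan R M S"
  by (auto simp: lspan_def)

lemma left_submodule_lspan:
  assumes "left_module R M" "S \<subseteq> carrier M"
  shows "left_submodule R M (lspan R M S)"
  unfolding left_submodule_def
proof (intro conjI)
  show "lspan R M S \<subseteq> carrier M"
    using lspan_minimal[OF left_submodule_carrier[OF assms(1)] assms(2)] .
qed (auto simp: lspan_def left_submodule_def)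

lemma lspan_restrict:
  assumes "left_module R M" "left_submodule R M H" "S \<subseteq> H"
  shows "lspan R (M\<lparr>carrier := H\<rparr>) S = lspan R M S"
proof
  have "S \<subseteq> carrier M" using assms(2,3) by (auto simp: left_submodule_def)
  then show "lspan R (M\<lparr>carrier := H\<rparr>) S \<subseteq> lspan R M S"
    using left_submodule_lspan[OF assms(1)] lspan_superset[of S R M] lspan_minimal[OF assms(2,3)]
    by (intro lspan_minimal) (auto simp: left_submodule_restrict_iff[OF assms(2)])
  show "lspan R M S \<subseteq> lspan R (M\<lparr>carrier := H\<rparr>) S"
    unfolding lspan_def left_submodule_restrict_iff[OF assms(2)] by blast
qed

lemma left_submodule_add:
  assumes "left_module R M" "left_submodule R M H" "left_submodule R M H'"
  shows "left_submodule R M {x \<oplus>\<^bsub>M\<^esub> y | x y. x \<in> H \<and> y \<in> H'}"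
proof -
  interpret left_module R M by fact
  note D = left_submoduleD[OF assms(2)] left_submoduleD[OF assms(3)]
  show ?thesis
  proof (rule left_submoduleI)
    show "\<zero>\<^bsub>M\<^esub> \<in> {x \<oplus>\<^bsub>M\<^esub> y | x y. x \<in> H \<and> y \<in> H'}"
      using D by (intro CollectI exI[of _ "\<zero>\<^bsub>M\<^esub>"]) auto
    fix u v assume "u \<in> {x \<oplus>\<^bsub>M\<^esub> y | x y. x \<in> H \<and> y \<in> H'}" "v \<in> {x \<oplus>\<^bsub>M\<^esub> y | x y. x \<in> H \<and> y \<in> H'}"
    then obtain x y x' y' where *: "x \<in> H" "y \<in> H'" "x' \<in> H" "y' \<in> H'"
      "u = x \<oplus>\<^bsub>M\<^esub> y" "v = x' \<oplus>\<^bsub>M\<^esub> y'" by blast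
    then have "u \<oplus>\<^bsub>M\<^esub> v = (x \<oplus>\<^bsub>M\<^esub> x') \<oplus>\<^bsub>M\<^esub> (y \<oplus>\<^bsub>M\<^esub> y')"
      using D by (simp add: M.a_ac)
    then show "u \<oplus>\<^bsub>M\<^esub> v \<in> {x \<oplus>\<^bsub>M\<^esub> y | x y. x \<in> H \<and> y \<in> H'}"
      using * D by (intro CollectI exI[of _ "x \<oplus>\<^bsub>M\<^esub> x'"] exI[of _ "y \<oplus>\<^bsub>M\<^esub> y'"]) simp
  next
    fix a u assume "a \<in> carrier R" "u \<in> {x \<oplus>\<^bsub>M\<^esub> y | x y. x \<in> H \<and> y \<in> H'}"
    then show "a \<odot>\<^bsub>M\<^esub> u \<in> {x \<oplus>\<^bsub>M\<^esub> y | x y. x \<in> H \<and> y \<in> H'}"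
      using D by (force simp: smult_r_distr)
  qed (use D in auto)
qed

lemma left_submodule_cyclic:
  assumes "left_module R M" "w \<in> carrier M"
  shows "left_submodule R M {a \<odot>\<^bsub>M\<^esub> w | a. a \<in> carrier R}"
proof -
  interpret left_module R M by fact
  show ?thesis
  proof (rule left_submoduleI)
    show "\<zero>\<^bsub>M\<^esub> \<in> {a \<odot>\<^bsub>M\<^esub> w | a. a \<in> carrier R}"
      using smult_zero_left[OF assms(2)] by (metis (mono_tags, lifting) R.zero_closed mem_Collect_eq)
    fix x y assume "x \<in> {a \<odot>\<^bsub>M\<^esub> w | a. a \<in> carrier R}" "y \<in> {a \<odot>\<^bsub>M\<^esub> w | a. a \<in> carrier R}"
    then obtain a b where "a \<in> carrier R" "b \<in> carrier R" "x = a \<odot>\<^bsub>M\<^esub> w" "y = b \<odot>\<^bsub>M\<^esub> w" by blast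
    then show "x \<oplus>\<^bsub>M\<^esub> y \<in> {a \<odot>\<^bsub>M\<^esub> w | a. a \<in> carrier R}"
      using smult_l_distr[of a b w] assms(2) by (metis (mono_tags, lifting) R.a_closed mem_Collect_eq)
  next
    fix a x assume "a \<in> carrier R" "x \<in> {a \<odot>\<^bsub>M\<^esub> w | a. a \<in> carrier R}"
    then obtain b where "a \<in> carrier R" "b \<in> carrier R" "x = b \<odot>\<^bsub>M\<^esub> w" by blast
    then show "a \<odot>\<^bsub>M\<^esub> x \<in> {a \<odot>\<^bsub>M\<^esub> w | a. a \<in> carrier R}"
      using smult_assoc1[of a b w] assms(2) by (metis (mono_tags, lifting) R.m_closed mem_Collect_eq)
  qed (use assms smult_closed in auto)
qed

lemma lspan_insert:
  assumes "left_module R M" "w \<in> carrier M" "S \<subseteq> carrier M"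
  shows "lspan R M (insert w S) = {y \<oplus>\<^bsub>M\<^esub> a \<odot>\<^bsub>M\<^esub> w | y a. y \<in> lspan R M S \<and> a \<in> carrier R}"
    (is "_ = ?H")
proof
  interpret left_module R M by fact
  note L = left_submodule_lspan[OF assms(1,3)]
  have "left_submodule R M {x \<oplus>\<^bsub>M\<^esub> y | x y. x \<in> lspan R M S \<and> y \<in> {a \<odot>\<^bsub>M\<^esub> w | a. a \<in> carrier R}}"
    by (rule left_submodule_add[OF assms(1) L left_submodule_cyclic[OF assms(1,2)]])
  also have "{x \<oplus>\<^bsub>M\<^esub> y | x y. x \<in> lspan R M S \<and> y \<in> {a \<odot>\<^bsub>M\<^esub> w | a. a \<in> carrier R}} = ?H" by blast
  finally have H: "left_submodule R M ?H" .
  have "w = \<zero>\<^bsub>M\<^esub> \<oplus>\<^bsub>M\<^esub> \<one>\<^bsub>R\<^esub> \<odot>\<^bsub>M\<^esub> w" using assms(2) by (simp add: smult_one)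
  then have "w \<in> ?H" using left_submoduleD(2)[OF L] by blast
  moreover have "s \<in> ?H" if "s \<in> S" for s
  proof -
    have "s = s \<oplus>\<^bsub>M\<^esub> \<zero>\<^bsub>R\<^esub> \<odot>\<^bsub>M\<^esub> w" using that assms by (auto simp: smult_zero_left)
    then show ?thesis using that lspan_superset[of S R M] by blast
  qed
  ultimately show "lspan R M (insert w S) \<subseteq> ?H"
    by (intro lspan_minimal[OF H]) auto
  note L' = left_submoduleD[OF left_submodule_lspan[OF assms(1), of "insert w S"]]
  have "lspan R M S \<subseteq> lspan R M (insert w S)" by (auto simp: lspan_def)
  moreover have "w \<in> lspan R M (insert w S)" using lspan_superset[of "insert w S" R M] by blast
  ultimately show "?H \<subseteq> lspan R M (insert w S)"
    using L' assms(2,3) by auto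
qed

text \<open>Every linear combination lies in the span by induction on the finite index set, and
  conversely the linear combinations of \<open>S\<close> form a submodule.\<close>

lemma fin_gen_module_iff:
  assumes "left_module R M"
  shows "fin_gen_module R M \<longleftrightarrow> (\<exists>S. finite S \<and> S \<subseteq> carrier M \<and> lspan R M S = carrier M)"
proof -
  interpret left_module R M by fact
  have "lspan R M S = {\<Oplus>\<^bsub>M\<^esub>s\<in>S. c s \<odot>\<^bsub>M\<^esub> s | c. c \<in> S \<rightarrow> carrier R}"
    if "finite S" "S \<subseteq> carrier M" for S
    using that
  proof (induction S)
    case empty
    have "lspan R M {} = {\<zero>\<^bsub>M\<^esub>}"
      using left_submodule_zero[OF assms] left_submoduleD(2)[of R M]
      by (auto simp: lspan_def)
    then show ?case by simp
  next
    case (insert w S)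
    then have wS: "w \<in> carrier M" "S \<subseteq> carrier M" by auto
    have sum: "(\<Oplus>\<^bsub>M\<^esub>s\<in>insert w S. c s \<odot>\<^bsub>M\<^esub> s) = (\<Oplus>\<^bsub>M\<^esub>s\<in>S. c s \<odot>\<^bsub>M\<^esub> s) \<oplus>\<^bsub>M\<^esub> c w \<odot>\<^bsub>M\<^esub> w"
      if "c \<in> insert w S \<rightarrow> carrier R" for c
    proof -
      have "(\<Oplus>\<^bsub>M\<^esub>s\<in>insert w S. c s \<odot>\<^bsub>M\<^esub> s) = c w \<odot>\<^bsub>M\<^esub> w \<oplus>\<^bsub>M\<^esub> (\<Oplus>\<^bsub>M\<^esub>s\<in>S. c s \<odot>\<^bsub>M\<^esub> s)"
        using that insert by (intro M.finsum_insert) (auto intro!: smult_closed)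
      also have "\<dots> = (\<Oplus>\<^bsub>M\<^esub>s\<in>S. c s \<odot>\<^bsub>M\<^esub> s) \<oplus>\<^bsub>M\<^esub> c w \<odot>\<^bsub>M\<^esub> w"
        using that insert by (intro M.a_comm M.finsum_closed) (auto intro!: smult_closed)
      finally show ?thesis .
    qed
    have upd: "(\<Oplus>\<^bsub>M\<^esub>s\<in>S. (c(w := a)) s \<odot>\<^bsub>M\<^esub> s) = (\<Oplus>\<^bsub>M\<^esub>s\<in>S. c s \<odot>\<^bsub>M\<^esub> s)"
      if "c \<in> S \<rightarrow> carrier R" for c a
      using that insert by (intro M.finsum_cong') (auto intro!: smult_closed)
    show ?case
    proof (intro Set.set_eqI iffI)
      fix x assume "x \<in> lspan R M (insert w S)"
      then obtain y a where "y \<in> lspan R M S" "a \<in> carrier R" "x = y \<oplus>\<^bsub>M\<^esub> a \<odot>\<^bsub>M\<^esub> w"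
        using lspan_insert[OF assms wS] by auto
      then obtain c where c: "c \<in> S \<rightarrow> carrier R" "x = (\<Oplus>\<^bsub>M\<^esub>s\<in>S. c s \<odot>\<^bsub>M\<^esub> s) \<oplus>\<^bsub>M\<^esub> a \<odot>\<^bsub>M\<^esub> w"
        "a \<in> carrier R"
        using insert by auto
      then have c': "c(w := a) \<in> insert w S \<rightarrow> carrier R" by auto
      have "x = (\<Oplus>\<^bsub>M\<^esub>s\<in>insert w S. (c(w := a)) s \<odot>\<^bsub>M\<^esub> s)"
        unfolding sum[OF c'] upd[OF c(1)] using c by simp
      then show "x \<in> {\<Oplus>\<^bsub>M\<^esub>s\<in>insert w S. c s \<odot>\<^bsub>M\<^esub> s | c. c \<in> insert w S \<rightarrow> carrier R}"
        using c' by blast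
    next
      fix x assume "x \<in> {\<Oplus>\<^bsub>M\<^esub>s\<in>insert w S. c s \<odot>\<^bsub>M\<^esub> s | c. c \<in> insert w S \<rightarrow> carrier R}"
      then obtain c where c: "c \<in> insert w S \<rightarrow> carrier R"
        "x = (\<Oplus>\<^bsub>M\<^esub>s\<in>S. c s \<odot>\<^bsub>M\<^esub> s) \<oplus>\<^bsub>M\<^esub> c w \<odot>\<^bsub>M\<^esub> w"
        using sum by auto
      then have "(\<Oplus>\<^bsub>M\<^esub>s\<in>S. c s \<odot>\<^bsub>M\<^esub> s) \<in> lspan R M S" "c w \<in> carrier R"
        using insert by auto
      then show "x \<in> lspan R M (insert w S)"
        using lspan_insert[OF assms wS] c(2) by blast
    qed
  qed note span = this
  show ?thesis
  proof
    assume "fin_gen_module R M"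
    then obtain S where S: "finite S" "S \<subseteq> carrier M"
      "\<forall>x\<in>carrier M. \<exists>c\<in>S \<rightarrow> carrier R. x = (\<Oplus>\<^bsub>M\<^esub>s\<in>S. c s \<odot>\<^bsub>M\<^esub> s)"
      unfolding fin_gen_module_def by blast
    then have "carrier M \<subseteq> lspan R M S"
      unfolding span[OF S(1,2)] by blast
    moreover have "lspan R M S \<subseteq> carrier M"
      using lspan_minimal[OF left_submodule_carrier[OF assms] S(2)] .
    ultimately show "\<exists>S. finite S \<and> S \<subseteq> carrier M \<and> lspan R M S = carrier M"
      using S by blast
  next
    assume "\<exists>S. finite S \<and> S \<subseteq> carrier M \<and> lspan R M S = carrier M"
    then obtain S where S: "finite S" "S \<subseteq> carrier M" "lspan R M S = carrier M" by blast
    show "fin_gen_module R M"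
      unfolding fin_gen_module_def using S span[OF S(1,2)] by (intro exI[of _ S]) auto
  qed
qed

lemma lspan_image:
  assumes "left_module R M" "left_module R N" "f \<in> module_hom R M N" "S \<subseteq> carrier M"
  shows "f ` lspan R M S = lspan R N (f ` S)"
proof
  note f = module_homD[OF assms(3)]
  have fS: "f ` S \<subseteq> carrier N" using assms(4) f(1) by auto
  have "left_submodule R M {x \<in> carrier M. f x \<in> lspan R N (f ` S)}"
    by (rule left_submodule_vimage[OF assms(1-3) left_submodule_lspan[OF assms(2) fS]])
  then have "lspan R M S \<subseteq> {x \<in> carrier M. f x \<in> lspan R N (f ` S)}"
    using lspan_superset[of "f ` S" R N] assms(4) by (intro lspan_minimal) auto
  then show "f ` lspan R M S \<subseteq> lspan R N (f ` S)" by blast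
  show "lspan R N (f ` S) \<subseteq> f ` lspan R M S"
    using lspan_superset[of S R M]
    by (intro lspan_minimal left_submodule_image[OF assms(1-3)] left_submodule_lspan[OF assms(1,4)]) auto
qed

lemma fin_gen_module_image:
  assumes "left_module R M" "left_module R N" "f \<in> module_hom R M N" "f ` carrier M = carrier N"
    "fin_gen_module R M"
  shows "fin_gen_module R N"
proof -
  obtain S where "finite S" "S \<subseteq> carrier M" "lspan R M S = carrier M"
    using assms(5) fin_gen_module_iff[OF assms(1)] by blast
  moreover from this have "lspan R N (f ` S) = carrier N"
    using lspan_image[OF assms(1-3)] assms(4) by metis
  ultimately show ?thesis
    unfolding fin_gen_module_iff[OF assms(2)] using module_homD(1)[OF assms(3)]
    by (intro exI[of _ "f ` S"]) auto
qed

text \<open>Stated with a sum instead of \<open>x - y\<close>, because the negation of a module record is computed inside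
  its carrier and therefore changes when the carrier is restricted.\<close>

lemma module_hom_diff_in_kernel:
  assumes "left_module R M" "left_module R N" "f \<in> module_hom R M N"
    "x \<in> carrier M" "y \<in> carrier M" "f x = f y"
  obtains z where "z \<in> carrier M" "f z = \<zero>\<^bsub>N\<^esub>" "x = y \<oplus>\<^bsub>M\<^esub> z"
proof -
  interpret M: left_module R M by fact
  interpret N: left_module R N by fact
  note f = module_homD[OF assms(3)]
  define y' where "y' = (\<ominus>\<^bsub>R\<^esub> \<one>\<^bsub>R\<^esub>) \<odot>\<^bsub>M\<^esub> y"
  have y': "y' \<in> carrier M" "y \<oplus>\<^bsub>M\<^esub> y' = \<zero>\<^bsub>M\<^esub>"
    using assms M.add_smult_minus_one by (auto simp: y'_def M.smult_closed)
  have "f (x \<oplus>\<^bsub>M\<^esub> y') = \<zero>\<^bsub>N\<^esub>"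
    using f assms y' module_hom_zero[OF assms(1-3)] by metis
  moreover have "y \<oplus>\<^bsub>M\<^esub> (x \<oplus>\<^bsub>M\<^esub> y') = x"
    using y' assms by (metis M.M.a_assoc M.M.a_comm M.M.r_zero)
  ultimately show ?thesis using that y' assms by (metis M.M.a_closed)
qed

lemma fin_gen_module_extension:
  assumes "left_module R M" "left_submodule R M H" "left_module R N"
    "f \<in> module_hom R M N" "f ` carrier M = carrier N" "{x \<in> carrier M. f x = \<zero>\<^bsub>N\<^esub>} = H"
    "fin_gen_module R (M\<lparr>carrier := H\<rparr>)" "fin_gen_module R N"
  shows "fin_gen_module R M"
proof -
  interpret M: left_module R M by fact
  note H = left_module_restrict[OF assms(1,2)]
  obtain S where S: "finite S" "S \<subseteq> H" "lspan R M S = H"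
    using assms(7) unfolding fin_gen_module_iff[OF H]
    using lspan_restrict[OF assms(1,2)] by auto
  obtain S' where S': "finite S'" "S' \<subseteq> carrier N" "lspan R N S' = carrier N"
    using assms(8) unfolding fin_gen_module_iff[OF assms(3)] by blast
  obtain S'' where S'': "S'' \<subseteq> carrier M" "finite S''" "S' = f ` S''"
    using finite_subset_image[OF S'(1)] S'(2) unfolding assms(5)[symmetric] by metis
  have sub: "S \<union> S'' \<subseteq> carrier M" using S S'' assms(2) by (auto simp: left_submodule_def)
  note U = left_submoduleD[OF left_submodule_lspan[OF assms(1) sub]]
  have "H \<subseteq> lspan R M (S \<union> S'')" unfolding S(3)[symmetric] by (auto simp: lspan_def)
  moreover have "f ` lspan R M (S \<union> S'') = carrier N"
  proof
    show "f ` lspan R M (S \<union> S'') \<subseteq> carrier N"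
      using U(1) module_homD(1)[OF assms(4)] by blast
    have "S' \<subseteq> f ` lspan R M (S \<union> S'')"
      unfolding S''(3) using lspan_superset[of "S \<union> S''" R M] by blast
    then show "carrier N \<subseteq> f ` lspan R M (S \<union> S'')"
      unfolding S'(3)[symmetric]
      by (intro lspan_minimal left_submodule_image[OF assms(1,3,4)] left_submodule_lspan[OF assms(1) sub])
  qed
  ultimately have H': "H \<subseteq> lspan R M (S \<union> S'')" and onto: "f ` lspan R M (S \<union> S'') = carrier N"
    by auto
  have "x \<in> lspan R M (S \<union> S'')" if x: "x \<in> carrier M" for x
  proof -
    have "f x \<in> f ` lspan R M (S \<union> S'')"
      unfolding onto by (rule module_homD(1)[OF assms(4) x])
    then obtain y where y: "y \<in> lspan R M (S \<union> S'')" "f x = f y" by blast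
    then obtain z where "z \<in> carrier M" "f z = \<zero>\<^bsub>N\<^esub>" "x = y \<oplus>\<^bsub>M\<^esub> z"
      using module_hom_diff_in_kernel[OF assms(1,3,4) x, of y] U(1) by metis
    then show ?thesis using y U(3) H' assms(6) by blast
  qed
  then show ?thesis
    unfolding fin_gen_module_iff[OF assms(1)] using sub S S'' U(1)
    by (intro exI[of _ "S \<union> S''"]) auto
qed

text \<open>Existence of \<open>M / H\<close>, carried by the cosets of \<open>H\<close>. Only the surjection onto the quotient
  and its kernel matter afterwards.\<close>

lemma quotient_module_exists:
  fixes M :: "('a, 'b, 'n) module_scheme"
  assumes "left_module R M" "left_submodule R M H"
  obtains Q :: "('a, 'b set) module" and g where "left_module R Q" "g \<in> module_hom R M Q"
    "g ` carrier M = carrier Q" "\<And>x. x \<in> carrier M \<Longrightarrow> g x = \<zero>\<^bsub>Q\<^esub> \<longleftrightarrow> x \<in> H"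
proof -
  interpret left_module R M by fact
  note D = left_submoduleD[OF assms(2)]
  define h where "h x = {x \<oplus>\<^bsub>M\<^esub> y | y. y \<in> H}" for x
  have h_eq: "h x = h y \<longleftrightarrow> (\<exists>z\<in>H. x = y \<oplus>\<^bsub>M\<^esub> z)" if xy: "x \<in> carrier M" "y \<in> carrier M" for x y
  proof
    assume "h x = h y"
    moreover have "x \<oplus>\<^bsub>M\<^esub> \<zero>\<^bsub>M\<^esub> \<in> h x" using D(2) by (auto simp: h_def)
    ultimately show "\<exists>z\<in>H. x = y \<oplus>\<^bsub>M\<^esub> z" using xy by (auto simp: h_def)
  next
    assume "\<exists>z\<in>H. x = y \<oplus>\<^bsub>M\<^esub> z"
    then obtain z where z: "z \<in> H" "x = y \<oplus>\<^bsub>M\<^esub> z" by blast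
    define z' where "z' = (\<ominus>\<^bsub>R\<^esub> \<one>\<^bsub>R\<^esub>) \<odot>\<^bsub>M\<^esub> z"
    have z': "z' \<in> H" "z \<oplus>\<^bsub>M\<^esub> z' = \<zero>\<^bsub>M\<^esub>"
      using z D add_smult_minus_one[of z] by (auto simp: z'_def)
    have "x \<oplus>\<^bsub>M\<^esub> w = y \<oplus>\<^bsub>M\<^esub> (z \<oplus>\<^bsub>M\<^esub> w)" "y \<oplus>\<^bsub>M\<^esub> w = x \<oplus>\<^bsub>M\<^esub> (z' \<oplus>\<^bsub>M\<^esub> w)" if "w \<in> H" for w
    proof -
      have "w \<in> carrier M" "z \<in> carrier M" "z' \<in> carrier M" using that z z' D(1) by auto
      moreover from this have "x \<oplus>\<^bsub>M\<^esub> (z' \<oplus>\<^bsub>M\<^esub> w) = y \<oplus>\<^bsub>M\<^esub> ((z \<oplus>\<^bsub>M\<^esub> z') \<oplus>\<^bsub>M\<^esub> w)"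
        using xy z(2) by (simp add: M.a_assoc)
      ultimately show "x \<oplus>\<^bsub>M\<^esub> w = y \<oplus>\<^bsub>M\<^esub> (z \<oplus>\<^bsub>M\<^esub> w)" "y \<oplus>\<^bsub>M\<^esub> w = x \<oplus>\<^bsub>M\<^esub> (z' \<oplus>\<^bsub>M\<^esub> w)"
        using xy z(2) z'(2) by (auto simp: M.a_assoc)
    qed
    moreover have "z \<oplus>\<^bsub>M\<^esub> w \<in> H" "z' \<oplus>\<^bsub>M\<^esub> w \<in> H" if "w \<in> H" for w
      using that z z' D(3) by auto
    ultimately show "h x = h y" unfolding h_def by blast
  qed
  define r where "r u = (SOME x. x \<in> carrier M \<and> h x = u)" for u
  have r: "r (h x) \<in> carrier M" "h (r (h x)) = h x" if "x \<in> carrier M" for x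
    using someI[of "\<lambda>y. y \<in> carrier M \<and> h y = h x" x] that by (auto simp: r_def)
  define Q :: "('a, 'b set) module" where
    "Q = \<lparr>carrier = h ` carrier M, monoid.mult = undefined, one = undefined, ring.zero = h \<zero>\<^bsub>M\<^esub>,
      add = (\<lambda>u w. h (r u \<oplus>\<^bsub>M\<^esub> r w)), smult = (\<lambda>a u. h (a \<odot>\<^bsub>M\<^esub> r u))\<rparr>"
  have add: "h (r (h x) \<oplus>\<^bsub>M\<^esub> r (h y)) = h (x \<oplus>\<^bsub>M\<^esub> y)" if xy: "x \<in> carrier M" "y \<in> carrier M" for x y
  proof -
    obtain z w where zw: "z \<in> H" "w \<in> H" "r (h x) = x \<oplus>\<^bsub>M\<^esub> z" "r (h y) = y \<oplus>\<^bsub>M\<^esub> w"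
      using h_eq[OF r(1)[OF xy(1)] xy(1)] h_eq[OF r(1)[OF xy(2)] xy(2)] r(2) xy by metis
    have zw': "z \<in> carrier M" "w \<in> carrier M" using zw D(1) by auto
    have "r (h x) \<oplus>\<^bsub>M\<^esub> r (h y) = (x \<oplus>\<^bsub>M\<^esub> y) \<oplus>\<^bsub>M\<^esub> (z \<oplus>\<^bsub>M\<^esub> w)"
      unfolding zw(3,4) using xy zw' by (simp add: M.a_ac)
    then show ?thesis
      using h_eq[of "r (h x) \<oplus>\<^bsub>M\<^esub> r (h y)" "x \<oplus>\<^bsub>M\<^esub> y"] xy r D(3)[OF zw(1,2)]
      by (metis M.a_closed)
  qed
  have smult: "h (a \<odot>\<^bsub>M\<^esub> r (h x)) = h (a \<odot>\<^bsub>M\<^esub> x)" if ax: "a \<in> carrier R" "x \<in> carrier M" for a x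
  proof -
    obtain z where z: "z \<in> H" "r (h x) = x \<oplus>\<^bsub>M\<^esub> z"
      using h_eq[OF r(1)[OF ax(2)] ax(2)] r(2) ax by metis
    then have "a \<odot>\<^bsub>M\<^esub> r (h x) = a \<odot>\<^bsub>M\<^esub> x \<oplus>\<^bsub>M\<^esub> a \<odot>\<^bsub>M\<^esub> z" "a \<odot>\<^bsub>M\<^esub> z \<in> H"
      using D ax smult_r_distr by auto
    then show ?thesis
      using h_eq[of "a \<odot>\<^bsub>M\<^esub> r (h x)" "a \<odot>\<^bsub>M\<^esub> x"] ax r(1)[OF ax(2)] smult_closed by metis
  qed
  have [simp]: "carrier Q = h ` carrier M" "\<zero>\<^bsub>Q\<^esub> = h \<zero>\<^bsub>M\<^esub>"
    "\<And>x y. x \<in> carrier M \<Longrightarrow> y \<in> carrier M \<Longrightarrow> h x \<oplus>\<^bsub>Q\<^esub> h y = h (x \<oplus>\<^bsub>M\<^esub> y)"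
    "\<And>a x. a \<in> carrier R \<Longrightarrow> x \<in> carrier M \<Longrightarrow> a \<odot>\<^bsub>Q\<^esub> h x = h (a \<odot>\<^bsub>M\<^esub> x)"
    by (auto simp: Q_def add smult)
  note [simp] = smult_closed
  have "abelian_group Q"
  proof (rule abelian_groupI)
    fix u assume "u \<in> carrier Q"
    then obtain x where "x \<in> carrier M" "u = h x" by auto
    then show "\<exists>w\<in>carrier Q. w \<oplus>\<^bsub>Q\<^esub> u = \<zero>\<^bsub>Q\<^esub>"
      by (intro bexI[of _ "h (\<ominus>\<^bsub>M\<^esub> x)"]) (auto simp: M.l_neg)
  qed (auto simp: M.a_ac)
  then have "left_module R Q"
    by (intro left_module.intro left_module_axioms.intro R.ring_axioms)
      (auto simp: smult_l_distr smult_r_distr smult_assoc1 smult_one)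
  moreover have "h \<in> module_hom R M Q" by (auto simp: module_hom_def)
  moreover have "h x = \<zero>\<^bsub>Q\<^esub> \<longleftrightarrow> x \<in> H" if "x \<in> carrier M" for x
    using h_eq[of x "\<zero>\<^bsub>M\<^esub>"] that D(1) by force
  ultimately show ?thesis using that by auto
qed

lemma module_hom_factor:
  assumes "left_module R M" "left_module R N" "left_module R Q"
    and f: "f \<in> module_hom R M N" "f ` carrier M = carrier N"
    and g: "g \<in> module_hom R M Q" "\<And>x. \<lbrakk>x \<in> carrier M; f x = \<zero>\<^bsub>N\<^esub>\<rbrakk> \<Longrightarrow> g x = \<zero>\<^bsub>Q\<^esub>"
  obtains e where "e \<in> module_hom R N Q" "\<And>x. x \<in> carrier M \<Longrightarrow> e (f x) = g x"
proof -
  interpret M: left_module R M by fact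
  interpret Q: left_module R Q by fact
  have eq: "g x = g y" if xy: "x \<in> carrier M" "y \<in> carrier M" "f x = f y" for x y
  proof -
    obtain z where z: "z \<in> carrier M" "f z = \<zero>\<^bsub>N\<^esub>" "x = y \<oplus>\<^bsub>M\<^esub> z"
      using module_hom_diff_in_kernel[OF assms(1,2) f(1) xy] by metis
    then show ?thesis
      using module_homD[OF g(1)] g(2) xy(2) by simp
  qed
  define e where "e y = g (SOME x. x \<in> carrier M \<and> f x = y)" for y
  have e: "e (f x) = g x" if "x \<in> carrier M" for x
    unfolding e_def using someI[of "\<lambda>z. z \<in> carrier M \<and> f z = f x" x] that eq by blast
  have "e \<in> module_hom R N Q"
  proof (rule module_homI)
    fix x assume "x \<in> carrier N"
    then obtain u where "u \<in> carrier M" "x = f u" unfolding f(2)[symmetric] by blast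
    then show "e x \<in> carrier Q" using e module_homD(1)[OF g(1)] by simp
    fix y assume "y \<in> carrier N"
    then obtain v where "v \<in> carrier M" "y = f v" unfolding f(2)[symmetric] by blast
    then show "e (x \<oplus>\<^bsub>N\<^esub> y) = e x \<oplus>\<^bsub>Q\<^esub> e y"
      using \<open>u \<in> carrier M\<close> \<open>x = f u\<close> e module_homD(2)[OF g(1)] module_homD(2)[OF f(1)]
      by (metis M.M.a_closed)
  next
    fix a x assume a: "a \<in> carrier R" and "x \<in> carrier N"
    then obtain u where "u \<in> carrier M" "x = f u" unfolding f(2)[symmetric] by blast
    then show "e (a \<odot>\<^bsub>N\<^esub> x) = a \<odot>\<^bsub>Q\<^esub> e x"
      using a e module_homD(3)[OF g(1)] module_homD(3)[OF f(1)] M.smult_closed by metis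
  qed
  then show ?thesis using that e by blast
qed

section \<open>Membership of subquotients in a torsion class\<close>

text \<open>An isomorphism is given as a surjection with trivial kernel, the form in which it composes with the
  quotient maps below.\<close>

lemma fg_modules_representative:
  assumes "left_module R Q" "fin_gen_module R Q"
  obtains N e where "N \<in> fg_modules R" "e \<in> module_hom R Q N" "e ` carrier Q = carrier N"
    "\<And>x. x \<in> carrier Q \<Longrightarrow> e x = \<zero>\<^bsub>N\<^esub> \<longleftrightarrow> x = \<zero>\<^bsub>Q\<^esub>"
proof -
  obtain N e where N: "N \<in> fg_modules R" and e: "e \<in> module_iso R Q N"
    using fg_modules_universal[OF assms] by blast
  have hom: "e \<in> module_hom R Q N" and bij: "bij_betw e (carrier Q) (carrier N)"
    using e by (auto simp: module_iso_def)
  interpret Q: left_module R Q by fact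
  have "left_module R N" using N by (simp add: fg_modules_def)
  then have "e \<zero>\<^bsub>Q\<^esub> = \<zero>\<^bsub>N\<^esub>" using module_hom_zero[OF assms(1) _ hom] by blast
  then have "e x = \<zero>\<^bsub>N\<^esub> \<longleftrightarrow> x = \<zero>\<^bsub>Q\<^esub>" if "x \<in> carrier Q" for x
    using bij that by (metis Q.M.zero_closed bij_betw_def inj_on_contraD)
  then show ?thesis using that N hom bij by (auto simp: bij_betw_def)
qed

lemma torsion_class_fg: "\<lbrakk>torsion_class R T; N \<in> T\<rbrakk> \<Longrightarrow> N \<in> fg_modules R"
  unfolding torsion_class_def by (elim conjE subsetD)

lemma torsion_class_left_module: "\<lbrakk>torsion_class R T; N \<in> T\<rbrakk> \<Longrightarrow> left_module R N"
  using torsion_class_fg[of R T N] by (simp add: fg_modules_def)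

lemma torsion_class_factor:
  "\<lbrakk>torsion_class R T; M \<in> T; N \<in> fg_modules R; f \<in> module_hom R M N; f ` carrier M = carrier N\<rbrakk>
    \<Longrightarrow> N \<in> T"
  unfolding torsion_class_def by blast

lemma torsion_class_extension:
  "\<lbrakk>torsion_class R T; L \<in> T; N \<in> T; M \<in> fg_modules R; short_exact R L M N f g\<rbrakk> \<Longrightarrow> M \<in> T"
  unfolding torsion_class_def by blast

text \<open>Closure under isomorphisms is a special case of closure under factor modules.\<close>

lemma torsion_classI:
  assumes "T \<subseteq> fg_modules R" "T \<noteq> {}"
    and factor: "\<And>M N f. \<lbrakk>M \<in> T; N \<in> fg_modules R; f \<in> module_hom R M N; f ` carrier M = carrier N\<rbrakk>
      \<Longrightarrow> N \<in> T"
    and "\<And>L M N f g. \<lbrakk>L \<in> T; N \<in> T; M \<in> fg_modules R; short_exact R L M N f g\<rbrakk> \<Longrightarrow> M \<in> T"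
  shows "torsion_class R T"
proof -
  have iso: "N \<in> T" if "M \<in> T" "N \<in> fg_modules R" "module_iso R M N \<noteq> {}" for M N
    using that factor unfolding module_iso_def bij_betw_def by blast
  show ?thesis
    unfolding torsion_class_def
    by (intro conjI ballI impI assms(1,2)) (blast intro: iso factor assms(4))+
qed

text \<open>\<open>subquot_in R T M A B\<close> says that \<open>A\<close> is a submodule of \<open>M\<close> and that the subquotient
  \<open>A / B\<close> is isomorphic to a member of \<open>T\<close>. The module \<open>M\<close> may live on any type, so this predicate
  is how the torsion class \<open>T\<close> is applied to modules that are not on the type of
  \<^const>\<open>fg_modules\<close>.\<close>

definition subquot_in :: "('a, 'm) ring_scheme \<Rightarrow> ('a, (nat \<Rightarrow> 'a) set) module set \<Rightarrow>
    ('a, 'b, 'n) module_scheme \<Rightarrow> 'b set \<Rightarrow> 'b set \<Rightarrow> bool"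
  where "subquot_in R T M A B \<longleftrightarrow> left_submodule R M A \<and>
    (\<exists>N\<in>T. \<exists>f\<in>module_hom R (M\<lparr>carrier := A\<rparr>) N. f ` A = carrier N \<and> {x \<in> A. f x = \<zero>\<^bsub>N\<^esub>} = B)"

lemma subquot_inD:
  assumes "subquot_in R T M A B"
  obtains N f where "N \<in> T" "f \<in> module_hom R (M\<lparr>carrier := A\<rparr>) N" "f ` A = carrier N"
    "{x \<in> A. f x = \<zero>\<^bsub>N\<^esub>} = B"
  using assms unfolding subquot_in_def by blast

lemma subquot_in_submodule: "subquot_in R T M A B \<Longrightarrow> left_submodule R M A"
  by (simp add: subquot_in_def)

lemma subquot_in_submodule_lower:
  assumes "torsion_class R T" "left_module R M" "subquot_in R T M A B"
  shows "left_submodule R M B" "B \<subseteq> A"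
proof -
  note A = subquot_in_submodule[OF assms(3)]
  obtain N f where N: "N \<in> T" "f \<in> module_hom R (M\<lparr>carrier := A\<rparr>) N" "{x \<in> A. f x = \<zero>\<^bsub>N\<^esub>} = B"
    using assms(3) by (rule subquot_inD)
  note N' = torsion_class_left_module[OF assms(1) N(1)]
  show "left_submodule R M B" "B \<subseteq> A"
    using left_submodule_vimage[OF left_module_restrict[OF assms(2) A] N' N(2) left_submodule_zero[OF N']]
      N(3) left_submodule_restrict_iff[OF A] by auto
qed

text \<open>The quotient \<open>A' / B'\<close> is the image of \<open>A / B\<close> under the map induced by \<open>h\<close>.\<close>

lemma subquot_in_image:
  fixes M' :: "('a, 'b, 'n) module_scheme"
  assumes T: "torsion_class R T" and M: "left_module R M" and M': "left_module R M'"
    and AB: "subquot_in R T M A B"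
    and h: "h \<in> module_hom R (M\<lparr>carrier := A\<rparr>) M'"
    and A': "left_submodule R M' A'" and B': "left_submodule R M' B'"
    and sub: "h ` A \<subseteq> A'" "B' \<subseteq> A'" "h ` B \<subseteq> B'"
    and onto: "\<And>y. y \<in> A' \<Longrightarrow> \<exists>x\<in>A. \<exists>b\<in>B'. y = h x \<oplus>\<^bsub>M'\<^esub> b"
  shows "subquot_in R T M' A' B'"
proof -
  note A = subquot_in_submodule[OF AB]
  obtain N f where N: "N \<in> T" and f: "f \<in> module_hom R (M\<lparr>carrier := A\<rparr>) N" "f ` A = carrier N"
    and ker: "{x \<in> A. f x = \<zero>\<^bsub>N\<^esub>} = B"
    using AB by (rule subquot_inD)
  have N': "left_module R N" using torsion_class_left_module[OF T N] .
  note MA = left_module_restrict[OF M A] and MA' = left_module_restrict[OF M' A']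
  have "left_submodule R (M'\<lparr>carrier := A'\<rparr>) B'"
    using B' sub by (simp add: left_submodule_restrict_iff[OF A'])
  from quotient_module_exists[OF MA' this]
  obtain Q :: "('a, 'b set) module" and g where Q: "left_module R Q"
    and g: "g \<in> module_hom R (M'\<lparr>carrier := A'\<rparr>) Q" "g ` A' = carrier Q"
    and kerg: "\<And>x. x \<in> A' \<Longrightarrow> g x = \<zero>\<^bsub>Q\<^esub> \<longleftrightarrow> x \<in> B'" by auto
  interpret Q: left_module R Q by fact
  have h': "h \<in> module_hom R (M\<lparr>carrier := A\<rparr>) (M'\<lparr>carrier := A'\<rparr>)"
    using h sub by (intro module_hom_restrict_target) auto
  note gh = module_hom_compose[OF h' g(1)]
  obtain e where e: "e \<in> module_hom R N Q" "\<And>x. x \<in> A \<Longrightarrow> e (f x) = g (h x)"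
  proof (rule module_hom_factor[OF MA N' Q f(1) _ gh])
    fix x assume "x \<in> carrier (M\<lparr>carrier := A\<rparr>)" "f x = \<zero>\<^bsub>N\<^esub>"
    then have "x \<in> B" unfolding ker[symmetric] by simp
    then have "h x \<in> B'" using sub(3) by blast
    then show "g (h x) = \<zero>\<^bsub>Q\<^esub>" using kerg[of "h x"] sub(2) by blast
  qed (use f in auto)
  have "e ` carrier N = carrier Q"
  proof
    show "e ` carrier N \<subseteq> carrier Q" using module_homD(1)[OF e(1)] by auto
    show "carrier Q \<subseteq> e ` carrier N"
    proof
      fix q assume "q \<in> carrier Q"
      then obtain y where y: "y \<in> A'" "q = g y" unfolding g(2)[symmetric] by blast
      then obtain x b where xb: "x \<in> A" "b \<in> B'" "y = h x \<oplus>\<^bsub>M'\<^esub> b" using onto by blast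
      then have b: "b \<in> A'" "h x \<in> A'" using sub by auto
      have "q = g (h x) \<oplus>\<^bsub>Q\<^esub> g b"
        using module_homD(2)[OF g(1), of "h x" b] y xb(3) b by simp
      also have "\<dots> = e (f x)"
        using kerg[OF b(1)] xb(1,2) e(2) module_homD(1)[OF g(1)] b by simp
      finally show "q \<in> e ` carrier N" using f(2) xb(1) by blast
    qed
  qed
  note onto_e = this
  have "fin_gen_module R Q"
    using fin_gen_module_image[OF N' Q e(1) onto_e] torsion_class_fg[OF T N]
    by (simp add: fg_modules_def)
  from fg_modules_representative[OF Q this] obtain P d where P: "P \<in> fg_modules R"
    and d: "d \<in> module_hom R Q P" "d ` carrier Q = carrier P"
    "\<And>x. x \<in> carrier Q \<Longrightarrow> d x = \<zero>\<^bsub>P\<^esub> \<longleftrightarrow> x = \<zero>\<^bsub>Q\<^esub>" by metis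
  have "(\<lambda>x. d (e x)) ` carrier N = carrier P"
    using onto_e d(2) by (simp add: image_image[symmetric])
  then have PT: "P \<in> T"
    using torsion_class_factor[OF T N P module_hom_compose[OF e(1) d(1)]] by blast
  show ?thesis
    unfolding subquot_in_def
  proof (intro conjI bexI[OF _ PT] bexI[OF _ module_hom_compose[OF g(1) d(1)]] A')
    show "(\<lambda>x. d (g x)) ` A' = carrier P"
      using g(2) d(2) by (simp add: image_image[symmetric])
    show "{x \<in> A'. d (g x) = \<zero>\<^bsub>P\<^esub>} = B'"
      using d(3)[OF module_homD(1)[OF g(1)]] kerg sub(2) by auto
  qed
qed

lemma subquot_in_image_zero:
  assumes T: "torsion_class R T" and M: "left_module R M" and M': "left_module R M'"
    and AB: "subquot_in R T M A B" and h: "h \<in> module_hom R M M'"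
    and B: "\<And>x. x \<in> B \<Longrightarrow> h x = \<zero>\<^bsub>M'\<^esub>"
  shows "subquot_in R T M' (h ` A) {\<zero>\<^bsub>M'\<^esub>}"
proof -
  note A = subquot_in_submodule[OF AB]
  note hA = left_submodule_image[OF M M' h A]
  interpret M': left_module R M' by fact
  show ?thesis
  proof (rule subquot_in_image[OF T M M' AB module_hom_restrict[OF h A] hA left_submodule_zero[OF M']])
    fix y assume "y \<in> h ` A"
    then obtain x where "x \<in> A" "y = h x" by blast
    then show "\<exists>x\<in>A. \<exists>b\<in>{\<zero>\<^bsub>M'\<^esub>}. y = h x \<oplus>\<^bsub>M'\<^esub> b"
      using left_submoduleD(1)[OF hA \<open>y \<in> h ` A\<close>] by (intro bexI[of _ x] bexI[of _ "\<zero>\<^bsub>M'\<^esub>"]) auto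
  qed (use B left_submoduleD(2)[OF hA] in auto)
qed

lemma subquot_in_mono:
  assumes "torsion_class R T" "left_module R M" "subquot_in R T M A B"
    "left_submodule R M B'" "B \<subseteq> B'" "B' \<subseteq> A"
  shows "subquot_in R T M A B'"
proof (rule subquot_in_image[OF assms(1,2,2,3) module_hom_id_restrict _ assms(4)])
  interpret left_module R M by fact
  note A = subquot_in_submodule[OF assms(3)]
  show "left_submodule R M A" "A \<subseteq> carrier M" using A by (auto simp: left_submodule_def)
  show "\<exists>x\<in>A. \<exists>b\<in>B'. y = x \<oplus>\<^bsub>M\<^esub> b" if "y \<in> A" for y
    using that left_submoduleD(1)[OF A] left_submoduleD(2)[OF assms(4)]
    by (intro bexI[of _ y] bexI[of _ "\<zero>\<^bsub>M\<^esub>"]) auto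
qed (use assms in auto)

text \<open>Here \<open>h\<close> induces an isomorphism \<open>A / B \<cong> A' / B'\<close>.\<close>

lemma subquot_in_vimage:
  assumes "subquot_in R T M' A' B'" "left_submodule R M A"
    and h: "h \<in> module_hom R (M\<lparr>carrier := A\<rparr>) M'" "h ` A = A'" "{x \<in> A. h x \<in> B'} = B"
  shows "subquot_in R T M A B"
proof -
  obtain N f where N: "N \<in> T" "f \<in> module_hom R (M'\<lparr>carrier := A'\<rparr>) N" "f ` A' = carrier N"
    "{x \<in> A'. f x = \<zero>\<^bsub>N\<^esub>} = B'"
    using assms(1) by (rule subquot_inD)
  have h': "h \<in> module_hom R (M\<lparr>carrier := A\<rparr>) (M'\<lparr>carrier := A'\<rparr>)"
    using h by (intro module_hom_restrict_target) auto
  show ?thesis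
    unfolding subquot_in_def
  proof (intro conjI bexI[OF _ N(1)] bexI[OF _ module_hom_compose[OF h' N(2)]] assms(2))
    show "(\<lambda>x. f (h x)) ` A = carrier N" using h(2) N(3) by (simp add: image_image[symmetric])
    show "{x \<in> A. f (h x) = \<zero>\<^bsub>N\<^esub>} = B" using h N(4) by auto
  qed
qed

text \<open>Closure under the extension \<open>0 \<rightarrow> B / C \<rightarrow> A / C \<rightarrow> A / B \<rightarrow> 0\<close>.\<close>

lemma subquot_in_trans:
  fixes M :: "('a, 'b, 'n) module_scheme"
  assumes T: "torsion_class R T" and M: "left_module R M"
    and AB: "subquot_in R T M A B" and BC: "subquot_in R T M B C"
  shows "subquot_in R T M A C"
proof -
  note A = subquot_in_submodule[OF AB] and B = subquot_in_submodule[OF BC]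
    and BA = subquot_in_submodule_lower(2)[OF T M AB] and C = subquot_in_submodule_lower[OF T M BC]
  note MA = left_module_restrict[OF M A] and MB = left_module_restrict[OF M B]
  obtain N1 f1 where N1: "N1 \<in> T" and f1: "f1 \<in> module_hom R (M\<lparr>carrier := A\<rparr>) N1"
    "f1 ` A = carrier N1" "{x \<in> A. f1 x = \<zero>\<^bsub>N1\<^esub>} = B"
    using AB by (rule subquot_inD)
  obtain N2 f2 where N2: "N2 \<in> T" and f2: "f2 \<in> module_hom R (M\<lparr>carrier := B\<rparr>) N2"
    "f2 ` B = carrier N2" "{x \<in> B. f2 x = \<zero>\<^bsub>N2\<^esub>} = C"
    using BC by (rule subquot_inD)
  note L1 = torsion_class_left_module[OF T N1] and L2 = torsion_class_left_module[OF T N2]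
  have "left_submodule R (M\<lparr>carrier := A\<rparr>) C"
    using C BA by (auto simp: left_submodule_restrict_iff[OF A])
  from quotient_module_exists[OF MA this]
  obtain Q :: "('a, 'b set) module" and g where Q: "left_module R Q"
    and g: "g \<in> module_hom R (M\<lparr>carrier := A\<rparr>) Q" "g ` A = carrier Q"
    and kerg: "\<And>x. x \<in> A \<Longrightarrow> g x = \<zero>\<^bsub>Q\<^esub> \<longleftrightarrow> x \<in> C" by auto
  have gB: "g \<in> module_hom R (M\<lparr>carrier := B\<rparr>) Q"
    using module_hom_restrict[OF g(1), of B] B BA by (simp add: left_submodule_restrict_iff[OF A])
  obtain k where k: "k \<in> module_hom R N2 Q" "\<And>x. x \<in> B \<Longrightarrow> k (f2 x) = g x"
  proof (rule module_hom_factor[OF MB L2 Q f2(1) _ gB])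
    fix x assume "x \<in> carrier (M\<lparr>carrier := B\<rparr>)" "f2 x = \<zero>\<^bsub>N2\<^esub>"
    then have "x \<in> A" "x \<in> C" using f2(3) BA by auto
    then show "g x = \<zero>\<^bsub>Q\<^esub>" using kerg by blast
  qed (use f2 in auto)
  obtain e where e: "e \<in> module_hom R Q N1" "\<And>x. x \<in> A \<Longrightarrow> e (g x) = f1 x"
  proof (rule module_hom_factor[OF MA Q L1 g(1) _ f1(1)])
    fix x assume "x \<in> carrier (M\<lparr>carrier := A\<rparr>)" "g x = \<zero>\<^bsub>Q\<^esub>"
    then have "x \<in> B" using kerg C(2) by auto
    then show "f1 x = \<zero>\<^bsub>N1\<^esub>" unfolding f1(3)[symmetric] by simp
  qed (use g in auto)
  have onto_e: "e ` carrier Q = carrier N1"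
    unfolding g(2)[symmetric] f1(2)[symmetric] image_image using e(2) by (rule image_cong[OF refl])
  have ran_k: "k ` carrier N2 = g ` B"
    unfolding f2(2)[symmetric] image_image using k(2) by (rule image_cong[OF refl])
  have ker_e: "{q \<in> carrier Q. e q = \<zero>\<^bsub>N1\<^esub>} = g ` B"
  proof (intro Set.set_eqI iffI)
    fix q assume "q \<in> {q \<in> carrier Q. e q = \<zero>\<^bsub>N1\<^esub>}"
    then obtain x where "x \<in> A" "q = g x" "e (g x) = \<zero>\<^bsub>N1\<^esub>" unfolding g(2)[symmetric] by blast
    then have "x \<in> {x \<in> A. f1 x = \<zero>\<^bsub>N1\<^esub>}" using e(2) by simp
    then show "q \<in> g ` B" using f1(3) \<open>q = g x\<close> by blast
  next
    fix q assume "q \<in> g ` B"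
    then obtain x where x: "x \<in> B" "q = g x" by blast
    then have "x \<in> {x \<in> A. f1 x = \<zero>\<^bsub>N1\<^esub>}" using f1(3) by simp
    then show "q \<in> {q \<in> carrier Q. e q = \<zero>\<^bsub>N1\<^esub>}" using e(2) x(2) g(2) by auto
  qed
  have gB': "left_submodule R Q (g ` B)"
    using left_submodule_image[OF MA Q g(1)] B BA by (simp add: left_submodule_restrict_iff[OF A])
  have "fin_gen_module R (Q\<lparr>carrier := g ` B\<rparr>)"
    using fin_gen_module_image[OF L2 left_module_restrict[OF Q gB'] module_hom_restrict_target[OF k(1)]]
      ran_k torsion_class_fg[OF T N2] by (auto simp: fg_modules_def)
  then have "fin_gen_module R Q"
    using fin_gen_module_extension[OF Q gB' L1 e(1) onto_e ker_e] torsion_class_fg[OF T N1]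
    by (simp add: fg_modules_def)
  from fg_modules_representative[OF Q this] obtain P d where P: "P \<in> fg_modules R"
    and d: "d \<in> module_hom R Q P" "d ` carrier Q = carrier P"
    and kerd: "\<And>x. x \<in> carrier Q \<Longrightarrow> d x = \<zero>\<^bsub>P\<^esub> \<longleftrightarrow> x = \<zero>\<^bsub>Q\<^esub>" by metis
  have LP: "left_module R P" using P by (simp add: fg_modules_def)
  have inj: "inj_on d (carrier Q)"
  proof (rule inj_onI)
    interpret Q: left_module R Q by fact
    fix x y assume xy: "x \<in> carrier Q" "y \<in> carrier Q" "d x = d y"
    obtain z where "z \<in> carrier Q" "d z = \<zero>\<^bsub>P\<^esub>" "x = y \<oplus>\<^bsub>Q\<^esub> z"
      by (rule module_hom_diff_in_kernel[OF Q LP d(1) xy])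
    then show "x = y" using kerd xy by simp
  qed
  obtain e' where e': "e' \<in> module_hom R P N1" "\<And>x. x \<in> carrier Q \<Longrightarrow> e' (d x) = e x"
    by (rule module_hom_factor[OF Q LP L1 d e(1)])
      (use kerd module_hom_zero[OF Q L1 e(1)] in auto)
  have "short_exact R N2 P N1 (\<lambda>x. d (k x)) e'"
    unfolding short_exact_def
  proof (intro conjI e'(1) module_hom_compose[OF k(1) d(1)])
    show "inj_on (\<lambda>x. d (k x)) (carrier N2)"
    proof (rule inj_onI)
      interpret N2: left_module R N2 by fact
      fix x y assume xy: "x \<in> carrier N2" "y \<in> carrier N2" "d (k x) = d (k y)"
      then have kxy: "k x = k y" using inj module_homD(1)[OF k(1)] by (auto dest: inj_onD)
      obtain z where z: "z \<in> carrier N2" "k z = \<zero>\<^bsub>Q\<^esub>" "x = y \<oplus>\<^bsub>N2\<^esub> z"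
        by (rule module_hom_diff_in_kernel[OF L2 Q k(1) xy(1,2) kxy])
      then obtain b where "b \<in> B" "z = f2 b" unfolding f2(2)[symmetric] by blast
      then have "b \<in> C" using z(2) k(2) kerg BA by (metis subsetD)
      then have "b \<in> {x \<in> B. f2 x = \<zero>\<^bsub>N2\<^esub>}" unfolding f2(3) .
      then have "z = \<zero>\<^bsub>N2\<^esub>" using \<open>z = f2 b\<close> by simp
      then show "x = y" using z(3) xy by simp
    qed
    have "(\<lambda>x. d (k x)) ` carrier N2 = d ` {q \<in> carrier Q. e q = \<zero>\<^bsub>N1\<^esub>}"
      unfolding ker_e ran_k[symmetric] by (simp add: image_image)
    also have "\<dots> = {x \<in> carrier P. e' x = \<zero>\<^bsub>N1\<^esub>}"
    proof (intro Set.set_eqI iffI)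
      fix p assume "p \<in> d ` {q \<in> carrier Q. e q = \<zero>\<^bsub>N1\<^esub>}"
      then obtain q where "q \<in> carrier Q" "e q = \<zero>\<^bsub>N1\<^esub>" "p = d q" by blast
      then show "p \<in> {x \<in> carrier P. e' x = \<zero>\<^bsub>N1\<^esub>}"
        using e'(2) module_homD(1)[OF d(1)] by simp
    next
      fix p assume p: "p \<in> {x \<in> carrier P. e' x = \<zero>\<^bsub>N1\<^esub>}"
      then obtain q where "q \<in> carrier Q" "p = d q" unfolding d(2)[symmetric] by blast
      then show "p \<in> d ` {q \<in> carrier Q. e q = \<zero>\<^bsub>N1\<^esub>}" using e'(2) p by simp
    qed
    finally show "(\<lambda>x. d (k x)) ` carrier N2 = {x \<in> carrier P. e' x = \<zero>\<^bsub>N1\<^esub>}" .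
    show "e' ` carrier P = carrier N1"
      unfolding d(2)[symmetric] onto_e[symmetric] image_image using e'(2) by (rule image_cong[OF refl])
  qed
  then have PT: "P \<in> T" using torsion_class_extension[OF T N2 N1 P] by blast
  show ?thesis
    unfolding subquot_in_def
  proof (intro conjI bexI[OF _ PT] bexI[OF _ module_hom_compose[OF g(1) d(1)]] A)
    show "(\<lambda>x. d (g x)) ` A = carrier P" using g(2) d(2) by (simp add: image_image[symmetric])
    show "{x \<in> A. d (g x) = \<zero>\<^bsub>P\<^esub>} = C" 
    proof -
      have "d (g x) = \<zero>\<^bsub>P\<^esub> \<longleftrightarrow> x \<in> C" if "x \<in> A" for x
        using kerd[of "g x"] kerg[OF that] module_homD(1)[OF g(1)] that by simp
      then show ?thesis using C(2) BA by blast
    qed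
  qed
qed

lemma subquot_in_member:
  assumes "torsion_class R T" "L \<in> T"
  shows "subquot_in R T L (carrier L) {\<zero>\<^bsub>L\<^esub>}"
proof -
  interpret L: left_module R L by (rule torsion_class_left_module[OF assms])
  have "(\<lambda>x. x) \<in> module_hom R (L\<lparr>carrier := carrier L\<rparr>) L"
    by (simp add: module_hom_def)
  then show ?thesis
    unfolding subquot_in_def using left_submodule_carrier[OF L.left_module_axioms] assms(2)
    by (intro conjI bexI[OF _ assms(2)] bexI) auto
qed

text \<open>Unpacking membership of a submodule \<open>A = A / 0\<close>.\<close>

lemma subquot_in_zeroD:
  assumes "torsion_class R T" "left_module R M" "subquot_in R T M A {\<zero>\<^bsub>M\<^esub>}"
  obtains N u where "N \<in> T" "u \<in> module_hom R N M" "u ` carrier N = A"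
    "\<And>x. x \<in> carrier N \<Longrightarrow> u x = \<zero>\<^bsub>M\<^esub> \<Longrightarrow> x = \<zero>\<^bsub>N\<^esub>"
proof -
  note A = subquot_in_submodule[OF assms(3)]
  note MA = left_module_restrict[OF assms(2) A]
  obtain N f where N: "N \<in> T" and f: "f \<in> module_hom R (M\<lparr>carrier := A\<rparr>) N"
    "f ` A = carrier N" "{x \<in> A. f x = \<zero>\<^bsub>N\<^esub>} = {\<zero>\<^bsub>M\<^esub>}"
    using assms(3) by (rule subquot_inD)
  have id: "(\<lambda>x. x) \<in> module_hom R (M\<lparr>carrier := A\<rparr>) M"
    using A by (intro module_hom_id_restrict) (simp add: left_submodule_def)
  obtain u where u: "u \<in> module_hom R N M" "\<And>x. x \<in> A \<Longrightarrow> u (f x) = x"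
    by (rule module_hom_factor[OF MA torsion_class_left_module[OF assms(1) N] assms(2) f(1) _ id])
      (use f in auto)
  show ?thesis
  proof (rule that[OF N u(1)])
    show "u ` carrier N = A" unfolding f(2)[symmetric] using u(2) by force
    fix x assume "x \<in> carrier N" "u x = \<zero>\<^bsub>M\<^esub>"
    then obtain y where y: "y \<in> A" "x = f y" unfolding f(2)[symmetric] by blast
    then have "y = \<zero>\<^bsub>M\<^esub>" using u(2) \<open>u x = \<zero>\<^bsub>M\<^esub>\<close> by simp
    then have "y \<in> {x \<in> A. f x = \<zero>\<^bsub>N\<^esub>}" unfolding f(3) by simp
    then show "x = \<zero>\<^bsub>N\<^esub>" using y by simp
  qed
qed

lemma subquot_in_zero_member:
  assumes "torsion_class R T" "L \<in> fg_modules R" "subquot_in R T L (carrier L) {\<zero>\<^bsub>L\<^esub>}"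
  shows "L \<in> T"
proof -
  have "left_module R L" using assms(2) by (simp add: fg_modules_def)
  then show ?thesis
    using subquot_in_zeroD[OF assms(1) _ assms(3)] torsion_class_factor[OF assms(1) _ assms(2)] by metis
qed

lemma subquot_in_refl:
  assumes "torsion_class R T" "left_module R M" "left_submodule R M A"
  shows "subquot_in R T M A A"
proof -
  have "T \<noteq> {}" using assms(1) unfolding torsion_class_def by (elim conjE)
  then obtain N where N: "N \<in> T" by blast
  interpret N: left_module R N by (rule torsion_class_left_module[OF assms(1) N])
  interpret M: left_module R M by fact
  show ?thesis
  proof (rule subquot_in_image[OF assms(1) N.left_module_axioms assms(2) subquot_in_member[OF assms(1) N] _ assms(3,3)])
    show "(\<lambda>_. \<zero>\<^bsub>M\<^esub>) \<in> module_hom R (N\<lparr>carrier := carrier N\<rparr>) M"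
      by (auto simp: module_hom_def M.smult_zero_right)
    show "\<exists>x\<in>carrier N. \<exists>b\<in>A. y = \<zero>\<^bsub>M\<^esub> \<oplus>\<^bsub>M\<^esub> b" if "y \<in> A" for y
      using that left_submoduleD(1)[OF assms(3)] by (intro bexI[of _ "\<zero>\<^bsub>N\<^esub>"] bexI[of _ y]) auto
  qed (use left_submoduleD[OF assms(3)] in auto)
qed

lemma subquot_in_zero_fin_gen:
  assumes "torsion_class R T" "left_module R M" "subquot_in R T M A {\<zero>\<^bsub>M\<^esub>}"
  shows "fin_gen_module R (M\<lparr>carrier := A\<rparr>)"
proof -
  note A = subquot_in_submodule[OF assms(3)]
  obtain N u where N: "N \<in> T" "u \<in> module_hom R N M" "u ` carrier N = A"
    using subquot_in_zeroD[OF assms] by metis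
  then show ?thesis
    using fin_gen_module_image[OF torsion_class_left_module[OF assms(1) N(1)] left_module_restrict[OF assms(2) A]
        module_hom_restrict_target[OF N(2)]] torsion_class_fg[OF assms(1) N(1)]
    by (auto simp: fg_modules_def)
qed

lemma fin_gen_restrictD:
  assumes "left_module R M" "left_submodule R M A" "fin_gen_module R (M\<lparr>carrier := A\<rparr>)"
  obtains S where "finite S" "S \<subseteq> A" "lspan R M S = A"
  using assms(3) lspan_restrict[OF assms(1,2)]
  unfolding fin_gen_module_iff[OF left_module_restrict[OF assms(1,2)]] by auto

section \<open>Change of rings\<close>

text \<open>The \<open>\<Gamma>\<close>-module \<open>M\<close> as a \<open>\<Lambda>\<close>-module along \<open>\<psi> : \<Lambda> \<rightarrow> \<Gamma>\<close>.\<close>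

definition restrict_scalars :: "('a \<Rightarrow> 'c) \<Rightarrow> ('c, 'b, 'n) module_scheme \<Rightarrow> ('a, 'b) module"
  where "restrict_scalars \<psi> M = \<lparr>carrier = carrier M, monoid.mult = monoid.mult M, one = one M,
    ring.zero = ring.zero M, add = add M, smult = (\<lambda>a x. \<psi> a \<odot>\<^bsub>M\<^esub> x)\<rparr>"

lemma restrict_scalars_simps [simp]:
  "carrier (restrict_scalars \<psi> M) = carrier M" "\<zero>\<^bsub>restrict_scalars \<psi> M\<^esub> = \<zero>\<^bsub>M\<^esub>"
  "x \<oplus>\<^bsub>restrict_scalars \<psi> M\<^esub> y = x \<oplus>\<^bsub>M\<^esub> y" "a \<odot>\<^bsub>restrict_scalars \<psi> M\<^esub> x = \<psi> a \<odot>\<^bsub>M\<^esub> x"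
  by (simp_all add: restrict_scalars_def)

lemma left_module_restrict_scalars:
  assumes "ring_hom_ring \<Lambda> \<Gamma> \<psi>" "left_module \<Gamma> M"
  shows "left_module \<Lambda> (restrict_scalars \<psi> M)"
proof -
  interpret h: ring_hom_ring \<Lambda> \<Gamma> \<psi> by fact
  interpret M: left_module \<Gamma> M by fact
  have "abelian_group (restrict_scalars \<psi> M)"
    by (rule abelian_groupI) (auto simp: M.M.a_ac intro: M.M.l_neg M.M.a_inv_closed)
  then show ?thesis
    by (intro left_module.intro left_module_axioms.intro h.R.ring_axioms)
      (auto simp: M.smult_closed M.smult_l_distr M.smult_r_distr M.smult_assoc1 M.smult_one)
qed

lemma left_submodule_restrict_scalars:
  assumes "ring_hom_ring \<Lambda> \<Gamma> \<psi>" "left_submodule \<Gamma> M H"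
  shows "left_submodule \<Lambda> (restrict_scalars \<psi> M) H"
proof -
  interpret h: ring_hom_ring \<Lambda> \<Gamma> \<psi> by fact
  show ?thesis using left_submoduleD[OF assms(2)] by (intro left_submoduleI) auto
qed

lemma module_hom_restrict_scalars:
  assumes "ring_hom_ring \<Lambda> \<Gamma> \<psi>" "f \<in> module_hom \<Gamma> M N"
  shows "f \<in> module_hom \<Lambda> (restrict_scalars \<psi> M) (restrict_scalars \<psi> N)"
proof -
  interpret h: ring_hom_ring \<Lambda> \<Gamma> \<psi> by fact
  show ?thesis using module_homD[OF assms(2)] by (intro module_homI) auto
qed

lemma lspan_restrict_scalars_subset:
  assumes "ring_hom_ring \<Lambda> \<Gamma> \<psi>" "left_module \<Gamma> M" "S \<subseteq> carrier M"
  shows "lspan \<Lambda> (restrict_scalars \<psi> M) S \<subseteq> lspan \<Gamma> M S"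
  by (intro lspan_minimal left_submodule_restrict_scalars[OF assms(1)]
      left_submodule_lspan[OF assms(2,3)] lspan_superset)

lemma left_module_alg_module:
  assumes "ring_hom_ring R \<Lambda> \<phi>"
  shows "left_module R (alg_module \<Lambda> \<phi>)"
proof -
  interpret h: ring_hom_ring R \<Lambda> \<phi> by fact
  have "abelian_group (alg_module \<Lambda> \<phi>)"
    by (rule abelian_groupI) (auto simp: alg_module_def h.S.a_ac intro: h.S.l_neg h.S.a_inv_closed)
  then show ?thesis
    by (intro left_module.intro left_module_axioms.intro h.R.ring_axioms)
      (auto simp: alg_module_def h.S.l_distr h.S.r_distr h.S.m_assoc)
qed

lemma zero_module_exists:
  fixes R :: "('a, 'm) ring_scheme"
  assumes "ring R"
  obtains Z where "Z \<in> fg_modules R" "carrier Z = {\<zero>\<^bsub>Z\<^esub>}"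
proof -
  interpret ring R by fact
  have "ring_hom_ring R R (\<lambda>x. x)"
    by (rule ring_hom_ringI2) (auto simp: ring_hom_def ring_axioms)
  note A = left_module_alg_module[OF this]
  define Z where "Z = (alg_module R (\<lambda>x. x))\<lparr>carrier := {\<zero>\<^bsub>alg_module R (\<lambda>x. x)\<^esub>}\<rparr>"
  have Z: "left_module R Z" "carrier Z = {\<zero>\<^bsub>Z\<^esub>}"
    using left_module_restrict[OF A left_submodule_zero[OF A]] by (auto simp: Z_def)
  have "lspan R Z {\<zero>\<^bsub>Z\<^esub>} = carrier Z"
    using lspan_minimal[OF left_submodule_carrier[OF Z(1)], of "{\<zero>\<^bsub>Z\<^esub>}"] lspan_superset[of "{\<zero>\<^bsub>Z\<^esub>}" R Z] Z(2)
    by auto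
  then have "fin_gen_module R Z"
    unfolding fin_gen_module_iff[OF Z(1)] using Z(2) by (intro exI[of _ "{\<zero>\<^bsub>Z\<^esub>}"]) auto
  from fg_modules_representative[OF Z(1) this] obtain N e where N: "N \<in> fg_modules R"
    "e \<in> module_hom R Z N" "e ` carrier Z = carrier N" by metis
  have "e \<zero>\<^bsub>Z\<^esub> = \<zero>\<^bsub>N\<^esub>"
    using N(1) by (intro module_hom_zero[OF Z(1) _ N(2)]) (simp add: fg_modules_def)
  then have "carrier N = {\<zero>\<^bsub>N\<^esub>}" unfolding N(3)[symmetric] Z(2) by simp
  then show ?thesis using that N(1) by blast
qed

text \<open>A \<open>\<Lambda>\<close>-submodule of a \<open>\<Gamma>\<close>-module that generates it over \<open>\<Gamma>\<close>. For \<open>\<Gamma> = K \<otimes>\<^sub>R \<Lambda>\<close> and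
  finitely generated submodules these are the lattices in the usual sense; for \<open>\<Gamma> = \<Lambda> / \<mm>\<Lambda>\<close>
  only the whole module qualifies.\<close>

definition lattice_in :: "('a, 'm) ring_scheme \<Rightarrow> ('c, 'p) ring_scheme \<Rightarrow> ('a \<Rightarrow> 'c) \<Rightarrow>
    ('c, 'b, 'n) module_scheme \<Rightarrow> 'b set \<Rightarrow> bool"
  where "lattice_in \<Lambda> \<Gamma> \<psi> M W \<longleftrightarrow>
    left_submodule \<Lambda> (restrict_scalars \<psi> M) W \<and> lspan \<Gamma> M W = carrier M"

text \<open>The \<open>\<Gamma>\<close>-modules that are generated by a submodule in \<open>T\<close>, equivalently, for a torsion class
  \<open>T\<close>, the quotients of the modules \<open>\<Gamma> \<otimes>\<^sub>\<Lambda> Y\<close> with \<open>Y \<in> T\<close>.\<close>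

definition extended_class :: "('a, 'm) ring_scheme \<Rightarrow> ('c, 'p) ring_scheme \<Rightarrow> ('a \<Rightarrow> 'c) \<Rightarrow>
    ('a, (nat \<Rightarrow> 'a) set) module set \<Rightarrow> ('c, (nat \<Rightarrow> 'c) set) module set"
  where "extended_class \<Lambda> \<Gamma> \<psi> T = {M \<in> fg_modules \<Gamma>.
    \<exists>W. lattice_in \<Lambda> \<Gamma> \<psi> M W \<and> subquot_in \<Lambda> T (restrict_scalars \<psi> M) W {\<zero>\<^bsub>M\<^esub>}}"

text \<open>For a torsion class \<open>U\<close>, the \<open>\<Lambda>\<close>-modules \<open>Y\<close> with \<open>\<Gamma> \<otimes>\<^sub>\<Lambda> Y\<close> in \<open>U\<close>. A homomorphism from \<open>Y\<close> whose image generates the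
  \<open>\<Gamma>\<close>-module \<open>M\<close> is the same as a surjection of \<open>\<Gamma> \<otimes>\<^sub>\<Lambda> Y\<close> onto \<open>M\<close>, so that no tensor product is
  needed to say this.\<close>

definition contracted_class :: "('a, 'm) ring_scheme \<Rightarrow> ('c, 'p) ring_scheme \<Rightarrow> ('a \<Rightarrow> 'c) \<Rightarrow>
    ('c, (nat \<Rightarrow> 'c) set) module set \<Rightarrow> ('a, (nat \<Rightarrow> 'a) set) module set"
  where "contracted_class \<Lambda> \<Gamma> \<psi> U = {Y \<in> fg_modules \<Lambda>.
    \<forall>M \<in> fg_modules \<Gamma>. \<forall>u \<in> module_hom \<Lambda> Y (restrict_scalars \<psi> M).
      lspan \<Gamma> M (u ` carrier Y) = carrier M \<longrightarrow> M \<in> U}"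

lemma contracted_classD:
  assumes "Y \<in> contracted_class \<Lambda> \<Gamma> \<psi> U"
  shows "Y \<in> fg_modules \<Lambda>"
    "\<lbrakk>M \<in> fg_modules \<Gamma>; u \<in> module_hom \<Lambda> Y (restrict_scalars \<psi> M);
      lspan \<Gamma> M (u ` carrier Y) = carrier M\<rbrakk> \<Longrightarrow> M \<in> U"
  using assms unfolding contracted_class_def by blast+

lemma contracted_classI:
  assumes "Y \<in> fg_modules \<Lambda>"
    "\<And>M u. \<lbrakk>M \<in> fg_modules \<Gamma>; u \<in> module_hom \<Lambda> Y (restrict_scalars \<psi> M);
      lspan \<Gamma> M (u ` carrier Y) = carrier M\<rbrakk> \<Longrightarrow> M \<in> U"
  shows "Y \<in> contracted_class \<Lambda> \<Gamma> \<psi> U"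
  using assms unfolding contracted_class_def by blast

text \<open>The \<open>\<Gamma>\<close>-module \<open>M\<close> need not be on the type of \<^const>\<open>fg_modules\<close> in the next two lemmas.\<close>

lemma generated_fin_gen:
  assumes h: "ring_hom_ring \<Lambda> \<Gamma> \<psi>" and M: "left_module \<Gamma> M" and Y: "left_module \<Lambda> Y" "fin_gen_module \<Lambda> Y"
    and u: "u \<in> module_hom \<Lambda> Y (restrict_scalars \<psi> M)" "lspan \<Gamma> M (u ` carrier Y) = carrier M"
  shows "fin_gen_module \<Gamma> M"
proof -
  obtain S where S: "finite S" "S \<subseteq> carrier Y" "lspan \<Lambda> Y S = carrier Y"
    using Y(2) unfolding fin_gen_module_iff[OF Y(1)] by blast
  have uS: "u ` S \<subseteq> carrier M" using module_homD(1)[OF u(1)] S(2) by auto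
  have "u ` carrier Y = lspan \<Lambda> (restrict_scalars \<psi> M) (u ` S)"
    using lspan_image[OF Y(1) left_module_restrict_scalars[OF h M] u(1) S(2)] S(3) by simp
  also have "\<dots> \<subseteq> lspan \<Gamma> M (u ` S)" by (rule lspan_restrict_scalars_subset[OF h M uS])
  finally have "lspan \<Gamma> M (u ` carrier Y) \<subseteq> lspan \<Gamma> M (u ` S)"
    by (rule lspan_minimal[OF left_submodule_lspan[OF M uS]])
  then have "lspan \<Gamma> M (u ` S) = carrier M"
    using u(2) lspan_minimal[OF left_submodule_carrier[OF M] uS] by blast
  then show ?thesis
    unfolding fin_gen_module_iff[OF M] using S(1) uS by blast
qed

lemma contracted_class_generates:
  assumes h: "ring_hom_ring \<Lambda> \<Gamma> \<psi>" and M: "left_module \<Gamma> M"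
    and Y: "Y \<in> contracted_class \<Lambda> \<Gamma> \<psi> U"
    and u: "u \<in> module_hom \<Lambda> Y (restrict_scalars \<psi> M)" "lspan \<Gamma> M (u ` carrier Y) = carrier M"
  shows "subquot_in \<Gamma> U M (carrier M) {\<zero>\<^bsub>M\<^esub>}"
proof -
  interpret M: left_module \<Gamma> M by fact
  have "Y \<in> fg_modules \<Lambda>" using Y by (rule contracted_classD)
  then have Y': "left_module \<Lambda> Y" "fin_gen_module \<Lambda> Y" by (auto simp: fg_modules_def)
  have uY: "u ` carrier Y \<subseteq> carrier M" using module_homD(1)[OF u(1)] by auto
  from fg_modules_representative[OF M generated_fin_gen[OF h M Y' u]]
  obtain P e where P: "P \<in> fg_modules \<Gamma>" and e: "e \<in> module_hom \<Gamma> M P" "e ` carrier M = carrier P"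
    "\<And>x. x \<in> carrier M \<Longrightarrow> e x = \<zero>\<^bsub>P\<^esub> \<longleftrightarrow> x = \<zero>\<^bsub>M\<^esub>" by metis
  have P': "left_module \<Gamma> P" using P by (simp add: fg_modules_def)
  have "lspan \<Gamma> P ((\<lambda>x. e (u x)) ` carrier Y) = carrier P"
    using lspan_image[OF M P' e(1) uY] u(2) e(2) by (simp add: image_image)
  then have "P \<in> U"
    using contracted_classD(2)[OF Y P module_hom_compose[OF u(1) module_hom_restrict_scalars[OF h e(1)]]]
    by blast
  moreover have "{x \<in> carrier M. e x = \<zero>\<^bsub>P\<^esub>} = {\<zero>\<^bsub>M\<^esub>}"
  proof -
    have "{x \<in> carrier M. e x = \<zero>\<^bsub>P\<^esub>} = {x \<in> carrier M. x = \<zero>\<^bsub>M\<^esub>}"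
      using e(3) by (intro Collect_cong conj_cong) auto
    then show ?thesis by auto
  qed
  ultimately show ?thesis
    unfolding subquot_in_def using e left_submodule_carrier[OF M] by auto
qed

lemma subquot_in_restrictD:
  assumes "left_submodule R M A" "subquot_in R T (M\<lparr>carrier := A\<rparr>) A B"
  shows "subquot_in R T M A B"
  using assms by (simp add: subquot_in_def)

lemma restrict_scalars_restrict:
  "restrict_scalars \<psi> (M\<lparr>carrier := A\<rparr>) = (restrict_scalars \<psi> M)\<lparr>carrier := A\<rparr>"
  by (simp add: restrict_scalars_def)

text \<open>This amounts to right exactness of \<open>\<Gamma> \<otimes>\<^sub>\<Lambda> -\<close>.\<close>

lemma torsion_class_contracted:
  fixes \<Lambda> :: "('a, 'm) ring_scheme" and \<Gamma> :: "('c, 'p) ring_scheme"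
  assumes h: "ring_hom_ring \<Lambda> \<Gamma> \<psi>" and U: "torsion_class \<Gamma> U"
  shows "torsion_class \<Lambda> (contracted_class \<Lambda> \<Gamma> \<psi> U)"
proof (rule torsion_classI)
  interpret h: ring_hom_ring \<Lambda> \<Gamma> \<psi> by fact
  show "contracted_class \<Lambda> \<Gamma> \<psi> U \<subseteq> fg_modules \<Lambda>" by (auto simp: contracted_class_def)
  obtain Z where Z: "Z \<in> fg_modules \<Lambda>" "carrier Z = {\<zero>\<^bsub>Z\<^esub>}"
    by (rule zero_module_exists[OF h.R.ring_axioms])
  have "Z \<in> contracted_class \<Lambda> \<Gamma> \<psi> U"
  proof (rule contracted_classI[OF Z(1)])
    fix M u assume M: "M \<in> fg_modules \<Gamma>" and u: "u \<in> module_hom \<Lambda> Z (restrict_scalars \<psi> M)"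
      "lspan \<Gamma> M (u ` carrier Z) = carrier M"
    have M': "left_module \<Gamma> M" using M by (simp add: fg_modules_def)
    have "u \<zero>\<^bsub>Z\<^esub> = \<zero>\<^bsub>M\<^esub>"
      using module_hom_zero[OF _ left_module_restrict_scalars[OF h M'] u(1)] Z(1) by (simp add: fg_modules_def)
    then have "lspan \<Gamma> M {\<zero>\<^bsub>M\<^esub>} = carrier M" using u(2) unfolding Z(2) by simp
    then have "carrier M = {\<zero>\<^bsub>M\<^esub>}"
      using lspan_minimal[OF left_submodule_zero[OF M'] order_refl] left_submoduleD(2)[OF left_submodule_zero[OF M']]
        lspan_superset[of "{\<zero>\<^bsub>M\<^esub>}" \<Gamma> M] by blast
    then show "M \<in> U"
      using subquot_in_refl[OF U M' left_submodule_carrier[OF M']] by (intro subquot_in_zero_member[OF U M]) simp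
  qed
  then show "contracted_class \<Lambda> \<Gamma> \<psi> U \<noteq> {}" by blast
next
  fix M N f
  assume M: "M \<in> contracted_class \<Lambda> \<Gamma> \<psi> U" and N: "N \<in> fg_modules \<Lambda>"
    and f: "f \<in> module_hom \<Lambda> M N" "f ` carrier M = carrier N"
  show "N \<in> contracted_class \<Lambda> \<Gamma> \<psi> U"
  proof (rule contracted_classI[OF N])
    fix P u assume P: "P \<in> fg_modules \<Gamma>" and u: "u \<in> module_hom \<Lambda> N (restrict_scalars \<psi> P)"
      and gen: "lspan \<Gamma> P (u ` carrier N) = carrier P"
    show "P \<in> U"
    proof (rule contracted_classD(2)[OF M P module_hom_compose[OF f(1) u]])
      show "lspan \<Gamma> P ((\<lambda>x. u (f x)) ` carrier M) = carrier P"
        using gen unfolding f(2)[symmetric] image_image .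
    qed
  qed
next
  fix L M N f g
  assume L: "L \<in> contracted_class \<Lambda> \<Gamma> \<psi> U" and N: "N \<in> contracted_class \<Lambda> \<Gamma> \<psi> U"
    and M: "M \<in> fg_modules \<Lambda>" and ex: "short_exact \<Lambda> L M N f g"
  have mods: "left_module \<Lambda> L" "left_module \<Lambda> M" "left_module \<Lambda> N"
    using contracted_classD(1)[OF L] contracted_classD(1)[OF N] M by (auto simp: fg_modules_def)
  have f: "f \<in> module_hom \<Lambda> L M" and g: "g \<in> module_hom \<Lambda> M N" "g ` carrier M = carrier N"
    and im: "f ` carrier L = {x \<in> carrier M. g x = \<zero>\<^bsub>N\<^esub>}"
    using ex by (auto simp: short_exact_def)
  show "M \<in> contracted_class \<Lambda> \<Gamma> \<psi> U"
  proof (rule contracted_classI[OF M])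
    fix P u assume P: "P \<in> fg_modules \<Gamma>" and u: "u \<in> module_hom \<Lambda> M (restrict_scalars \<psi> P)"
      and gen: "lspan \<Gamma> P (u ` carrier M) = carrier P"
    have P': "left_module \<Gamma> P" using P by (simp add: fg_modules_def)
    define P1 where "P1 = lspan \<Gamma> P ((\<lambda>x. u (f x)) ` carrier L)"
    have sub: "(\<lambda>x. u (f x)) ` carrier L \<subseteq> carrier P"
      using module_homD(1)[OF u] module_homD(1)[OF f] by auto
    have P1: "left_submodule \<Gamma> P P1" unfolding P1_def by (rule left_submodule_lspan[OF P' sub])
    have uf_P1: "(\<lambda>x. u (f x)) ` carrier L \<subseteq> P1" unfolding P1_def by (rule lspan_superset)
    have uf: "(\<lambda>x. u (f x)) \<in> module_hom \<Lambda> L (restrict_scalars \<psi> (P\<lparr>carrier := P1\<rparr>))"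
      unfolding restrict_scalars_restrict
      by (rule module_hom_restrict_target[OF module_hom_compose[OF f u] uf_P1])
    have "subquot_in \<Gamma> U (P\<lparr>carrier := P1\<rparr>) (carrier (P\<lparr>carrier := P1\<rparr>)) {\<zero>\<^bsub>P\<lparr>carrier := P1\<rparr>\<^esub>}"
      using lspan_restrict[OF P' P1 uf_P1]
      by (intro contracted_class_generates[OF h left_module_restrict[OF P' P1] L uf]) (simp add: P1_def)
    then have s1: "subquot_in \<Gamma> U P P1 {\<zero>\<^bsub>P\<^esub>}"
      by (intro subquot_in_restrictD[OF P1]) simp
    obtain Q :: "('c, (nat \<Rightarrow> 'c) set set) module" and q where Q: "left_module \<Gamma> Q"
      and q: "q \<in> module_hom \<Gamma> P Q" "q ` carrier P = carrier Q"
      and kerq: "\<And>x. x \<in> carrier P \<Longrightarrow> q x = \<zero>\<^bsub>Q\<^esub> \<longleftrightarrow> x \<in> P1"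
      using quotient_module_exists[OF P' P1] by blast
    note q' = module_hom_restrict_scalars[OF h q(1)]
    obtain v where v: "v \<in> module_hom \<Lambda> N (restrict_scalars \<psi> Q)"
      "\<And>x. x \<in> carrier M \<Longrightarrow> v (g x) = q (u x)"
    proof (rule module_hom_factor[OF mods(2,3) left_module_restrict_scalars[OF h Q] g module_hom_compose[OF u q']])
      fix x assume "x \<in> carrier M" "g x = \<zero>\<^bsub>N\<^esub>"
      then have "x \<in> f ` carrier L" unfolding im by simp
      then obtain l where l: "l \<in> carrier L" "x = f l" by blast
      then have "u x \<in> P1" using uf_P1 by blast
      then show "q (u x) = \<zero>\<^bsub>restrict_scalars \<psi> Q\<^esub>"
        using kerq[of "u x"] left_submoduleD(1)[OF P1] by simp
    qed blast
    have "v ` carrier N = q ` u ` carrier M"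
      unfolding g(2)[symmetric] image_image using v(2) by (rule image_cong[OF refl])
    then have "lspan \<Gamma> Q (v ` carrier N) = carrier Q"
      using lspan_image[OF P' Q q(1), of "u ` carrier M"] module_homD(1)[OF u] gen q(2) by auto
    from contracted_class_generates[OF h Q N v(1) this]
    have "subquot_in \<Gamma> U P (carrier P) P1"
    proof (rule subquot_in_vimage)
      show "{x \<in> carrier P. q x \<in> {\<zero>\<^bsub>Q\<^esub>}} = P1"
        using kerq left_submoduleD(1)[OF P1] by blast
    qed (use q left_submodule_carrier[OF P'] in auto)
    from subquot_in_trans[OF U P' this s1] show "P \<in> U"
      by (rule subquot_in_zero_member[OF U P])
  qed
qed

lemma lattice_in_image:
  assumes h: "ring_hom_ring \<Lambda> \<Gamma> \<psi>" and T: "torsion_class \<Lambda> T"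
    and M: "left_module \<Gamma> M" and N: "left_module \<Gamma> N"
    and f: "f \<in> module_hom \<Gamma> M N" "f ` carrier M = carrier N"
    and W: "lattice_in \<Lambda> \<Gamma> \<psi> M W" "subquot_in \<Lambda> T (restrict_scalars \<psi> M) W {\<zero>\<^bsub>M\<^esub>}"
  shows "lattice_in \<Lambda> \<Gamma> \<psi> N (f ` W)" "subquot_in \<Lambda> T (restrict_scalars \<psi> N) (f ` W) {\<zero>\<^bsub>N\<^esub>}"
proof -
  interpret N: left_module \<Gamma> N by fact
  note f' = module_hom_restrict_scalars[OF h f(1)]
  note M' = left_module_restrict_scalars[OF h M] and N' = left_module_restrict_scalars[OF h N]
  have W': "left_submodule \<Lambda> (restrict_scalars \<psi> M) W" "lspan \<Gamma> M W = carrier M"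
    using W(1) by (auto simp: lattice_in_def)
  have WM: "W \<subseteq> carrier M" using W'(1) by (auto simp: left_submodule_def)
  have fW: "left_submodule \<Lambda> (restrict_scalars \<psi> N) (f ` W)"
    by (rule left_submodule_image[OF M' N' f' W'(1)])
  show "lattice_in \<Lambda> \<Gamma> \<psi> N (f ` W)"
    unfolding lattice_in_def using fW lspan_image[OF M N f(1) WM] W'(2) f(2) by simp
  show "subquot_in \<Lambda> T (restrict_scalars \<psi> N) (f ` W) {\<zero>\<^bsub>N\<^esub>}"
    using subquot_in_image_zero[OF T M' N' W(2) f'] module_hom_zero[OF M N f(1)] by simp
qed

lemma extended_classD:
  assumes "M \<in> extended_class \<Lambda> \<Gamma> \<psi> T"
  obtains W where "M \<in> fg_modules \<Gamma>" "lattice_in \<Lambda> \<Gamma> \<psi> M W"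
    "subquot_in \<Lambda> T (restrict_scalars \<psi> M) W {\<zero>\<^bsub>M\<^esub>}"
  using assms unfolding extended_class_def by blast

lemma extended_classI:
  "\<lbrakk>M \<in> fg_modules \<Gamma>; lattice_in \<Lambda> \<Gamma> \<psi> M W; subquot_in \<Lambda> T (restrict_scalars \<psi> M) W {\<zero>\<^bsub>M\<^esub>}\<rbrakk>
    \<Longrightarrow> M \<in> extended_class \<Lambda> \<Gamma> \<psi> T"
  unfolding extended_class_def by blast

text \<open>All closure properties but the one under extensions come for free.\<close>

lemma torsion_class_extended:
  assumes h: "ring_hom_ring \<Lambda> \<Gamma> \<psi>" and T: "torsion_class \<Lambda> T"
    and ext: "\<And>L M N f g. \<lbrakk>L \<in> extended_class \<Lambda> \<Gamma> \<psi> T; N \<in> extended_class \<Lambda> \<Gamma> \<psi> T; M \<in> fg_modules \<Gamma>;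
      short_exact \<Gamma> L M N f g\<rbrakk> \<Longrightarrow> M \<in> extended_class \<Lambda> \<Gamma> \<psi> T"
  shows "torsion_class \<Gamma> (extended_class \<Lambda> \<Gamma> \<psi> T)"
proof (rule torsion_classI[OF _ _ _ ext])
  interpret h: ring_hom_ring \<Lambda> \<Gamma> \<psi> by fact
  show "extended_class \<Lambda> \<Gamma> \<psi> T \<subseteq> fg_modules \<Gamma>" by (auto simp: extended_class_def)
  obtain Z where Z: "Z \<in> fg_modules \<Gamma>" "carrier Z = {\<zero>\<^bsub>Z\<^esub>}"
    by (rule zero_module_exists[OF h.S.ring_axioms])
  have Z': "left_module \<Gamma> Z" using Z by (simp add: fg_modules_def)
  note Z'' = left_module_restrict_scalars[OF h Z']
  have "Z \<in> extended_class \<Lambda> \<Gamma> \<psi> T"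
  proof (rule extended_classI[OF Z(1)])
    show "subquot_in \<Lambda> T (restrict_scalars \<psi> Z) {\<zero>\<^bsub>Z\<^esub>} {\<zero>\<^bsub>Z\<^esub>}"
      using subquot_in_refl[OF T Z'' left_submodule_zero[OF Z'']] by simp
    show "lattice_in \<Lambda> \<Gamma> \<psi> Z {\<zero>\<^bsub>Z\<^esub>}"
      unfolding lattice_in_def
      using left_submodule_zero[OF Z''] lspan_minimal[OF left_submodule_carrier[OF Z'], of "{\<zero>\<^bsub>Z\<^esub>}"]
        lspan_superset[of "{\<zero>\<^bsub>Z\<^esub>}" \<Gamma> Z] Z(2) by simp
  qed
  then show "extended_class \<Lambda> \<Gamma> \<psi> T \<noteq> {}" by blast
  fix M N f assume M: "M \<in> extended_class \<Lambda> \<Gamma> \<psi> T" and N: "N \<in> fg_modules \<Gamma>"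
    and f: "f \<in> module_hom \<Gamma> M N" "f ` carrier M = carrier N"
  obtain W where "M \<in> fg_modules \<Gamma>" and W: "lattice_in \<Lambda> \<Gamma> \<psi> M W"
    "subquot_in \<Lambda> T (restrict_scalars \<psi> M) W {\<zero>\<^bsub>M\<^esub>}"
    using M by (rule extended_classD)
  then show "N \<in> extended_class \<Lambda> \<Gamma> \<psi> T"
    using extended_classI[OF N lattice_in_image[OF h T _ _ f W]] N by (simp add: fg_modules_def)
qed

text \<open>Comparison of extended classes on modules that are not on the type of \<^const>\<open>fg_modules\<close>.\<close>

lemma extended_class_transfer:
  assumes h: "ring_hom_ring \<Lambda> \<Gamma> \<psi>" and T: "torsion_class \<Lambda> T" and T': "torsion_class \<Lambda> T'"
    and sub: "extended_class \<Lambda> \<Gamma> \<psi> T \<subseteq> extended_class \<Lambda> \<Gamma> \<psi> T'"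
    and M: "left_module \<Gamma> M"
    and W: "lattice_in \<Lambda> \<Gamma> \<psi> M W" "subquot_in \<Lambda> T (restrict_scalars \<psi> M) W {\<zero>\<^bsub>M\<^esub>}"
  obtains W' where "lattice_in \<Lambda> \<Gamma> \<psi> M W'" "subquot_in \<Lambda> T' (restrict_scalars \<psi> M) W' {\<zero>\<^bsub>M\<^esub>}"
proof -
  interpret M: left_module \<Gamma> M by fact
  note M' = left_module_restrict_scalars[OF h M]
  note zM = restrict_scalars_simps(2)[of \<psi> M]
  have W': "left_submodule \<Lambda> (restrict_scalars \<psi> M) W" "lspan \<Gamma> M W = carrier M"
    using W(1) by (auto simp: lattice_in_def)
  have WM: "W \<subseteq> carrier M" using W'(1) by (auto simp: left_submodule_def)
  have "fin_gen_module \<Lambda> ((restrict_scalars \<psi> M)\<lparr>carrier := W\<rparr>)"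
    using subquot_in_zero_fin_gen[OF T M', unfolded zM, OF W(2)] .
  then have "fin_gen_module \<Gamma> M"
    using generated_fin_gen[OF h M left_module_restrict[OF M' W'(1)] _ module_hom_id_restrict] WM W'(2)
    by simp
  from fg_modules_representative[OF M this]
  obtain P e where P: "P \<in> fg_modules \<Gamma>" and e: "e \<in> module_hom \<Gamma> M P" "e ` carrier M = carrier P"
    and kere: "\<And>x. x \<in> carrier M \<Longrightarrow> e x = \<zero>\<^bsub>P\<^esub> \<longleftrightarrow> x = \<zero>\<^bsub>M\<^esub>" by metis
  have P': "left_module \<Gamma> P" using P by (simp add: fg_modules_def)
  have "P \<in> extended_class \<Lambda> \<Gamma> \<psi> T"
    by (rule extended_classI[OF P lattice_in_image[OF h T M P' e W]])
  then obtain V where V: "lattice_in \<Lambda> \<Gamma> \<psi> P V" "subquot_in \<Lambda> T' (restrict_scalars \<psi> P) V {\<zero>\<^bsub>P\<^esub>}"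
    using sub by (meson extended_classD subsetD)
  have "(\<lambda>x. x) \<in> module_hom \<Gamma> M M" by (auto simp: module_hom_def)
  then obtain d where d: "d \<in> module_hom \<Gamma> P M" "\<And>x. x \<in> carrier M \<Longrightarrow> d (e x) = x"
    by (rule module_hom_factor[OF M P' M e]) (use kere in auto)
  have "d ` carrier P = carrier M"
    unfolding e(2)[symmetric] image_image using d(2) by simp
  from lattice_in_image[OF h T' P' M d(1) this V] show ?thesis by (rule that)
qed

text \<open>The hypothesis says that every finitely generated \<open>\<Gamma>\<close>-module \<open>M\<close> is \<open>\<Gamma> \<otimes>\<^sub>\<Lambda> W\<close> for a finitely
  generated lattice \<open>W\<close>, in the weak form that \<open>M\<close> maps onto every \<open>\<Gamma>\<close>-module generated by an image
  of \<open>W\<close>. Then every torsion class \<open>U\<close> of \<open>\<Gamma>\<close> is the extension of its contraction.\<close>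

lemma finite_tors_of_scalar_extension:
  assumes h: "ring_hom_ring \<Lambda> \<Gamma> \<psi>"
    and lattice: "\<And>M. M \<in> fg_modules \<Gamma> \<Longrightarrow> \<exists>W. lattice_in \<Lambda> \<Gamma> \<psi> M W \<and>
      fin_gen_module \<Lambda> ((restrict_scalars \<psi> M)\<lparr>carrier := W\<rparr>) \<and>
      (\<forall>N\<in>fg_modules \<Gamma>. \<forall>u\<in>module_hom \<Lambda> ((restrict_scalars \<psi> M)\<lparr>carrier := W\<rparr>) (restrict_scalars \<psi> N).
        lspan \<Gamma> N (u ` W) = carrier N \<longrightarrow> (\<exists>f\<in>module_hom \<Gamma> M N. f ` carrier M = carrier N))"
    and fin: "finite (tors \<Lambda>)"
  shows "finite (tors \<Gamma>)"
proof (rule finite_subset[OF _ finite_imageI[OF fin, of "extended_class \<Lambda> \<Gamma> \<psi>"]], rule subsetI)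
  fix U assume "U \<in> tors \<Gamma>"
  then have U: "torsion_class \<Gamma> U" by (simp add: tors_def)
  define T where "T = contracted_class \<Lambda> \<Gamma> \<psi> U"
  have T: "torsion_class \<Lambda> T" unfolding T_def by (rule torsion_class_contracted[OF h U])
  have "extended_class \<Lambda> \<Gamma> \<psi> T = U"
  proof
    show "extended_class \<Lambda> \<Gamma> \<psi> T \<subseteq> U"
    proof
      fix M assume "M \<in> extended_class \<Lambda> \<Gamma> \<psi> T"
      then obtain W where M: "M \<in> fg_modules \<Gamma>" and W: "lattice_in \<Lambda> \<Gamma> \<psi> M W"
        "subquot_in \<Lambda> T (restrict_scalars \<psi> M) W {\<zero>\<^bsub>M\<^esub>}" by (rule extended_classD)
      have M': "left_module \<Lambda> (restrict_scalars \<psi> M)"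
        using M by (intro left_module_restrict_scalars[OF h]) (simp add: fg_modules_def)
      obtain N u where N: "N \<in> T" "u \<in> module_hom \<Lambda> N (restrict_scalars \<psi> M)" "u ` carrier N = W"
        using subquot_in_zeroD[OF T M'] W(2) by (metis restrict_scalars_simps(2))
      then show "M \<in> U"
        using contracted_classD(2)[OF N(1)[unfolded T_def] M N(2)] W(1) by (simp add: lattice_in_def)
    qed
    show "U \<subseteq> extended_class \<Lambda> \<Gamma> \<psi> T"
    proof
      fix M assume MU: "M \<in> U"
      then have M: "M \<in> fg_modules \<Gamma>" by (rule torsion_class_fg[OF U])
      have M': "left_module \<Gamma> M" using M by (simp add: fg_modules_def)
      note M'' = left_module_restrict_scalars[OF h M']
      obtain W where W: "lattice_in \<Lambda> \<Gamma> \<psi> M W"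
        and fg: "fin_gen_module \<Lambda> ((restrict_scalars \<psi> M)\<lparr>carrier := W\<rparr>)"
        and univ: "\<forall>N\<in>fg_modules \<Gamma>.
          \<forall>u\<in>module_hom \<Lambda> ((restrict_scalars \<psi> M)\<lparr>carrier := W\<rparr>) (restrict_scalars \<psi> N).
          lspan \<Gamma> N (u ` W) = carrier N \<longrightarrow> (\<exists>f\<in>module_hom \<Gamma> M N. f ` carrier M = carrier N)"
        using lattice[OF M] by (elim exE conjE)
      have W': "left_submodule \<Lambda> (restrict_scalars \<psi> M) W" using W by (simp add: lattice_in_def)
      from fg_modules_representative[OF left_module_restrict[OF M'' W'] fg]
      obtain Y e where Y: "Y \<in> fg_modules \<Lambda>"
        and e: "e \<in> module_hom \<Lambda> ((restrict_scalars \<psi> M)\<lparr>carrier := W\<rparr>) Y" "e ` W = carrier Y"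
        and kere: "\<And>x. x \<in> W \<Longrightarrow> e x = \<zero>\<^bsub>Y\<^esub> \<longleftrightarrow> x = \<zero>\<^bsub>M\<^esub>" by auto
      have YT: "Y \<in> T"
        unfolding T_def
      proof (rule contracted_classI[OF Y])
        fix N u assume N: "N \<in> fg_modules \<Gamma>" and u: "u \<in> module_hom \<Lambda> Y (restrict_scalars \<psi> N)"
          "lspan \<Gamma> N (u ` carrier Y) = carrier N"
        have "lspan \<Gamma> N ((\<lambda>x. u (e x)) ` W) = carrier N"
          using u(2) unfolding e(2)[symmetric] image_image .
        with univ[rule_format, OF N module_hom_compose[OF e(1) u(1)]]
        obtain f where "f \<in> module_hom \<Gamma> M N" "f ` carrier M = carrier N" by blast
        then show "N \<in> U" by (rule torsion_class_factor[OF U MU N])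
      qed
      have "{x \<in> W. e x = \<zero>\<^bsub>Y\<^esub>} = {x \<in> W. x = \<zero>\<^bsub>M\<^esub>}"
        using kere by (intro Collect_cong conj_cong) auto
      also have "\<dots> = {\<zero>\<^bsub>M\<^esub>}" using left_submoduleD(2)[OF W'] by auto
      finally have "subquot_in \<Lambda> T (restrict_scalars \<psi> M) W {\<zero>\<^bsub>M\<^esub>}"
        unfolding subquot_in_def using W' YT e by blast
      then show "M \<in> extended_class \<Lambda> \<Gamma> \<psi> T" by (rule extended_classI[OF M W])
    qed
  qed
  moreover have "T \<in> tors \<Lambda>" using T by (simp add: tors_def)
  ultimately show "U \<in> extended_class \<Lambda> \<Gamma> \<psi> ` tors \<Lambda>" by blast
qed

section \<open>Noetherian rings of dimension one\<close>

lemma (in noetherian_ring) maximal_element_ideals: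
  assumes "\<I> \<noteq> {}" "\<And>I. I \<in> \<I> \<Longrightarrow> ideal I R"
  obtains I where "I \<in> \<I>" "\<And>J. \<lbrakk>J \<in> \<I>; I \<subseteq> J\<rbrakk> \<Longrightarrow> J = I"
proof -
  have "\<Union>C \<in> \<I>" if C: "C \<noteq> {}" "subset.chain \<I> C" for C
  proof -
    have "subset.chain {I. ideal I R} C"
      using C(2) assms(2) unfolding subset_chain_def by blast
    then have "\<Union>C \<in> C" by (rule ideal_chain_is_trivial[OF C(1)])
    then show ?thesis using C(2) unfolding subset_chain_def by blast
  qed
  then show ?thesis using subset_Zorn_nonempty[OF assms(1)] that by blast
qed

lemma nonzero_prime_is_maximal:
  assumes "local_ring \<mm> R" "noetherian_domain R" "krull_dim R = 1"
    and P: "primeideal P R" "P \<noteq> {\<zero>\<^bsub>R\<^esub>}"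
  shows "P = \<mm>"
proof (rule ccontr)
  assume "P \<noteq> \<mm>"
  interpret local_ring \<mm> R by fact
  interpret noetherian_domain R by fact
  interpret P: primeideal P R by fact
  have "ideal P R" by unfold_locales
  let ?\<I> = "{J. ideal J R \<and> P \<subseteq> J \<and> J \<noteq> carrier R}"
  have "P \<in> ?\<I>" using P.I_notcarr \<open>ideal P R\<close> by auto
  then have "?\<I> \<noteq> {}" by blast
  then obtain J where J: "J \<in> ?\<I>" "\<And>J'. \<lbrakk>J' \<in> ?\<I>; J \<subseteq> J'\<rbrakk> \<Longrightarrow> J' = J"
    by (rule maximal_element_ideals) auto
  have "maximalideal J R"
  proof (rule maximalidealI)
    show "ideal J R" "carrier R \<noteq> J" using J(1) by auto
    show "J' = J \<or> J' = carrier R" if "ideal J' R" "J \<subseteq> J'" "J' \<subseteq> carrier R" for J'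
      using J that by blast
  qed
  then have "J = \<mm>" by (rule unique_maximalideal)
  with J(1) \<open>P \<noteq> \<mm>\<close> have "P \<subset> \<mm>" by blast
  have "\<zero>\<^bsub>R\<^esub> \<in> P" using P.zero_closed by simp
  then have "{\<zero>\<^bsub>R\<^esub>} \<subset> P" using P(2) by blast
  have "maximalideal \<mm> R" by unfold_locales
  then have "primeideal \<mm> R" by (rule maximalideal_prime)
  \<comment> \<open>Otherwise \<open>0 \<subset> P \<subset> \<mm>\<close> would be a chain of length two.\<close>
  define p where "p i = (if i = 0 then {\<zero>\<^bsub>R\<^esub>} else if i = 1 then P else \<mm>)" for i :: nat
  have "(\<forall>i\<le>2. primeideal (p i) R) \<and> (\<forall>i<2. p i \<subset> p (Suc i))"
    using zeroprimeideal P(1) \<open>primeideal \<mm> R\<close> \<open>P \<subset> \<mm>\<close> \<open>{\<zero>\<^bsub>R\<^esub>} \<subset> P\<close>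
    by (auto simp: p_def less_Suc_eq numeral_2_eq_2)
  then have "enat 2 \<le> krull_dim R"
    unfolding krull_dim_def by (intro Sup_upper) blast
  then show False unfolding assms(3) by (simp add: one_enat_def)
qed

section \<open>Torsion and ideals in modules over a module-finite algebra\<close>

lemma module_hom_central_smult:
  assumes "module_finite_algebra R \<Lambda> \<phi>" "left_module \<Lambda> M" "r \<in> carrier R"
  shows "(\<lambda>x. \<phi> r \<odot>\<^bsub>M\<^esub> x) \<in> module_hom \<Lambda> M M"
proof -
  interpret module_finite_algebra R \<Lambda> \<phi> by fact
  interpret M: left_module \<Lambda> M by fact
  show ?thesis
    using assms(3) by (intro module_homI)
      (auto simp: M.smult_closed M.smult_r_distr M.smult_assoc1[symmetric] central)
qed

text \<open>If \<open>B\<close> generates \<open>\<Lambda>\<close> over \<open>R\<close> and \<open>S\<close> generates \<open>M\<close> over \<open>\<Lambda>\<close>, then the products \<open>b s\<close>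
  generate \<open>M\<close> over \<open>R\<close>.\<close>

lemma fin_gen_over_base:
  assumes A: "module_finite_algebra R \<Lambda> \<phi>" and M: "left_module \<Lambda> M" "fin_gen_module \<Lambda> M"
  shows "fin_gen_module R (restrict_scalars \<phi> M)"
proof -
  interpret module_finite_algebra R \<Lambda> \<phi> by fact
  interpret M: left_module \<Lambda> M by fact
  have h: "ring_hom_ring R \<Lambda> \<phi>" by unfold_locales
  note MR = left_module_restrict_scalars[OF h M(1)]
  note AR = left_module_alg_module[OF h]
  obtain B where B: "finite B" "B \<subseteq> carrier \<Lambda>" "lspan R (alg_module \<Lambda> \<phi>) B = carrier \<Lambda>"
    using fin_gen unfolding fin_gen_module_iff[OF AR] by (auto simp: alg_module_def)
  obtain S where S: "finite S" "S \<subseteq> carrier M" "lspan \<Lambda> M S = carrier M"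
    using M(2) unfolding fin_gen_module_iff[OF M(1)] by blast
  define G where "G = (\<lambda>(b, s). b \<odot>\<^bsub>M\<^esub> s) ` (B \<times> S)"
  have G: "finite G" "G \<subseteq> carrier (restrict_scalars \<phi> M)"
    using B S by (auto simp: G_def intro!: M.smult_closed)
  define D where "D = lspan R (restrict_scalars \<phi> M) G"
  have D: "left_submodule R (restrict_scalars \<phi> M) D"
    unfolding D_def by (rule left_submodule_lspan[OF MR G(2)])
  note D' = left_submoduleD[OF D, simplified]
  have 1: "a \<odot>\<^bsub>M\<^esub> s \<in> D" if a: "a \<in> carrier \<Lambda>" and s: "s \<in> S" for a s
  proof -
    have s': "s \<in> carrier M" using s S by auto
    have "left_submodule R (alg_module \<Lambda> \<phi>) {a \<in> carrier \<Lambda>. a \<odot>\<^bsub>M\<^esub> s \<in> D}"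
      using D' s' by (intro left_submoduleI)
        (auto simp: alg_module_def M.smult_zero_left M.smult_l_distr M.smult_assoc1)
    moreover have "b \<odot>\<^bsub>M\<^esub> s \<in> D" if "b \<in> B" for b
      using that s lspan_superset[of G R "restrict_scalars \<phi> M"] by (force simp: D_def G_def)
    ultimately have "lspan R (alg_module \<Lambda> \<phi>) B \<subseteq> {a \<in> carrier \<Lambda>. a \<odot>\<^bsub>M\<^esub> s \<in> D}"
      using B(2) by (intro lspan_minimal) auto
    then show ?thesis using a unfolding B(3) by blast
  qed
  have "left_submodule R (restrict_scalars \<phi> M) {d \<in> D. \<forall>a\<in>carrier \<Lambda>. a \<odot>\<^bsub>M\<^esub> d \<in> D}"
  proof (rule left_submoduleI)
    fix r x assume rx: "r \<in> carrier R" "x \<in> {d \<in> D. \<forall>a\<in>carrier \<Lambda>. a \<odot>\<^bsub>M\<^esub> d \<in> D}"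
    have "a \<odot>\<^bsub>M\<^esub> (\<phi> r \<odot>\<^bsub>M\<^esub> x) \<in> D" if a: "a \<in> carrier \<Lambda>" for a
    proof -
      have "a \<odot>\<^bsub>M\<^esub> (\<phi> r \<odot>\<^bsub>M\<^esub> x) = \<phi> r \<odot>\<^bsub>M\<^esub> (a \<odot>\<^bsub>M\<^esub> x)"
        using rx a D'(1) by (simp add: M.smult_assoc1[symmetric] central)
      then show ?thesis using rx a D' by simp
    qed
    then show "r \<odot>\<^bsub>restrict_scalars \<phi> M\<^esub> x \<in> {d \<in> D. \<forall>a\<in>carrier \<Lambda>. a \<odot>\<^bsub>M\<^esub> d \<in> D}"
      using rx D' by simp
  qed (use D' in \<open>auto simp: M.smult_zero_right M.smult_r_distr\<close>)
  moreover have "a \<odot>\<^bsub>M\<^esub> g \<in> D" if g: "g \<in> G" "a \<in> carrier \<Lambda>" for a g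
  proof -
    obtain b s where "b \<in> B" "s \<in> S" "g = b \<odot>\<^bsub>M\<^esub> s" using g(1) by (auto simp: G_def)
    then show ?thesis using 1[of "a \<otimes>\<^bsub>\<Lambda>\<^esub> b" s] g(2) B(2) S(2) by (auto simp: M.smult_assoc1 subset_iff)
  qed
  ultimately have "D \<subseteq> {d \<in> D. \<forall>a\<in>carrier \<Lambda>. a \<odot>\<^bsub>M\<^esub> d \<in> D}"
    using lspan_superset[of G R "restrict_scalars \<phi> M"] unfolding D_def by (intro lspan_minimal) blast+
  then have "left_submodule \<Lambda> M D"
    using D' by (intro left_submoduleI) auto
  moreover have "s \<in> D" if "s \<in> S" for s
    using 1[OF S.one_closed that] that S by (auto simp: M.smult_one)
  ultimately have "carrier M \<subseteq> D"
    unfolding S(3)[symmetric] by (intro lspan_minimal) auto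
  then show ?thesis
    unfolding fin_gen_module_iff[OF MR] using G D'(1) by (intro exI[of _ G]) (auto simp: D_def)
qed

text \<open>A submodule \<open>L\<close> with \<open>L / U\<close> torsion has \<open>r L \<subseteq> U\<close> for a single \<open>r\<close>, as far as \<open>L\<close> lies in a
  finitely generated submodule; \<open>R\<close> need not be noetherian. The proof is by induction on the
  generators. If a nonzero multiple of the new generator \<open>w\<close> lies in
  \<open>lspan S + L\<close>, then multiplying by it moves \<open>lspan (insert w S) \<inter> L\<close> into \<open>lspan S \<inter> L\<close> up to a
  multiple of one fixed element of \<open>L\<close>; otherwise \<open>lspan (insert w S) \<inter> L = lspan S \<inter> L\<close>.\<close>

lemma bounded_torsion_lspan:
  assumes "domain R" and M: "left_module R M"
    and L: "left_submodule R M L" and U: "left_submodule R M U"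
    and tors: "\<And>l. l \<in> L \<Longrightarrow> \<exists>r\<in>carrier R - {\<zero>\<^bsub>R\<^esub>}. r \<odot>\<^bsub>M\<^esub> l \<in> U"
    and S: "finite S" "S \<subseteq> carrier M"
  shows "\<exists>r\<in>carrier R - {\<zero>\<^bsub>R\<^esub>}. \<forall>x\<in>lspan R M S \<inter> L. r \<odot>\<^bsub>M\<^esub> x \<in> U"
  using S
proof (induction S)
  case empty
  interpret domain R by fact
  interpret M: left_module R M by fact
  have "lspan R M {} \<subseteq> {\<zero>\<^bsub>M\<^esub>}"
    by (rule lspan_minimal[OF left_submodule_zero[OF M]]) simp
  then show ?case
    using left_submoduleD(2)[OF U] by (intro bexI[of _ "\<one>\<^bsub>R\<^esub>"]) (auto simp: M.smult_zero_right)
next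
  case (insert w S)
  interpret domain R by fact
  interpret M: left_module R M by fact
  note L' = left_submoduleD[OF L] and U' = left_submoduleD[OF U]
  have w: "w \<in> carrier M" and S: "S \<subseteq> carrier M" using insert by auto
  note N = left_submodule_lspan[OF M S]
  note N' = left_submoduleD[OF N]
  obtain r where r: "r \<in> carrier R" "r \<noteq> \<zero>\<^bsub>R\<^esub>" "\<And>x. x \<in> lspan R M S \<Longrightarrow> x \<in> L \<Longrightarrow> r \<odot>\<^bsub>M\<^esub> x \<in> U"
    using insert S by auto
  have neg: "(x \<oplus>\<^bsub>M\<^esub> y) \<oplus>\<^bsub>M\<^esub> (\<ominus>\<^bsub>R\<^esub> \<one>\<^bsub>R\<^esub>) \<odot>\<^bsub>M\<^esub> y = x" if "x \<in> carrier M" "y \<in> carrier M" for x y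
    using that M.add_smult_minus_one[of y] by (simp add: M.M.a_assoc M.smult_closed)
  show ?case
  proof (cases "\<exists>s\<in>carrier R - {\<zero>\<^bsub>R\<^esub>}. \<exists>n\<in>lspan R M S. \<exists>l\<in>L. s \<odot>\<^bsub>M\<^esub> w = n \<oplus>\<^bsub>M\<^esub> l")
    case True
    then obtain s n l where s: "s \<in> carrier R" "s \<noteq> \<zero>\<^bsub>R\<^esub>" and n: "n \<in> lspan R M S" and l: "l \<in> L"
      and eq: "s \<odot>\<^bsub>M\<^esub> w = n \<oplus>\<^bsub>M\<^esub> l" by blast
    obtain q where q: "q \<in> carrier R" "q \<noteq> \<zero>\<^bsub>R\<^esub>" "q \<odot>\<^bsub>M\<^esub> l \<in> U" using tors[OF l] by blast
    have "(q \<otimes>\<^bsub>R\<^esub> r \<otimes>\<^bsub>R\<^esub> s) \<odot>\<^bsub>M\<^esub> x \<in> U" if x: "x \<in> lspan R M (insert w S)" "x \<in> L" for x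
    proof -
      obtain y a where y: "y \<in> lspan R M S" "a \<in> carrier R" "x = y \<oplus>\<^bsub>M\<^esub> a \<odot>\<^bsub>M\<^esub> w"
        using x(1) lspan_insert[OF M w S] by auto
      have c: "y \<in> carrier M" "n \<in> carrier M" "l \<in> carrier M" "x \<in> carrier M"
        using y(1) n l x(2) N'(1) L'(1) by auto
      define z where "z = s \<odot>\<^bsub>M\<^esub> y \<oplus>\<^bsub>M\<^esub> a \<odot>\<^bsub>M\<^esub> n"
      have z: "z \<in> lspan R M S" "z \<in> carrier M" using N' y n s by (auto simp: z_def)
      have "s \<odot>\<^bsub>M\<^esub> (a \<odot>\<^bsub>M\<^esub> w) = a \<odot>\<^bsub>M\<^esub> (s \<odot>\<^bsub>M\<^esub> w)"
        using s y w by (simp add: M.smult_assoc1[symmetric] m_comm)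
      then have sx: "s \<odot>\<^bsub>M\<^esub> x = z \<oplus>\<^bsub>M\<^esub> a \<odot>\<^bsub>M\<^esub> l"
        using s y w c eq by (simp add: z_def M.smult_r_distr M.smult_closed M.M.a_assoc)
      then have "z = s \<odot>\<^bsub>M\<^esub> x \<oplus>\<^bsub>M\<^esub> (\<ominus>\<^bsub>R\<^esub> \<one>\<^bsub>R\<^esub>) \<odot>\<^bsub>M\<^esub> (a \<odot>\<^bsub>M\<^esub> l)"
        using neg[of z "a \<odot>\<^bsub>M\<^esub> l"] z y c by (simp add: M.smult_closed)
      then have "z \<in> L" using L' s x(2) y l by simp
      then have "r \<odot>\<^bsub>M\<^esub> z \<in> U" by (rule r(3)[OF z(1)])
      have "(q \<otimes>\<^bsub>R\<^esub> r \<otimes>\<^bsub>R\<^esub> s) \<odot>\<^bsub>M\<^esub> x = (q \<otimes>\<^bsub>R\<^esub> r) \<odot>\<^bsub>M\<^esub> (z \<oplus>\<^bsub>M\<^esub> a \<odot>\<^bsub>M\<^esub> l)"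
        using q r s c sx by (simp add: M.smult_assoc1)
      also have "\<dots> = (q \<otimes>\<^bsub>R\<^esub> r) \<odot>\<^bsub>M\<^esub> z \<oplus>\<^bsub>M\<^esub> (q \<otimes>\<^bsub>R\<^esub> r) \<odot>\<^bsub>M\<^esub> (a \<odot>\<^bsub>M\<^esub> l)"
        using q r z c y by (simp add: M.smult_r_distr M.smult_closed)
      also have "(q \<otimes>\<^bsub>R\<^esub> r) \<odot>\<^bsub>M\<^esub> z = q \<odot>\<^bsub>M\<^esub> (r \<odot>\<^bsub>M\<^esub> z)"
        using q r z by (simp add: M.smult_assoc1)
      also have "(q \<otimes>\<^bsub>R\<^esub> r) \<odot>\<^bsub>M\<^esub> (a \<odot>\<^bsub>M\<^esub> l) = (r \<otimes>\<^bsub>R\<^esub> a) \<odot>\<^bsub>M\<^esub> (q \<odot>\<^bsub>M\<^esub> l)"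
        using q r y c by (simp add: M.smult_assoc1[symmetric] m_ac)
      finally show ?thesis
        using U' q r y \<open>r \<odot>\<^bsub>M\<^esub> z \<in> U\<close> by simp
    qed
    then show ?thesis
      using q r s by (intro bexI[of _ "q \<otimes>\<^bsub>R\<^esub> r \<otimes>\<^bsub>R\<^esub> s"]) (auto simp: integral_iff)
  next
    case False
    have "x \<in> lspan R M S" if x: "x \<in> lspan R M (insert w S)" "x \<in> L" for x
    proof -
      obtain y a where y: "y \<in> lspan R M S" "a \<in> carrier R" "x = y \<oplus>\<^bsub>M\<^esub> a \<odot>\<^bsub>M\<^esub> w"
        using x(1) lspan_insert[OF M w S] by auto
      have c: "y \<in> carrier M" using y N' by auto
      define y' where "y' = (\<ominus>\<^bsub>R\<^esub> \<one>\<^bsub>R\<^esub>) \<odot>\<^bsub>M\<^esub> y"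
      have y': "y' \<in> lspan R M S" "y \<oplus>\<^bsub>M\<^esub> y' = \<zero>\<^bsub>M\<^esub>" "y' \<in> carrier M"
        using N' y M.add_smult_minus_one[OF c] by (auto simp: y'_def)
      have "a \<odot>\<^bsub>M\<^esub> w = (y' \<oplus>\<^bsub>M\<^esub> y) \<oplus>\<^bsub>M\<^esub> a \<odot>\<^bsub>M\<^esub> w"
        using y' y w c by (simp add: M.M.a_comm M.smult_closed)
      also have "\<dots> = y' \<oplus>\<^bsub>M\<^esub> x"
        using y' y(2,3) w c by (simp add: M.M.a_assoc M.smult_closed)
      finally have "a = \<zero>\<^bsub>R\<^esub>" using False y'(1) x(2) y(2) by blast
      then show ?thesis using y w c by (simp add: M.smult_zero_left)
    qed
    then show ?thesis using r by (intro bexI[of _ r]) auto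
  qed
qed

lemma bounded_torsion:
  assumes A: "module_finite_algebra R \<Lambda> \<phi>" and "domain R" and M: "left_module \<Lambda> M" "fin_gen_module \<Lambda> M"
    and L: "left_submodule \<Lambda> M L" and U: "left_submodule \<Lambda> M U"
    and tors: "\<And>l. l \<in> L \<Longrightarrow> \<exists>r\<in>carrier R - {\<zero>\<^bsub>R\<^esub>}. \<phi> r \<odot>\<^bsub>M\<^esub> l \<in> U"
  obtains r where "r \<in> carrier R - {\<zero>\<^bsub>R\<^esub>}" "\<And>x. x \<in> L \<Longrightarrow> \<phi> r \<odot>\<^bsub>M\<^esub> x \<in> U"
proof -
  interpret module_finite_algebra R \<Lambda> \<phi> by fact
  have h: "ring_hom_ring R \<Lambda> \<phi>" by unfold_locales
  note MR = left_module_restrict_scalars[OF h M(1)]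
  obtain S where S: "finite S" "S \<subseteq> carrier (restrict_scalars \<phi> M)"
    "lspan R (restrict_scalars \<phi> M) S = carrier (restrict_scalars \<phi> M)"
    using fin_gen_over_base[OF A M] unfolding fin_gen_module_iff[OF MR] by blast
  have "\<exists>r\<in>carrier R - {\<zero>\<^bsub>R\<^esub>}. \<forall>x\<in>lspan R (restrict_scalars \<phi> M) S \<inter> L. r \<odot>\<^bsub>restrict_scalars \<phi> M\<^esub> x \<in> U"
    using tors by (intro bounded_torsion_lspan[OF \<open>domain R\<close> MR left_submodule_restrict_scalars[OF h L]
      left_submodule_restrict_scalars[OF h U] _ S(1,2)]) simp
  then show ?thesis using that left_submoduleD(1)[OF L] unfolding S(3) by auto
qed

text \<open>The submodule \<open>I M\<close>.\<close>

definition ideal_smult :: "('b, 'n) ring_scheme \<Rightarrow> ('a \<Rightarrow> 'b) \<Rightarrow> 'a set \<Rightarrow> ('b, 'c, 'p) module_scheme \<Rightarrow> 'c set"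
  where "ideal_smult \<Lambda> \<phi> I M = lspan \<Lambda> M {\<phi> a \<odot>\<^bsub>M\<^esub> x | a x. a \<in> I \<and> x \<in> carrier M}"

text \<open>Noetherian induction on \<open>I\<close>. A nonzero proper ideal \<open>I\<close> other than \<open>\<mm>\<close> is not prime, so
  there are \<open>a, b \<notin> I\<close> with \<open>a b \<in> I\<close>. The modules \<open>M / (I + R a) M\<close> and \<open>M / (I + R b) M\<close> belong to
  \<open>T\<close> by induction, and multiplication by \<open>a\<close> maps the latter onto \<open>(I + R a) M / I M\<close>.\<close>

lemma subquot_in_ideal_smult:
  assumes A: "module_finite_algebra R \<Lambda> \<phi>" and "noetherian_domain R"
    and primes: "\<And>P. \<lbrakk>primeideal P R; P \<noteq> {\<zero>\<^bsub>R\<^esub>}\<rbrakk> \<Longrightarrow> P = \<mm>"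
    and T: "torsion_class \<Lambda> T" and M: "left_module \<Lambda> M"
    and base: "subquot_in \<Lambda> T M (carrier M) (ideal_smult \<Lambda> \<phi> \<mm> M)"
    and I: "ideal I R" "I \<noteq> {\<zero>\<^bsub>R\<^esub>}"
  shows "subquot_in \<Lambda> T M (carrier M) (ideal_smult \<Lambda> \<phi> I M)"
proof (rule ccontr)
  assume bad: "\<not> ?thesis"
  interpret noetherian_domain R by fact
  interpret A: module_finite_algebra R \<Lambda> \<phi> by fact
  interpret M: left_module \<Lambda> M by fact
  note CM = left_submodule_carrier[OF M]
  define \<I> where "\<I> = {I. ideal I R \<and> I \<noteq> {\<zero>\<^bsub>R\<^esub>} \<and> \<not> subquot_in \<Lambda> T M (carrier M) (ideal_smult \<Lambda> \<phi> I M)}"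
  have "\<I> \<noteq> {}" using I bad by (auto simp: \<I>_def)
  then obtain I where "I \<in> \<I>" and max: "\<And>J. \<lbrakk>J \<in> \<I>; I \<subseteq> J\<rbrakk> \<Longrightarrow> J = I"
    by (rule maximal_element_ideals) (auto simp: \<I>_def)
  then have I: "ideal I R" "I \<noteq> {\<zero>\<^bsub>R\<^esub>}" "\<not> subquot_in \<Lambda> T M (carrier M) (ideal_smult \<Lambda> \<phi> I M)"
    by (auto simp: \<I>_def)
  interpret I: ideal I R by (rule I(1))
  have sub: "left_submodule \<Lambda> M (ideal_smult \<Lambda> \<phi> J M)" if "J \<subseteq> carrier R" for J
    unfolding ideal_smult_def using that by (intro left_submodule_lspan[OF M]) (auto intro!: M.smult_closed)
  have gen: "\<phi> a \<odot>\<^bsub>M\<^esub> x \<in> ideal_smult \<Lambda> \<phi> J M" if "a \<in> J" "x \<in> carrier M" for a x J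
    unfolding ideal_smult_def using that by (intro subsetD[OF lspan_superset]) blast
  have minimal: "ideal_smult \<Lambda> \<phi> J M \<subseteq> H"
    if "left_submodule \<Lambda> M H" "\<And>a x. \<lbrakk>a \<in> J; x \<in> carrier M\<rbrakk> \<Longrightarrow> \<phi> a \<odot>\<^bsub>M\<^esub> x \<in> H" for J H
    unfolding ideal_smult_def using that by (intro lspan_minimal) auto
  have "carrier R \<noteq> I"
  proof
    assume eq: "carrier R = I"
    have "x \<in> ideal_smult \<Lambda> \<phi> I M" if "x \<in> carrier M" for x
      using gen[of "\<one>\<^bsub>R\<^esub>" I x] that eq by (auto simp: M.smult_one)
    then have "ideal_smult \<Lambda> \<phi> I M = carrier M" using left_submoduleD(1)[OF sub[of I]] eq by auto
    then show False using I(3) subquot_in_refl[OF T M CM] by simp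
  qed
  moreover have "\<not> primeideal I R" using primes[of I] I base by blast
  ultimately obtain a b where ab: "a \<in> carrier R" "b \<in> carrier R" "a \<notin> I" "b \<notin> I" "a \<otimes>\<^bsub>R\<^esub> b \<in> I"
    using primeidealI[OF I(1) is_cring] by blast
  have adjoin: "ideal (I <+>\<^bsub>R\<^esub> PIdl\<^bsub>R\<^esub> c) R" "subquot_in \<Lambda> T M (carrier M) (ideal_smult \<Lambda> \<phi> (I <+>\<^bsub>R\<^esub> PIdl\<^bsub>R\<^esub> c) M)"
    "I \<subseteq> I <+>\<^bsub>R\<^esub> PIdl\<^bsub>R\<^esub> c" "I <+>\<^bsub>R\<^esub> PIdl\<^bsub>R\<^esub> c = {i \<oplus>\<^bsub>R\<^esub> r \<otimes>\<^bsub>R\<^esub> c | i r. i \<in> I \<and> r \<in> carrier R}"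
    if c: "c \<in> carrier R" "c \<notin> I" for c
  proof -
    show J: "ideal (I <+>\<^bsub>R\<^esub> PIdl\<^bsub>R\<^esub> c) R" by (rule add_ideals[OF I(1) cgenideal_ideal[OF c(1)]])
    show eq: "I <+>\<^bsub>R\<^esub> PIdl\<^bsub>R\<^esub> c = {i \<oplus>\<^bsub>R\<^esub> r \<otimes>\<^bsub>R\<^esub> c | i r. i \<in> I \<and> r \<in> carrier R}"
      by (auto simp: set_add_def' cgenideal_def)
    have "i \<in> I <+>\<^bsub>R\<^esub> PIdl\<^bsub>R\<^esub> c" if "i \<in> I" for i
    proof -
      have "i = i \<oplus>\<^bsub>R\<^esub> \<zero>\<^bsub>R\<^esub> \<otimes>\<^bsub>R\<^esub> c" using that c(1) I.Icarr by simp
      then show ?thesis using that unfolding eq by blast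
    qed
    then show IJ: "I \<subseteq> I <+>\<^bsub>R\<^esub> PIdl\<^bsub>R\<^esub> c" by blast
    have "c = \<zero>\<^bsub>R\<^esub> \<oplus>\<^bsub>R\<^esub> \<one>\<^bsub>R\<^esub> \<otimes>\<^bsub>R\<^esub> c" using c by simp
    then have "c \<in> I <+>\<^bsub>R\<^esub> PIdl\<^bsub>R\<^esub> c" unfolding eq using I.zero_closed by blast
    then have "I <+>\<^bsub>R\<^esub> PIdl\<^bsub>R\<^esub> c \<notin> \<I>" using max[OF _ IJ] c(2) by blast
    moreover have "I <+>\<^bsub>R\<^esub> PIdl\<^bsub>R\<^esub> c \<noteq> {\<zero>\<^bsub>R\<^esub>}"
      using IJ I(2) I.zero_closed by blast
    ultimately show "subquot_in \<Lambda> T M (carrier M) (ideal_smult \<Lambda> \<phi> (I <+>\<^bsub>R\<^esub> PIdl\<^bsub>R\<^esub> c) M)"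
      using J by (simp add: \<I>_def)
  qed
  let ?Ia = "I <+>\<^bsub>R\<^esub> PIdl\<^bsub>R\<^esub> a" and ?Ib = "I <+>\<^bsub>R\<^esub> PIdl\<^bsub>R\<^esub> b"
  have car: "?Ia \<subseteq> carrier R" "?Ib \<subseteq> carrier R" "I \<subseteq> carrier R"
    using adjoin(1) ab I by (auto dest: ideal.Icarr)
  note hom = module_hom_central_smult[OF A M ab(1)]
  have aa: "a \<in> ?Ia" 
  proof -
    have "a = \<zero>\<^bsub>R\<^esub> \<oplus>\<^bsub>R\<^esub> \<one>\<^bsub>R\<^esub> \<otimes>\<^bsub>R\<^esub> a" using ab by simp
    then show ?thesis unfolding adjoin(4)[OF ab(1,3)] using I.zero_closed by blast
  qed
  have sum: "\<phi> (i \<oplus>\<^bsub>R\<^esub> r \<otimes>\<^bsub>R\<^esub> c) \<odot>\<^bsub>M\<^esub> x = \<phi> i \<odot>\<^bsub>M\<^esub> x \<oplus>\<^bsub>M\<^esub> \<phi> c \<odot>\<^bsub>M\<^esub> (\<phi> r \<odot>\<^bsub>M\<^esub> x)"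
    if "i \<in> carrier R" "r \<in> carrier R" "c \<in> carrier R" "x \<in> carrier M" for i r c x
  proof -
    have "\<phi> r \<otimes>\<^bsub>\<Lambda>\<^esub> \<phi> c = \<phi> c \<otimes>\<^bsub>\<Lambda>\<^esub> \<phi> r" using that by (intro A.central) auto
    then show ?thesis using that by (simp add: M.smult_l_distr M.smult_assoc1[symmetric])
  qed
  have "subquot_in \<Lambda> T M (ideal_smult \<Lambda> \<phi> ?Ia M) (ideal_smult \<Lambda> \<phi> I M)"
  proof (rule subquot_in_image[OF T M M adjoin(2)[OF ab(2,4)] _ sub[OF car(1)] sub[OF car(3)]])
    show "(\<lambda>x. \<phi> a \<odot>\<^bsub>M\<^esub> x) \<in> module_hom \<Lambda> (M\<lparr>carrier := carrier M\<rparr>) M" using hom by simp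
    show "(\<lambda>x. \<phi> a \<odot>\<^bsub>M\<^esub> x) ` carrier M \<subseteq> ideal_smult \<Lambda> \<phi> ?Ia M"
      using gen[OF aa] by auto
    show "ideal_smult \<Lambda> \<phi> I M \<subseteq> ideal_smult \<Lambda> \<phi> ?Ia M"
      using gen[of _ ?Ia] adjoin(3)[OF ab(1,3)] by (intro minimal[OF sub[OF car(1)]]) blast
    have "ideal_smult \<Lambda> \<phi> ?Ib M \<subseteq> {x \<in> carrier M. \<phi> a \<odot>\<^bsub>M\<^esub> x \<in> ideal_smult \<Lambda> \<phi> I M}"
    proof (rule minimal)
      show "left_submodule \<Lambda> M {x \<in> carrier M. \<phi> a \<odot>\<^bsub>M\<^esub> x \<in> ideal_smult \<Lambda> \<phi> I M}"
        by (rule left_submodule_vimage[OF M M hom sub[OF car(3)]])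
      fix c x assume c: "c \<in> ?Ib" and x: "x \<in> carrier M"
      obtain i r where "i \<in> I" "r \<in> carrier R" "c = i \<oplus>\<^bsub>R\<^esub> r \<otimes>\<^bsub>R\<^esub> b"
        using c unfolding adjoin(4)[OF ab(2,4)] by blast
      moreover from this have "a \<otimes>\<^bsub>R\<^esub> c = a \<otimes>\<^bsub>R\<^esub> i \<oplus>\<^bsub>R\<^esub> r \<otimes>\<^bsub>R\<^esub> (a \<otimes>\<^bsub>R\<^esub> b)"
        using ab I.Icarr by (simp add: r_distr m_lcomm)
      moreover have "a \<otimes>\<^bsub>R\<^esub> i \<in> I" "r \<otimes>\<^bsub>R\<^esub> (a \<otimes>\<^bsub>R\<^esub> b) \<in> I" if "i \<in> I" "r \<in> carrier R" for i r
        using that ab I.I_l_closed by blast+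
      ultimately have "a \<otimes>\<^bsub>R\<^esub> c \<in> I" using I.a_closed by simp
      then have "\<phi> (a \<otimes>\<^bsub>R\<^esub> c) \<odot>\<^bsub>M\<^esub> x \<in> ideal_smult \<Lambda> \<phi> I M" using gen x by blast
      moreover have "c \<in> carrier R" using c car by blast
      ultimately show "\<phi> c \<odot>\<^bsub>M\<^esub> x \<in> {x \<in> carrier M. \<phi> a \<odot>\<^bsub>M\<^esub> x \<in> ideal_smult \<Lambda> \<phi> I M}"
        using ab x by (simp add: M.smult_closed M.smult_assoc1)
    qed
    then show "(\<lambda>x. \<phi> a \<odot>\<^bsub>M\<^esub> x) ` ideal_smult \<Lambda> \<phi> ?Ib M \<subseteq> ideal_smult \<Lambda> \<phi> I M" by blast
    have "left_submodule \<Lambda> M {x \<oplus>\<^bsub>M\<^esub> y | x y. x \<in> (\<lambda>x. \<phi> a \<odot>\<^bsub>M\<^esub> x) ` carrier M \<and> y \<in> ideal_smult \<Lambda> \<phi> I M}"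
      by (rule left_submodule_add[OF M left_submodule_image[OF M M hom CM] sub[OF car(3)]])
    then have "ideal_smult \<Lambda> \<phi> ?Ia M \<subseteq> {x \<oplus>\<^bsub>M\<^esub> y | x y. x \<in> (\<lambda>x. \<phi> a \<odot>\<^bsub>M\<^esub> x) ` carrier M \<and> y \<in> ideal_smult \<Lambda> \<phi> I M}"
    proof (rule minimal)
      fix c x assume c: "c \<in> ?Ia" and x: "x \<in> carrier M"
      obtain i r where ir: "i \<in> I" "r \<in> carrier R" "c = i \<oplus>\<^bsub>R\<^esub> r \<otimes>\<^bsub>R\<^esub> a"
        using c unfolding adjoin(4)[OF ab(1,3)] by blast
      have i: "i \<in> carrier R" using ir I.Icarr by blast
      have "\<phi> c \<odot>\<^bsub>M\<^esub> x = \<phi> a \<odot>\<^bsub>M\<^esub> (\<phi> r \<odot>\<^bsub>M\<^esub> x) \<oplus>\<^bsub>M\<^esub> \<phi> i \<odot>\<^bsub>M\<^esub> x"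
        unfolding ir(3) sum[OF i ir(2) ab(1) x] using i ir(2) ab(1) x by (intro M.M.a_comm M.smult_closed) auto
      then show "\<phi> c \<odot>\<^bsub>M\<^esub> x \<in> {x \<oplus>\<^bsub>M\<^esub> y | x y. x \<in> (\<lambda>x. \<phi> a \<odot>\<^bsub>M\<^esub> x) ` carrier M \<and> y \<in> ideal_smult \<Lambda> \<phi> I M}"
        using gen[OF ir(1) x] ir(2) x by (intro CollectI exI conjI) (auto simp: M.smult_closed)
    qed
    then show "\<exists>x\<in>carrier M. \<exists>b\<in>ideal_smult \<Lambda> \<phi> I M. y = \<phi> a \<odot>\<^bsub>M\<^esub> x \<oplus>\<^bsub>M\<^esub> b"
      if "y \<in> ideal_smult \<Lambda> \<phi> ?Ia M" for y using that by blast
  qed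
  then show False
    using I(3) subquot_in_trans[OF T M adjoin(2)[OF ab(1,3)]] by blast
qed

section \<open>Factor rings\<close>

lemma left_submodule_surj:
  assumes "ring_hom_ring \<Lambda> \<Gamma> \<psi>" "\<psi> ` carrier \<Lambda> = carrier \<Gamma>"
    "left_submodule \<Lambda> (restrict_scalars \<psi> M) H"
  shows "left_submodule \<Gamma> M H"
proof (rule left_submoduleI)
  note D = left_submoduleD[OF assms(3), simplified]
  fix c x assume "c \<in> carrier \<Gamma>" "x \<in> H"
  then obtain a where "a \<in> carrier \<Lambda>" "c = \<psi> a" unfolding assms(2)[symmetric] by blast
  then show "c \<odot>\<^bsub>M\<^esub> x \<in> H" using D(4) \<open>x \<in> H\<close> by simp
qed (use left_submoduleD[OF assms(3), simplified] in auto)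

lemma module_hom_surj:
  assumes "ring_hom_ring \<Lambda> \<Gamma> \<psi>" "\<psi> ` carrier \<Lambda> = carrier \<Gamma>"
    "f \<in> module_hom \<Lambda> (restrict_scalars \<psi> M) (restrict_scalars \<psi> N)"
  shows "f \<in> module_hom \<Gamma> M N"
proof (rule module_homI)
  note D = module_homD[OF assms(3), simplified]
  fix c x assume "c \<in> carrier \<Gamma>" "x \<in> carrier M"
  then obtain a where "a \<in> carrier \<Lambda>" "c = \<psi> a" unfolding assms(2)[symmetric] by blast
  then show "f (c \<odot>\<^bsub>M\<^esub> x) = c \<odot>\<^bsub>N\<^esub> f x" using D(3) \<open>x \<in> carrier M\<close> by simp
qed (use module_homD[OF assms(3), simplified] in auto)

lemma lattice_in_surj:
  assumes "ring_hom_ring \<Lambda> \<Gamma> \<psi>" "\<psi> ` carrier \<Lambda> = carrier \<Gamma>" "left_module \<Gamma> M"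
  shows "lattice_in \<Lambda> \<Gamma> \<psi> M W \<longleftrightarrow> W = carrier M"
proof
  assume "lattice_in \<Lambda> \<Gamma> \<psi> M W"
  then have W: "left_submodule \<Lambda> (restrict_scalars \<psi> M) W" "lspan \<Gamma> M W = carrier M"
    by (auto simp: lattice_in_def)
  have "lspan \<Gamma> M W \<subseteq> W" using left_submodule_surj[OF assms(1,2) W(1)] by (rule lspan_minimal) simp
  then show "W = carrier M" using W left_submoduleD(1)[OF W(1)] by auto
next
  assume W: "W = carrier M"
  have "lspan \<Gamma> M (carrier M) = carrier M"
    using lspan_minimal[OF left_submodule_carrier[OF assms(3)] order_refl] lspan_superset[of "carrier M" \<Gamma> M]
    by blast
  then show "lattice_in \<Lambda> \<Gamma> \<psi> M W"
    using left_submodule_carrier[OF left_module_restrict_scalars[OF assms(1,3)]]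
    unfolding W lattice_in_def by simp
qed

lemma finite_tors_surj:
  assumes h: "ring_hom_ring \<Lambda> \<Gamma> \<psi>" and surj: "\<psi> ` carrier \<Lambda> = carrier \<Gamma>" and fin: "finite (tors \<Lambda>)"
  shows "finite (tors \<Gamma>)"
proof (rule finite_tors_of_scalar_extension[OF h _ fin])
  fix M assume "M \<in> fg_modules \<Gamma>"
  then have M: "left_module \<Gamma> M" "fin_gen_module \<Gamma> M" by (auto simp: fg_modules_def)
  note M' = left_module_restrict_scalars[OF h M(1)]
  obtain S where S: "finite S" "S \<subseteq> carrier M" "lspan \<Gamma> M S = carrier M"
    using M(2) unfolding fin_gen_module_iff[OF M(1)] by blast
  have "lspan \<Gamma> M S \<subseteq> lspan \<Lambda> (restrict_scalars \<psi> M) S"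
    using S(2) by (intro lspan_minimal left_submodule_surj[OF h surj] left_submodule_lspan[OF M'] lspan_superset) simp
  then have fg: "fin_gen_module \<Lambda> (restrict_scalars \<psi> M)"
    unfolding fin_gen_module_iff[OF M'] using S lspan_minimal[OF left_submodule_carrier[OF M'], of S]
    by (intro exI[of _ S]) auto
  have "\<exists>f\<in>module_hom \<Gamma> M N. f ` carrier M = carrier N"
    if N: "N \<in> fg_modules \<Gamma>" and u: "u \<in> module_hom \<Lambda> (restrict_scalars \<psi> M) (restrict_scalars \<psi> N)"
      "lspan \<Gamma> N (u ` carrier M) = carrier N" for N u
  proof -
    have N': "left_module \<Gamma> N" using N by (simp add: fg_modules_def)
    have "left_submodule \<Lambda> (restrict_scalars \<psi> N) (u ` carrier M)"
      using left_submodule_image[OF M' left_module_restrict_scalars[OF h N'] u(1) left_submodule_carrier[OF M']]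
      by simp
    then have "u ` carrier M = carrier N"
      using lattice_in_surj[OF h surj N', of "u ` carrier M"] u(2) by (simp add: lattice_in_def)
    then show ?thesis using module_hom_surj[OF h surj u(1)] by blast
  qed
  note quotient = this
  have "(restrict_scalars \<psi> M)\<lparr>carrier := carrier M\<rparr> = restrict_scalars \<psi> M"
    by (simp add: restrict_scalars_def)
  note whole = this
  show "\<exists>W. lattice_in \<Lambda> \<Gamma> \<psi> M W \<and>
      fin_gen_module \<Lambda> ((restrict_scalars \<psi> M)\<lparr>carrier := W\<rparr>) \<and>
      (\<forall>N\<in>fg_modules \<Gamma>. \<forall>u\<in>module_hom \<Lambda> ((restrict_scalars \<psi> M)\<lparr>carrier := W\<rparr>) (restrict_scalars \<psi> N).
        lspan \<Gamma> N (u ` W) = carrier N \<longrightarrow> (\<exists>f\<in>module_hom \<Gamma> M N. f ` carrier M = carrier N))"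
  proof (rule exI[of _ "carrier M"], unfold whole, intro conjI ballI impI)
    show "lattice_in \<Lambda> \<Gamma> \<psi> M (carrier M)" using lattice_in_surj[OF h surj M(1)] by blast
  qed (fact fg quotient)+
qed

lemma torsion_class_extended_surj:
  assumes h: "ring_hom_ring \<Lambda> \<Gamma> \<psi>" and surj: "\<psi> ` carrier \<Lambda> = carrier \<Gamma>" and T: "torsion_class \<Lambda> T"
  shows "torsion_class \<Gamma> (extended_class \<Lambda> \<Gamma> \<psi> T)"
proof (rule torsion_class_extended[OF h T])
  fix L M N f g
  assume L: "L \<in> extended_class \<Lambda> \<Gamma> \<psi> T" and N: "N \<in> extended_class \<Lambda> \<Gamma> \<psi> T"
    and M: "M \<in> fg_modules \<Gamma>" and ex: "short_exact \<Gamma> L M N f g"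
  have mods: "left_module \<Gamma> L" "left_module \<Gamma> M" "left_module \<Gamma> N"
    using L N M by (auto simp: fg_modules_def extended_class_def)
  note rmods = mods[THEN left_module_restrict_scalars[OF h]]
  have f: "f \<in> module_hom \<Gamma> L M" and g: "g \<in> module_hom \<Gamma> M N" "g ` carrier M = carrier N"
    and im: "f ` carrier L = {x \<in> carrier M. g x = \<zero>\<^bsub>N\<^esub>}"
    using ex by (auto simp: short_exact_def)
  have whole: "subquot_in \<Lambda> T (restrict_scalars \<psi> P) (carrier P) {\<zero>\<^bsub>P\<^esub>}"
    if "P \<in> extended_class \<Lambda> \<Gamma> \<psi> T" "left_module \<Gamma> P" for P
    using that lattice_in_surj[OF h surj that(2)] by (auto elim!: extended_classD)
  note fr = module_hom_restrict_scalars[OF h f] and gr = module_hom_restrict_scalars[OF h g(1)]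
  have CM: "left_submodule \<Lambda> (restrict_scalars \<psi> M) (carrier M)"
    using left_submodule_carrier[OF rmods(2)] by simp
  have s1: "subquot_in \<Lambda> T (restrict_scalars \<psi> M) (f ` carrier L) {\<zero>\<^bsub>M\<^esub>}"
    using subquot_in_image_zero[OF T rmods(1,2) whole[OF L mods(1)] fr] module_hom_zero[OF mods(1,2) f] by simp
  have "subquot_in \<Lambda> T (restrict_scalars \<psi> M) (carrier M) (f ` carrier L)"
    by (rule subquot_in_vimage[OF whole[OF N mods(3)] CM module_hom_restrict[OF gr CM] g(2)]) (simp add: im)
  from subquot_in_trans[OF T rmods(2) this s1]
  show "M \<in> extended_class \<Lambda> \<Gamma> \<psi> T"
    by (intro extended_classI[OF M, of _ _ "carrier M"]) (simp_all add: lattice_in_surj[OF h surj mods(2)])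
qed

text \<open>A module that is annihilated by the kernel of a surjection \<open>\<Lambda> \<rightarrow> \<Gamma>\<close> is a \<open>\<Gamma>\<close>-module.\<close>

lemma descend_scalars:
  fixes M :: "('a, 'b, 'n) module_scheme" and \<Gamma> :: "('c, 'p) ring_scheme"
  assumes h: "ring_hom_ring \<Lambda> \<Gamma> \<psi>" and surj: "\<psi> ` carrier \<Lambda> = carrier \<Gamma>" and M: "left_module \<Lambda> M"
    and ann: "\<And>a x. \<lbrakk>a \<in> carrier \<Lambda>; \<psi> a = \<zero>\<^bsub>\<Gamma>\<^esub>; x \<in> carrier M\<rbrakk> \<Longrightarrow> a \<odot>\<^bsub>M\<^esub> x = \<zero>\<^bsub>M\<^esub>"
  obtains N :: "('c, 'b) module" where "left_module \<Gamma> N" "carrier N = carrier M" "\<zero>\<^bsub>N\<^esub> = \<zero>\<^bsub>M\<^esub>"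
    "(\<lambda>x. x) \<in> module_hom \<Lambda> M (restrict_scalars \<psi> N)"
proof -
  interpret h: ring_hom_ring \<Lambda> \<Gamma> \<psi> by fact
  interpret M: left_module \<Lambda> M by fact
  define r where "r c = (SOME a. a \<in> carrier \<Lambda> \<and> \<psi> a = c)" for c
  have r: "r (\<psi> a) \<in> carrier \<Lambda>" "\<psi> (r (\<psi> a)) = \<psi> a" if "a \<in> carrier \<Lambda>" for a
    using someI[of "\<lambda>b. b \<in> carrier \<Lambda> \<and> \<psi> b = \<psi> a" a] that by (auto simp: r_def)
  have act: "r (\<psi> a) \<odot>\<^bsub>M\<^esub> x = a \<odot>\<^bsub>M\<^esub> x" if "a \<in> carrier \<Lambda>" "x \<in> carrier M" for a x
  proof -
    define d where "d = r (\<psi> a) \<ominus>\<^bsub>\<Lambda>\<^esub> a"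
    have d: "d \<in> carrier \<Lambda>" "\<psi> d = \<zero>\<^bsub>\<Gamma>\<^esub>" "r (\<psi> a) = d \<oplus>\<^bsub>\<Lambda>\<^esub> a"
      using r that by (auto simp: d_def a_minus_def h.S.r_neg h.R.a_assoc h.R.l_neg)
    show ?thesis
      unfolding d(3) using d(1) that ann[OF d(1,2) that(2)] by (simp add: M.smult_l_distr M.smult_closed)
  qed
  define N :: "('c, 'b) module" where
    "N = \<lparr>carrier = carrier M, monoid.mult = undefined, one = undefined, ring.zero = \<zero>\<^bsub>M\<^esub>,
      add = add M, smult = (\<lambda>c x. r c \<odot>\<^bsub>M\<^esub> x)\<rparr>"
  have simps: "carrier N = carrier M" "\<zero>\<^bsub>N\<^esub> = \<zero>\<^bsub>M\<^esub>" "\<And>x y. x \<oplus>\<^bsub>N\<^esub> y = x \<oplus>\<^bsub>M\<^esub> y"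
    "\<And>a x. \<lbrakk>a \<in> carrier \<Lambda>; x \<in> carrier M\<rbrakk> \<Longrightarrow> \<psi> a \<odot>\<^bsub>N\<^esub> x = a \<odot>\<^bsub>M\<^esub> x"
    by (simp_all add: N_def act)
  have "abelian_group N"
    by (rule abelian_groupI) (auto simp: simps M.M.a_ac intro: M.M.l_neg M.M.a_inv_closed)
  then have "left_module \<Gamma> N"
  proof (intro left_module.intro left_module_axioms.intro h.S.ring_axioms)
    fix c d x y assume cd: "c \<in> carrier \<Gamma>" "d \<in> carrier \<Gamma>" and x: "x \<in> carrier N" and y: "y \<in> carrier N"
    then obtain a b where ab: "a \<in> carrier \<Lambda>" "b \<in> carrier \<Lambda>" "c = \<psi> a" "d = \<psi> b"
      unfolding surj[symmetric] by blast
    have x': "x \<in> carrier M" "y \<in> carrier M" using x y by (auto simp: simps)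
    show "c \<odot>\<^bsub>N\<^esub> x \<in> carrier N" "c \<odot>\<^bsub>N\<^esub> (x \<oplus>\<^bsub>N\<^esub> y) = c \<odot>\<^bsub>N\<^esub> x \<oplus>\<^bsub>N\<^esub> c \<odot>\<^bsub>N\<^esub> y"
      using ab x' by (auto simp: simps M.smult_closed M.smult_r_distr)
    have eqs: "c \<oplus>\<^bsub>\<Gamma>\<^esub> d = \<psi> (a \<oplus>\<^bsub>\<Lambda>\<^esub> b)" "c \<otimes>\<^bsub>\<Gamma>\<^esub> d = \<psi> (a \<otimes>\<^bsub>\<Lambda>\<^esub> b)" using ab by auto
    have "(c \<oplus>\<^bsub>\<Gamma>\<^esub> d) \<odot>\<^bsub>N\<^esub> x = (a \<oplus>\<^bsub>\<Lambda>\<^esub> b) \<odot>\<^bsub>M\<^esub> x" "(c \<otimes>\<^bsub>\<Gamma>\<^esub> d) \<odot>\<^bsub>N\<^esub> x = (a \<otimes>\<^bsub>\<Lambda>\<^esub> b) \<odot>\<^bsub>M\<^esub> x"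
      unfolding eqs by (rule simps(4); use ab x' in simp)+
    moreover have "c \<odot>\<^bsub>N\<^esub> z = a \<odot>\<^bsub>M\<^esub> z" "d \<odot>\<^bsub>N\<^esub> z = b \<odot>\<^bsub>M\<^esub> z" if "z \<in> carrier M" for z
      using ab that simps(4) by auto
    ultimately show "(c \<oplus>\<^bsub>\<Gamma>\<^esub> d) \<odot>\<^bsub>N\<^esub> x = c \<odot>\<^bsub>N\<^esub> x \<oplus>\<^bsub>N\<^esub> d \<odot>\<^bsub>N\<^esub> x"
      "(c \<otimes>\<^bsub>\<Gamma>\<^esub> d) \<odot>\<^bsub>N\<^esub> x = c \<odot>\<^bsub>N\<^esub> (d \<odot>\<^bsub>N\<^esub> x)"
      using ab(1,2) x' by (simp_all add: simps(3,4) M.smult_closed M.smult_l_distr M.smult_assoc1)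
  next
    fix x assume "x \<in> carrier N"
    then show "\<one>\<^bsub>\<Gamma>\<^esub> \<odot>\<^bsub>N\<^esub> x = x" using simps(4)[of "\<one>\<^bsub>\<Lambda>\<^esub>" x] by (simp add: simps M.smult_one)
  qed
  moreover have "(\<lambda>x. x) \<in> module_hom \<Lambda> M (restrict_scalars \<psi> N)"
    by (intro module_homI) (auto simp: simps)
  ultimately show ?thesis using that simps by blast
qed

section \<open>Inverting the nonzero elements of the base ring\<close>

text \<open>A ring \<open>\<Gamma>\<close> over \<open>\<Lambda>\<close> in which the nonzero elements of \<open>R\<close> become invertible and every element
  is a fraction with denominator in \<open>R\<close>. The kernel of \<open>\<psi>\<close> is left open.\<close>

locale base_localization = alg: module_finite_algebra R \<Lambda> \<phi> + base: domain R + ext: ring_hom_ring \<Lambda> \<Gamma> \<psi>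
  for R (structure) and \<Lambda> (structure) and \<phi> and \<Gamma> (structure) and \<psi> +
  assumes invertible: "r \<in> carrier R - {\<zero>} \<Longrightarrow>
      \<exists>c\<in>carrier \<Gamma>. c \<otimes>\<^bsub>\<Gamma>\<^esub> \<psi> (\<phi> r) = \<one>\<^bsub>\<Gamma>\<^esub> \<and> \<psi> (\<phi> r) \<otimes>\<^bsub>\<Gamma>\<^esub> c = \<one>\<^bsub>\<Gamma>\<^esub>"
    and denominators: "c \<in> carrier \<Gamma> \<Longrightarrow>
      \<exists>r\<in>carrier R - {\<zero>}. \<exists>a\<in>carrier \<Lambda>. \<psi> (\<phi> r) \<otimes>\<^bsub>\<Gamma>\<^esub> c = \<psi> a"
begin

lemma hom: "ring_hom_ring \<Lambda> \<Gamma> \<psi>" by (rule ext.ring_hom_ring_axioms)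

lemma algebra: "module_finite_algebra R \<Lambda> \<phi>" by (rule alg.module_finite_algebra_axioms)

lemma nonzero_mult: "\<lbrakk>r \<in> carrier R - {\<zero>}; s \<in> carrier R - {\<zero>}\<rbrakk> \<Longrightarrow> r \<otimes> s \<in> carrier R - {\<zero>}"
  by (auto simp: base.integral_iff)

lemma scale_mult:
  assumes "left_module \<Gamma> M" "r \<in> carrier R" "s \<in> carrier R" "x \<in> carrier M"
  shows "\<psi> (\<phi> (r \<otimes> s)) \<odot>\<^bsub>M\<^esub> x = \<psi> (\<phi> r) \<odot>\<^bsub>M\<^esub> (\<psi> (\<phi> s) \<odot>\<^bsub>M\<^esub> x)"
proof -
  interpret M: left_module \<Gamma> M by fact
  show ?thesis using assms by (simp add: M.smult_assoc1)
qed

lemma scale_commute: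
  assumes "left_module \<Gamma> M" "r \<in> carrier R" "a \<in> carrier \<Lambda>" "x \<in> carrier M"
  shows "\<psi> (\<phi> r) \<odot>\<^bsub>M\<^esub> (\<psi> a \<odot>\<^bsub>M\<^esub> x) = \<psi> a \<odot>\<^bsub>M\<^esub> (\<psi> (\<phi> r) \<odot>\<^bsub>M\<^esub> x)"
proof -
  interpret M: left_module \<Gamma> M by fact
  have "\<psi> (\<phi> r) \<otimes>\<^bsub>\<Gamma>\<^esub> \<psi> a = \<psi> a \<otimes>\<^bsub>\<Gamma>\<^esub> \<psi> (\<phi> r)"
    using alg.central[OF assms(2,3)] assms by (metis alg.hom_closed ext.hom_mult)
  then show ?thesis using assms by (simp add: M.smult_assoc1[symmetric])
qed

lemma scale_fraction:
  assumes "left_module \<Gamma> M" "r \<in> carrier R" "s \<in> carrier R" "c \<in> carrier \<Gamma>" "a \<in> carrier \<Lambda>"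
    "\<psi> (\<phi> s) \<otimes>\<^bsub>\<Gamma>\<^esub> c = \<psi> a" "x \<in> carrier M"
  shows "\<psi> (\<phi> (r \<otimes> s)) \<odot>\<^bsub>M\<^esub> (c \<odot>\<^bsub>M\<^esub> x) = \<psi> a \<odot>\<^bsub>M\<^esub> (\<psi> (\<phi> r) \<odot>\<^bsub>M\<^esub> x)"
proof -
  interpret M: left_module \<Gamma> M by fact
  have "\<psi> (\<phi> (r \<otimes> s)) \<odot>\<^bsub>M\<^esub> (c \<odot>\<^bsub>M\<^esub> x) = \<psi> (\<phi> r) \<odot>\<^bsub>M\<^esub> (\<psi> (\<phi> s) \<odot>\<^bsub>M\<^esub> (c \<odot>\<^bsub>M\<^esub> x))"
    using assms by (intro scale_mult[OF assms(1)]) (auto simp: M.smult_closed)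
  also have "\<psi> (\<phi> s) \<odot>\<^bsub>M\<^esub> (c \<odot>\<^bsub>M\<^esub> x) = \<psi> a \<odot>\<^bsub>M\<^esub> x"
    using assms by (simp add: M.smult_assoc1[symmetric])
  finally show ?thesis using scale_commute[OF assms(1,2,5,7)] by simp
qed

lemma scale_hom:
  assumes "left_module \<Gamma> M" "r \<in> carrier R"
  shows "(\<lambda>x. \<psi> (\<phi> r) \<odot>\<^bsub>M\<^esub> x) \<in> module_hom \<Lambda> (restrict_scalars \<psi> M) (restrict_scalars \<psi> M)"
  using module_hom_central_smult[OF algebra left_module_restrict_scalars[OF hom assms(1)] assms(2)] by simp

lemma scale_inj:
  assumes "left_module \<Gamma> M" "r \<in> carrier R - {\<zero>}" "x \<in> carrier M" "y \<in> carrier M"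
    "\<psi> (\<phi> r) \<odot>\<^bsub>M\<^esub> x = \<psi> (\<phi> r) \<odot>\<^bsub>M\<^esub> y"
  shows "x = y"
proof -
  interpret M: left_module \<Gamma> M by fact
  obtain c where c: "c \<in> carrier \<Gamma>" "c \<otimes>\<^bsub>\<Gamma>\<^esub> \<psi> (\<phi> r) = \<one>\<^bsub>\<Gamma>\<^esub>" using invertible[OF assms(2)] by blast
  have "c \<odot>\<^bsub>M\<^esub> (\<psi> (\<phi> r) \<odot>\<^bsub>M\<^esub> z) = z" if "z \<in> carrier M" for z
    using that c assms(2) by (simp add: M.smult_assoc1[symmetric] M.smult_one)
  then show ?thesis using assms by metis
qed

lemma scale_surj:
  assumes "left_module \<Gamma> M" "left_submodule \<Gamma> M H" "r \<in> carrier R - {\<zero>}" "x \<in> H"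
  obtains y where "y \<in> H" "\<psi> (\<phi> r) \<odot>\<^bsub>M\<^esub> y = x"
proof -
  interpret M: left_module \<Gamma> M by fact
  obtain c where c: "c \<in> carrier \<Gamma>" "\<psi> (\<phi> r) \<otimes>\<^bsub>\<Gamma>\<^esub> c = \<one>\<^bsub>\<Gamma>\<^esub>" using invertible[OF assms(3)] by blast
  have "\<psi> (\<phi> r) \<odot>\<^bsub>M\<^esub> (c \<odot>\<^bsub>M\<^esub> x) = x"
    using left_submoduleD(1)[OF assms(2,4)] c assms(3) by (simp add: M.smult_assoc1[symmetric] M.smult_one)
  then show ?thesis using that left_submoduleD(4)[OF assms(2) c(1) assms(4)] by blast
qed

text \<open>The elements with a nonzero multiple in \<open>W\<close> form the \<open>\<Gamma>\<close>-submodule generated by \<open>W\<close>.\<close>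

lemma lattice_in_iff:
  assumes M: "left_module \<Gamma> M" and W: "left_submodule \<Lambda> (restrict_scalars \<psi> M) W"
  shows "lattice_in \<Lambda> \<Gamma> \<psi> M W \<longleftrightarrow> (\<forall>x\<in>carrier M. \<exists>r\<in>carrier R - {\<zero>}. \<psi> (\<phi> r) \<odot>\<^bsub>M\<^esub> x \<in> W)"
proof
  interpret M: left_module \<Gamma> M by fact
  note D = left_submoduleD[OF W, simplified]
  have sc: "\<psi> (\<phi> r) \<odot>\<^bsub>M\<^esub> x \<in> W" if "r \<in> carrier R" "x \<in> W" for r x
    using D(4) that by simp
  define H where "H = {x \<in> carrier M. \<exists>r\<in>carrier R - {\<zero>}. \<psi> (\<phi> r) \<odot>\<^bsub>M\<^esub> x \<in> W}"
  have "left_submodule \<Gamma> M H"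
  proof (rule left_submoduleI)
    show "\<zero>\<^bsub>M\<^esub> \<in> H"
      using D(2) by (auto simp: H_def M.smult_zero_right intro!: bexI[of _ \<one>])
    fix x y assume xy: "x \<in> H" "y \<in> H"
    then obtain r s where r: "r \<in> carrier R - {\<zero>}" "\<psi> (\<phi> r) \<odot>\<^bsub>M\<^esub> x \<in> W"
      and s: "s \<in> carrier R - {\<zero>}" "\<psi> (\<phi> s) \<odot>\<^bsub>M\<^esub> y \<in> W" by (auto simp: H_def)
    have xy': "x \<in> carrier M" "y \<in> carrier M" using xy by (auto simp: H_def)
    have "\<psi> (\<phi> (r \<otimes> s)) \<odot>\<^bsub>M\<^esub> (x \<oplus>\<^bsub>M\<^esub> y) =
        \<psi> (\<phi> s) \<odot>\<^bsub>M\<^esub> (\<psi> (\<phi> r) \<odot>\<^bsub>M\<^esub> x) \<oplus>\<^bsub>M\<^esub> \<psi> (\<phi> r) \<odot>\<^bsub>M\<^esub> (\<psi> (\<phi> s) \<odot>\<^bsub>M\<^esub> y)"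
      using r s xy' by (simp add: scale_mult[OF M, symmetric] alg.m_comm[of s r] M.smult_r_distr del: alg.hom_mult ext.hom_mult)
    also have "\<dots> \<in> W" using r s D(3) sc by auto
    finally show "x \<oplus>\<^bsub>M\<^esub> y \<in> H" using nonzero_mult[OF r(1) s(1)] xy' unfolding H_def by blast
  next
    fix c x assume c: "c \<in> carrier \<Gamma>" and x: "x \<in> H"
    then obtain r where r: "r \<in> carrier R - {\<zero>}" "\<psi> (\<phi> r) \<odot>\<^bsub>M\<^esub> x \<in> W" by (auto simp: H_def)
    have x': "x \<in> carrier M" using x by (auto simp: H_def)
    obtain s a where s: "s \<in> carrier R - {\<zero>}" and a: "a \<in> carrier \<Lambda>" "\<psi> (\<phi> s) \<otimes>\<^bsub>\<Gamma>\<^esub> c = \<psi> a"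
      using denominators[OF c] by blast
    have "\<psi> (\<phi> (r \<otimes> s)) \<odot>\<^bsub>M\<^esub> (c \<odot>\<^bsub>M\<^esub> x) = \<psi> a \<odot>\<^bsub>M\<^esub> (\<psi> (\<phi> r) \<odot>\<^bsub>M\<^esub> x)"
      using r s a c x' by (intro scale_fraction[OF M]) auto
    also have "\<dots> \<in> W" using a r D(4) by simp
    finally show "c \<odot>\<^bsub>M\<^esub> x \<in> H" using nonzero_mult[OF r(1) s] c x' M.smult_closed unfolding H_def by blast
  qed (auto simp: H_def)
  moreover have "W \<subseteq> H"
    using D(1) by (auto simp: H_def M.smult_one intro!: bexI[of _ \<one>])
  moreover assume "lattice_in \<Lambda> \<Gamma> \<psi> M W"
  ultimately have "carrier M \<subseteq> H" using lspan_minimal[of \<Gamma> M H W] by (simp add: lattice_in_def)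
  then show "\<forall>x\<in>carrier M. \<exists>r\<in>carrier R - {\<zero>}. \<psi> (\<phi> r) \<odot>\<^bsub>M\<^esub> x \<in> W" by (auto simp: H_def)
next
  interpret M: left_module \<Gamma> M by fact
  assume *: "\<forall>x\<in>carrier M. \<exists>r\<in>carrier R - {\<zero>}. \<psi> (\<phi> r) \<odot>\<^bsub>M\<^esub> x \<in> W"
  have WM: "W \<subseteq> carrier M" using left_submoduleD(1)[OF W] by auto
  note L = left_submodule_lspan[OF M WM]
  have "x \<in> lspan \<Gamma> M W" if x: "x \<in> carrier M" for x
  proof -
    obtain r where r: "r \<in> carrier R - {\<zero>}" "\<psi> (\<phi> r) \<odot>\<^bsub>M\<^esub> x \<in> W" using * x by blast
    then have "\<psi> (\<phi> r) \<odot>\<^bsub>M\<^esub> x \<in> lspan \<Gamma> M W" using subsetD[OF lspan_superset] by metis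
    then obtain y where y: "y \<in> lspan \<Gamma> M W" "\<psi> (\<phi> r) \<odot>\<^bsub>M\<^esub> y = \<psi> (\<phi> r) \<odot>\<^bsub>M\<^esub> x"
      using scale_surj[OF M L r(1)] by blast
    then have "y = x" using scale_inj[OF M r(1) _ x] left_submoduleD(1)[OF L] by blast
    then show ?thesis using y by simp
  qed
  then show "lattice_in \<Lambda> \<Gamma> \<psi> M W"
    unfolding lattice_in_def using W left_submoduleD(1)[OF L] by blast
qed

text \<open>A homomorphism from a lattice \<open>W\<close> in \<open>M\<close> extends to \<open>M\<close> by \<open>f (w / r) = u w / r\<close>.\<close>

lemma lattice_hom_extends:
  assumes M: "left_module \<Gamma> M" and N: "left_module \<Gamma> N" and W: "lattice_in \<Lambda> \<Gamma> \<psi> M W"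
    and u: "u \<in> module_hom \<Lambda> ((restrict_scalars \<psi> M)\<lparr>carrier := W\<rparr>) (restrict_scalars \<psi> N)"
    and gen: "lspan \<Gamma> N (u ` W) = carrier N"
  shows "\<exists>f\<in>module_hom \<Gamma> M N. f ` carrier M = carrier N"
proof -
  interpret M: left_module \<Gamma> M by fact
  interpret N: left_module \<Gamma> N by fact
  note M' = left_module_restrict_scalars[OF hom M] and N' = left_module_restrict_scalars[OF hom N]
  have W': "left_submodule \<Lambda> (restrict_scalars \<psi> M) W" using W by (simp add: lattice_in_def)
  note D = left_submoduleD[OF W', simplified]
  note [simp] = module_homD(1)[OF u, simplified]
  note u_add = module_homD(2)[OF u, simplified] and u_smult = module_homD(3)[OF u, simplified]
  have dense: "\<exists>r\<in>carrier R - {\<zero>}. \<psi> (\<phi> r) \<odot>\<^bsub>M\<^esub> x \<in> W" if "x \<in> carrier M" for x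
    using W lattice_in_iff[OF M W'] that by blast
  \<comment> \<open>\<open>y\<close> is the value of the extension at \<open>x\<close>, as computed with some denominator \<open>r\<close>.\<close>
  define ext where "ext x y \<longleftrightarrow> y \<in> carrier N \<and> (\<exists>r\<in>carrier R - {\<zero>}. \<psi> (\<phi> r) \<odot>\<^bsub>M\<^esub> x \<in> W \<and>
    \<psi> (\<phi> r) \<odot>\<^bsub>N\<^esub> y = u (\<psi> (\<phi> r) \<odot>\<^bsub>M\<^esub> x))" for x y
  have multiple: "\<psi> (\<phi> (s \<otimes> r)) \<odot>\<^bsub>M\<^esub> x \<in> W" "\<psi> (\<phi> (s \<otimes> r)) \<odot>\<^bsub>N\<^esub> y = u (\<psi> (\<phi> (s \<otimes> r)) \<odot>\<^bsub>M\<^esub> x)"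
    if "r \<in> carrier R" "s \<in> carrier R" "x \<in> carrier M" "y \<in> carrier N"
      "\<psi> (\<phi> r) \<odot>\<^bsub>M\<^esub> x \<in> W" "\<psi> (\<phi> r) \<odot>\<^bsub>N\<^esub> y = u (\<psi> (\<phi> r) \<odot>\<^bsub>M\<^esub> x)" for r s x y
    unfolding scale_mult[OF M that(2,1,3)] scale_mult[OF N that(2,1,4)]
    using that D(4) u_smult by auto
  have unique: "y = y'" if x: "x \<in> carrier M" and y: "ext x y" "ext x y'" for x y y'
  proof -
    obtain r where r: "r \<in> carrier R - {\<zero>}" "\<psi> (\<phi> r) \<odot>\<^bsub>M\<^esub> x \<in> W" "\<psi> (\<phi> r) \<odot>\<^bsub>N\<^esub> y = u (\<psi> (\<phi> r) \<odot>\<^bsub>M\<^esub> x)"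
      using y(1) unfolding ext_def by blast
    obtain s where s: "s \<in> carrier R - {\<zero>}" "\<psi> (\<phi> s) \<odot>\<^bsub>M\<^esub> x \<in> W" "\<psi> (\<phi> s) \<odot>\<^bsub>N\<^esub> y' = u (\<psi> (\<phi> s) \<odot>\<^bsub>M\<^esub> x)"
      using y(2) unfolding ext_def by blast
    have c: "y \<in> carrier N" "y' \<in> carrier N" using y unfolding ext_def by blast+
    have "\<psi> (\<phi> (s \<otimes> r)) \<odot>\<^bsub>N\<^esub> y = u (\<psi> (\<phi> (s \<otimes> r)) \<odot>\<^bsub>M\<^esub> x)"
      using r s x c by (intro multiple(2)) auto
    moreover have "\<psi> (\<phi> (r \<otimes> s)) \<odot>\<^bsub>N\<^esub> y' = u (\<psi> (\<phi> (r \<otimes> s)) \<odot>\<^bsub>M\<^esub> x)"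
      using r s x c by (intro multiple(2)) auto
    moreover have "r \<otimes> s = s \<otimes> r" using r s by (intro alg.m_comm) auto
    ultimately have "\<psi> (\<phi> (s \<otimes> r)) \<odot>\<^bsub>N\<^esub> y = \<psi> (\<phi> (s \<otimes> r)) \<odot>\<^bsub>N\<^esub> y'" by simp
    then show ?thesis by (rule scale_inj[OF N nonzero_mult[OF s(1) r(1)] c])
  qed
  have exists: "\<exists>y. ext x y" if x: "x \<in> carrier M" for x
  proof -
    obtain r where r: "r \<in> carrier R - {\<zero>}" "\<psi> (\<phi> r) \<odot>\<^bsub>M\<^esub> x \<in> W" using dense[OF x] by blast
    then obtain y where "y \<in> carrier N" "\<psi> (\<phi> r) \<odot>\<^bsub>N\<^esub> y = u (\<psi> (\<phi> r) \<odot>\<^bsub>M\<^esub> x)"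
      using scale_surj[OF N left_submodule_carrier[OF N] r(1), of "u (\<psi> (\<phi> r) \<odot>\<^bsub>M\<^esub> x)"] by auto
    then show ?thesis using r unfolding ext_def by blast
  qed
  define f where "f x = (SOME y. ext x y)" for x
  have f: "ext x (f x)" if "x \<in> carrier M" for x
    unfolding f_def using exists[OF that] by (rule someI_ex)
  have fI: "f x = y" if "x \<in> carrier M" "ext x y" for x y
    using unique[OF that(1) f[OF that(1)] that(2)] .
  have fhom: "f \<in> module_hom \<Gamma> M N"
  proof (rule module_homI)
    fix x assume x: "x \<in> carrier M"
    show fx: "f x \<in> carrier N" using f[OF x] unfolding ext_def by blast
    obtain r where r: "r \<in> carrier R - {\<zero>}" "\<psi> (\<phi> r) \<odot>\<^bsub>M\<^esub> x \<in> W" "\<psi> (\<phi> r) \<odot>\<^bsub>N\<^esub> f x = u (\<psi> (\<phi> r) \<odot>\<^bsub>M\<^esub> x)"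
      using f[OF x] unfolding ext_def by blast
    {
      fix y assume y: "y \<in> carrier M"
      have fy: "f y \<in> carrier N" using f[OF y] unfolding ext_def by blast
      obtain s where s: "s \<in> carrier R - {\<zero>}" "\<psi> (\<phi> s) \<odot>\<^bsub>M\<^esub> y \<in> W" "\<psi> (\<phi> s) \<odot>\<^bsub>N\<^esub> f y = u (\<psi> (\<phi> s) \<odot>\<^bsub>M\<^esub> y)"
        using f[OF y] unfolding ext_def by blast
      have "r \<otimes> s = s \<otimes> r" using r s by (intro alg.m_comm) auto
      then have 1: "\<psi> (\<phi> (s \<otimes> r)) \<odot>\<^bsub>M\<^esub> x \<in> W" "\<psi> (\<phi> (s \<otimes> r)) \<odot>\<^bsub>N\<^esub> f x = u (\<psi> (\<phi> (s \<otimes> r)) \<odot>\<^bsub>M\<^esub> x)"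
        and 2: "\<psi> (\<phi> (s \<otimes> r)) \<odot>\<^bsub>M\<^esub> y \<in> W" "\<psi> (\<phi> (s \<otimes> r)) \<odot>\<^bsub>N\<^esub> f y = u (\<psi> (\<phi> (s \<otimes> r)) \<odot>\<^bsub>M\<^esub> y)"
        using multiple[of r s x "f x"] multiple[of s r y "f y"] r s x y fx fy by auto
      have c: "\<psi> (\<phi> (s \<otimes> r)) \<in> carrier \<Gamma>" using r s by simp
      have "ext (x \<oplus>\<^bsub>M\<^esub> y) (f x \<oplus>\<^bsub>N\<^esub> f y)"
        unfolding ext_def
        using nonzero_mult[OF s(1) r(1)] c fx fy x y 1 2 D(3)[OF 1(1) 2(1)] u_add[OF 1(1) 2(1)]
        by (intro conjI bexI[of _ "s \<otimes> r"]) (auto simp: M.smult_r_distr N.smult_r_distr simp del: alg.hom_mult ext.hom_mult)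
      then show "f (x \<oplus>\<^bsub>M\<^esub> y) = f x \<oplus>\<^bsub>N\<^esub> f y" using x y by (intro fI) auto
    }
    fix c assume c: "c \<in> carrier \<Gamma>"
    obtain s a where s: "s \<in> carrier R - {\<zero>}" and a: "a \<in> carrier \<Lambda>" "\<psi> (\<phi> s) \<otimes>\<^bsub>\<Gamma>\<^esub> c = \<psi> a"
      using denominators[OF c] by blast
    have rx: "\<psi> (\<phi> (r \<otimes> s)) \<odot>\<^bsub>M\<^esub> (c \<odot>\<^bsub>M\<^esub> x) = \<psi> a \<odot>\<^bsub>M\<^esub> (\<psi> (\<phi> r) \<odot>\<^bsub>M\<^esub> x)"
      "\<psi> (\<phi> (r \<otimes> s)) \<odot>\<^bsub>N\<^esub> (c \<odot>\<^bsub>N\<^esub> f x) = \<psi> a \<odot>\<^bsub>N\<^esub> (\<psi> (\<phi> r) \<odot>\<^bsub>N\<^esub> f x)"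
      by (rule scale_fraction[OF M] scale_fraction[OF N]; use r s a c x fx in simp)+
    have "ext (c \<odot>\<^bsub>M\<^esub> x) (c \<odot>\<^bsub>N\<^esub> f x)"
      unfolding ext_def
      using nonzero_mult[OF r(1) s] N.smult_closed[OF c fx] D(4)[OF a(1) r(2)] u_smult[OF a(1) r(2)] r(3)
      by (intro conjI bexI[of _ "r \<otimes> s"]) (simp_all only: rx)
    then show "f (c \<odot>\<^bsub>M\<^esub> x) = c \<odot>\<^bsub>N\<^esub> f x" using c x by (intro fI) (auto simp: M.smult_closed)
  qed
  have "carrier N \<subseteq> f ` carrier M"
  proof
    fix y assume y: "y \<in> carrier N"
    have uW: "left_submodule \<Lambda> (restrict_scalars \<psi> N) (u ` W)"
      using left_submodule_image[OF left_module_restrict[OF M' W'] N' u left_submodule_carrier[OF left_module_restrict[OF M' W']]]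
      by simp
    then have "lattice_in \<Lambda> \<Gamma> \<psi> N (u ` W)" using gen by (simp add: lattice_in_def)
    then obtain r w where r: "r \<in> carrier R - {\<zero>}" and w: "w \<in> W" "\<psi> (\<phi> r) \<odot>\<^bsub>N\<^esub> y = u w"
      using lattice_in_iff[OF N uW] y by blast
    obtain x where x: "x \<in> carrier M" "\<psi> (\<phi> r) \<odot>\<^bsub>M\<^esub> x = w"
      using scale_surj[OF M left_submodule_carrier[OF M] r D(1)[OF w(1)]] .
    then have "ext x y" unfolding ext_def using r w y by blast
    then show "y \<in> f ` carrier M" using fI[OF x(1)] x(1) by blast
  qed
  moreover have "f ` carrier M \<subseteq> carrier N" using module_homD(1)[OF fhom] by auto
  ultimately show ?thesis using fhom by (intro bexI[of _ f]) auto
qed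

lemma finite_tors_localization:
  assumes fin: "finite (tors \<Lambda>)"
  shows "finite (tors \<Gamma>)"
proof (rule finite_tors_of_scalar_extension[OF hom _ fin])
  fix M assume "M \<in> fg_modules \<Gamma>"
  then have M: "left_module \<Gamma> M" "fin_gen_module \<Gamma> M" by (auto simp: fg_modules_def)
  note M' = left_module_restrict_scalars[OF hom M(1)]
  obtain S where S: "finite S" "S \<subseteq> carrier M" "lspan \<Gamma> M S = carrier M"
    using M(2) unfolding fin_gen_module_iff[OF M(1)] by blast
  define W where "W = lspan \<Lambda> (restrict_scalars \<psi> M) S"
  have W: "left_submodule \<Lambda> (restrict_scalars \<psi> M) W"
    unfolding W_def using S(2) by (intro left_submodule_lspan[OF M']) simp
  have SW: "S \<subseteq> W" unfolding W_def by (rule lspan_superset)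
  have WM: "W \<subseteq> carrier M" using left_submoduleD(1)[OF W] by auto
  have "lspan \<Gamma> M S \<subseteq> lspan \<Gamma> M W"
    using SW lspan_superset[of W \<Gamma> M] by (intro lspan_minimal left_submodule_lspan[OF M(1) WM]) blast
  then have lat: "lattice_in \<Lambda> \<Gamma> \<psi> M W"
    unfolding lattice_in_def using W S(3) left_submoduleD(1)[OF left_submodule_lspan[OF M(1) WM]] by blast
  have "fin_gen_module \<Lambda> ((restrict_scalars \<psi> M)\<lparr>carrier := W\<rparr>)"
    unfolding fin_gen_module_iff[OF left_module_restrict[OF M' W]]
    using S(1) SW lspan_restrict[OF M' W SW] by (intro exI[of _ S]) (simp add: W_def)
  then show "\<exists>W. lattice_in \<Lambda> \<Gamma> \<psi> M W \<and>
      fin_gen_module \<Lambda> ((restrict_scalars \<psi> M)\<lparr>carrier := W\<rparr>) \<and>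
      (\<forall>N\<in>fg_modules \<Gamma>. \<forall>u\<in>module_hom \<Lambda> ((restrict_scalars \<psi> M)\<lparr>carrier := W\<rparr>) (restrict_scalars \<psi> N).
        lspan \<Gamma> N (u ` W) = carrier N \<longrightarrow> (\<exists>f\<in>module_hom \<Gamma> M N. f ` carrier M = carrier N))"
    using lat lattice_hom_extends[OF M(1) _ lat]
    by (intro exI[of _ W] conjI ballI impI) (auto simp: fg_modules_def)
qed

text \<open>Given lattices \<open>U\<close> in the submodule \<open>f L\<close> and \<open>V\<close> in the quotient \<open>N\<close>, lift generators of \<open>V\<close> to
  span \<open>W\<^sub>0\<close>. As \<open>r (W\<^sub>0 \<inter> f L) \<subseteq> U\<close> for some nonzero \<open>r\<close>, the lattice \<open>W\<^sub>0 + r\<^sup>-\<^sup>1 U\<close> is an extension of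
  \<open>V\<close> by \<open>r\<^sup>-\<^sup>1 U \<cong> U\<close>.\<close>

lemma torsion_class_extended_localization:
  assumes T: "torsion_class \<Lambda> T"
  shows "torsion_class \<Gamma> (extended_class \<Lambda> \<Gamma> \<psi> T)"
proof (rule torsion_class_extended[OF hom T])
  fix L M N f g
  assume L: "L \<in> extended_class \<Lambda> \<Gamma> \<psi> T" and N: "N \<in> extended_class \<Lambda> \<Gamma> \<psi> T"
    and M: "M \<in> fg_modules \<Gamma>" and ex: "short_exact \<Gamma> L M N f g"
  have mL: "left_module \<Gamma> L" and mM: "left_module \<Gamma> M" and mN: "left_module \<Gamma> N"
    using L N M by (auto simp: fg_modules_def extended_class_def)
  note rL = left_module_restrict_scalars[OF hom mL] and rM = left_module_restrict_scalars[OF hom mM]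
    and rN = left_module_restrict_scalars[OF hom mN]
  interpret M: left_module \<Gamma> M by (rule mM)
  interpret rM: left_module \<Lambda> "restrict_scalars \<psi> M" by (rule rM)
  interpret N: left_module \<Gamma> N by (rule mN)
  have f: "f \<in> module_hom \<Gamma> L M" and g: "g \<in> module_hom \<Gamma> M N" "g ` carrier M = carrier N"
    and im: "f ` carrier L = {x \<in> carrier M. g x = \<zero>\<^bsub>N\<^esub>}"
    using ex by (auto simp: short_exact_def)
  note fr = module_hom_restrict_scalars[OF hom f] and gr = module_hom_restrict_scalars[OF hom g(1)]
  obtain U0 where U0: "lattice_in \<Lambda> \<Gamma> \<psi> L U0" "subquot_in \<Lambda> T (restrict_scalars \<psi> L) U0 {\<zero>\<^bsub>L\<^esub>}"
    using L by (rule extended_classD)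
  obtain V where V: "lattice_in \<Lambda> \<Gamma> \<psi> N V" "subquot_in \<Lambda> T (restrict_scalars \<psi> N) V {\<zero>\<^bsub>N\<^esub>}"
    using N by (rule extended_classD)
  define I where "I = f ` carrier L"
  define U where "U = f ` U0"
  have I: "left_submodule \<Gamma> M I"
    unfolding I_def by (rule left_submodule_image[OF mL mM f left_submodule_carrier[OF mL]])
  note rI = left_submodule_restrict_scalars[OF hom I]
  have gI: "x \<in> I \<longleftrightarrow> x \<in> carrier M \<and> g x = \<zero>\<^bsub>N\<^esub>" for x unfolding I_def im by simp
  have sU0: "left_submodule \<Lambda> (restrict_scalars \<psi> L) U0" and sV: "left_submodule \<Lambda> (restrict_scalars \<psi> N) V"
    using U0(1) V(1) by (auto simp: lattice_in_def)
  note sU = left_submodule_image[OF rL rM fr sU0, folded U_def]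
  have UT: "subquot_in \<Lambda> T (restrict_scalars \<psi> M) U {\<zero>\<^bsub>M\<^esub>}"
    using subquot_in_image_zero[OF T rL rM U0(2) fr] module_hom_zero[OF mL mM f] by (simp add: U_def)
  have UI: "\<exists>r\<in>carrier R - {\<zero>}. \<psi> (\<phi> r) \<odot>\<^bsub>M\<^esub> x \<in> U" if "x \<in> I" for x
  proof -
    from that obtain l where l: "l \<in> carrier L" "x = f l" unfolding I_def by blast
    then obtain r where "r \<in> carrier R - {\<zero>}" "\<psi> (\<phi> r) \<odot>\<^bsub>L\<^esub> l \<in> U0"
      using U0(1) lattice_in_iff[OF mL sU0] by blast
    then show ?thesis using module_homD(3)[OF f, of "\<psi> (\<phi> r)" l] l unfolding U_def by force
  qed
  obtain S where S: "finite S" "S \<subseteq> V" "lspan \<Lambda> (restrict_scalars \<psi> N) S = V"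
    using fin_gen_restrictD[OF rN sV] subquot_in_zero_fin_gen[OF T rN] V(2) by auto
  have "S \<subseteq> g ` carrier M" using S(2) left_submoduleD(1)[OF sV] g(2) by auto
  then obtain S' where S': "S' \<subseteq> carrier M" "finite S'" "S = g ` S'"
    using finite_subset_image[OF S(1)] by blast
  define W0 where "W0 = lspan \<Lambda> (restrict_scalars \<psi> M) S'"
  have sW0: "left_submodule \<Lambda> (restrict_scalars \<psi> M) W0"
    unfolding W0_def using S' by (intro left_submodule_lspan[OF rM]) simp
  have gW0: "g ` W0 = V"
    unfolding W0_def using lspan_image[OF rM rN gr, of S'] S' S(3) by simp
  have SW0: "S' \<subseteq> W0" unfolding W0_def by (rule lspan_superset)
  let ?W0 = "(restrict_scalars \<psi> M)\<lparr>carrier := W0\<rparr>"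
  note mW0 = left_module_restrict[OF rM sW0]
  have "fin_gen_module \<Lambda> ?W0"
    unfolding fin_gen_module_iff[OF mW0]
    using S'(2) SW0 lspan_restrict[OF rM sW0 SW0] by (intro exI[of _ S']) (simp add: W0_def)
  moreover have "left_submodule \<Lambda> ?W0 (W0 \<inter> I)" "left_submodule \<Lambda> ?W0 (W0 \<inter> U)"
    using left_submodule_Int[OF sW0 rI] left_submodule_Int[OF sW0 sU]
    by (simp_all add: left_submodule_restrict_iff[OF sW0])
  moreover have "\<exists>r\<in>carrier R - {\<zero>}. \<phi> r \<odot>\<^bsub>?W0\<^esub> l \<in> W0 \<inter> U" if "l \<in> W0 \<inter> I" for l
  proof -
    have l: "l \<in> W0" "l \<in> I" using that by auto
    obtain r where r: "r \<in> carrier R - {\<zero>}" "\<psi> (\<phi> r) \<odot>\<^bsub>M\<^esub> l \<in> U" using UI[OF l(2)] by blast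
    moreover have "\<psi> (\<phi> r) \<odot>\<^bsub>M\<^esub> l \<in> W0" using left_submoduleD(4)[OF sW0 _ l(1), of "\<phi> r"] r(1) by simp
    ultimately show ?thesis by auto
  qed
  ultimately obtain r where r: "r \<in> carrier R - {\<zero>}"
    and rW0: "\<And>x. x \<in> W0 \<inter> I \<Longrightarrow> \<phi> r \<odot>\<^bsub>?W0\<^esub> x \<in> W0 \<inter> U"
    using bounded_torsion[OF algebra base.domain_axioms mW0] by blast
  define U' where "U' = {x \<in> I. \<psi> (\<phi> r) \<odot>\<^bsub>M\<^esub> x \<in> U}"
  have rR: "r \<in> carrier R" using r by simp
  have "left_submodule \<Lambda> (restrict_scalars \<psi> M) {x \<in> carrier M. \<psi> (\<phi> r) \<odot>\<^bsub>M\<^esub> x \<in> U}"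
    using left_submodule_vimage[OF rM rM scale_hom[OF mM rR] sU] by simp
  from left_submodule_Int[OF rI this] have "left_submodule \<Lambda> (restrict_scalars \<psi> M) (I \<inter> {x \<in> carrier M. \<psi> (\<phi> r) \<odot>\<^bsub>M\<^esub> x \<in> U})" .
  moreover have "I \<inter> {x \<in> carrier M. \<psi> (\<phi> r) \<odot>\<^bsub>M\<^esub> x \<in> U} = U'"
    using left_submoduleD(1)[OF I] unfolding U'_def by blast
  ultimately have sU': "left_submodule \<Lambda> (restrict_scalars \<psi> M) U'"
    by simp
  have UsubI: "U \<subseteq> I" using left_submoduleD(1)[OF sU0] by (auto simp: U_def I_def)
  have sc_U': "(\<lambda>x. \<psi> (\<phi> r) \<odot>\<^bsub>M\<^esub> x) ` U' = U"
  proof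
    show "U \<subseteq> (\<lambda>x. \<psi> (\<phi> r) \<odot>\<^bsub>M\<^esub> x) ` U'"
    proof
      fix y assume y: "y \<in> U"
      then obtain x where "x \<in> I" "\<psi> (\<phi> r) \<odot>\<^bsub>M\<^esub> x = y" using scale_surj[OF mM I r] UsubI by blast
      then show "y \<in> (\<lambda>x. \<psi> (\<phi> r) \<odot>\<^bsub>M\<^esub> x) ` U'" using y unfolding U'_def by blast
    qed
  qed (auto simp: U'_def)
  have U'T: "subquot_in \<Lambda> T (restrict_scalars \<psi> M) U' {\<zero>\<^bsub>M\<^esub>}"
  proof (rule subquot_in_vimage[OF UT sU' module_hom_restrict[OF scale_hom[OF mM rR] sU'] sc_U'])
    have "x = \<zero>\<^bsub>M\<^esub>" if "x \<in> U'" "\<psi> (\<phi> r) \<odot>\<^bsub>M\<^esub> x = \<zero>\<^bsub>M\<^esub>" for x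
      using scale_inj[OF mM r, of x "\<zero>\<^bsub>M\<^esub>"] that left_submoduleD(1)[OF sU'] rR by (simp add: M.smult_zero_right)
    then show "{x \<in> U'. \<psi> (\<phi> r) \<odot>\<^bsub>M\<^esub> x \<in> {\<zero>\<^bsub>M\<^esub>}} = {\<zero>\<^bsub>M\<^esub>}"
      using left_submoduleD(2)[OF sU'] rR by (auto simp: M.smult_zero_right)
  qed
  define W where "W = {x \<oplus>\<^bsub>M\<^esub> y | x y. x \<in> W0 \<and> y \<in> U'}"
  have sW: "left_submodule \<Lambda> (restrict_scalars \<psi> M) W"
    using left_submodule_add[OF rM sW0 sU'] by (simp add: W_def)
  have cW0: "x \<in> carrier M" if "x \<in> W0" for x using left_submoduleD(1)[OF sW0 that] by simp
  have cU': "x \<in> carrier M" "g x = \<zero>\<^bsub>N\<^esub>" if "x \<in> U'" for x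
    using that gI by (auto simp: U'_def)
  have gW': "g (x \<oplus>\<^bsub>M\<^esub> y) = g x" if "x \<in> W0" "y \<in> U'" for x y
    using that cW0 cU' module_homD[OF g(1)] by simp
  have gW: "g ` W = V"
  proof
    show "g ` W \<subseteq> V" using gW' gW0 by (auto simp: W_def)
    have "\<zero>\<^bsub>M\<^esub> \<in> U'" using left_submoduleD(2)[OF sU'] by simp
    then have "x \<in> W" if "x \<in> W0" for x
      using cW0[OF that] that unfolding W_def by (intro CollectI exI[of _ x] exI[of _ "\<zero>\<^bsub>M\<^esub>"]) simp
    then show "V \<subseteq> g ` W" unfolding gW0[symmetric] by blast
  qed
  have U'W: "U' \<subseteq> W"
  proof
    fix x assume x: "x \<in> U'"
    have "\<zero>\<^bsub>M\<^esub> \<in> W0" using left_submoduleD(2)[OF sW0] by simp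
    then show "x \<in> W"
      using cU'(1)[OF x] x unfolding W_def by (intro CollectI exI[of _ "\<zero>\<^bsub>M\<^esub>"] exI[of _ x]) simp
  qed
  have "subquot_in \<Lambda> T (restrict_scalars \<psi> M) W U'"
  proof (rule subquot_in_vimage[OF V(2) sW module_hom_restrict[OF gr sW] gW])
    have "x \<in> U'" if "x \<in> W" "g x = \<zero>\<^bsub>N\<^esub>" for x
    proof -
      obtain w y where w: "w \<in> W0" "y \<in> U'" "x = w \<oplus>\<^bsub>M\<^esub> y" using \<open>x \<in> W\<close> unfolding W_def by blast
      then have "w \<in> W0 \<inter> I" using gW' that(2) cW0 gI by simp
      then have "w \<in> U'" using rW0 unfolding U'_def by simp
      then show ?thesis using w left_submoduleD(3)[OF sU'] by simp
    qed
    then show "{x \<in> W. g x \<in> {\<zero>\<^bsub>N\<^esub>}} = U'" using U'W cU' by blast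
  qed
  from subquot_in_trans[OF T rM this U'T]
  have WT: "subquot_in \<Lambda> T (restrict_scalars \<psi> M) W {\<zero>\<^bsub>M\<^esub>}" .
  have WM: "W \<subseteq> carrier M" using left_submoduleD(1)[OF sW] by auto
  have H: "left_submodule \<Gamma> M (lspan \<Gamma> M W)" by (rule left_submodule_lspan[OF mM WM])
  have IH: "I \<subseteq> lspan \<Gamma> M W"
  proof
    fix x assume x: "x \<in> I"
    then obtain s where s: "s \<in> carrier R - {\<zero>}" "\<psi> (\<phi> s) \<odot>\<^bsub>M\<^esub> x \<in> U" using UI by blast
    have xM: "x \<in> carrier M" using x gI by simp
    have "\<psi> (\<phi> s) \<odot>\<^bsub>M\<^esub> x \<in> U'"
      using s x UsubI left_submoduleD(4)[OF sU, of "\<phi> r"] rR unfolding U'_def by auto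
    then have "\<psi> (\<phi> s) \<odot>\<^bsub>M\<^esub> x \<in> lspan \<Gamma> M W" using U'W lspan_superset[of W \<Gamma> M] by blast
    then obtain y where y: "y \<in> lspan \<Gamma> M W" "\<psi> (\<phi> s) \<odot>\<^bsub>M\<^esub> y = \<psi> (\<phi> s) \<odot>\<^bsub>M\<^esub> x"
      using scale_surj[OF mM H s(1)] by blast
    then have "y = x" using scale_inj[OF mM s(1) _ xM] left_submoduleD(1)[OF H] by blast
    then show "x \<in> lspan \<Gamma> M W" using y by simp
  qed
  have "lspan \<Gamma> N V \<subseteq> g ` lspan \<Gamma> M W"
    unfolding gW[symmetric] lspan_image[OF mM mN g(1) WM] by simp
  then have onto: "g ` carrier M \<subseteq> g ` lspan \<Gamma> M W" using V(1) g(2) by (simp add: lattice_in_def)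
  have "x \<in> lspan \<Gamma> M W" if x: "x \<in> carrier M" for x
  proof -
    obtain y where y: "y \<in> lspan \<Gamma> M W" "g x = g y" using onto x by blast
    then have "y \<in> carrier M" using left_submoduleD(1)[OF H] by blast
    from module_hom_diff_in_kernel[OF mM mN g(1) x this y(2)]
    obtain z where "z \<in> carrier M" "g z = \<zero>\<^bsub>N\<^esub>" "x = y \<oplus>\<^bsub>M\<^esub> z" by blast
    then show ?thesis using y(1) IH gI left_submoduleD(3)[OF H] by blast
  qed
  then have "lattice_in \<Lambda> \<Gamma> \<psi> M W"
    unfolding lattice_in_def using sW left_submoduleD(1)[OF H] by blast
  then show "M \<in> extended_class \<Lambda> \<Gamma> \<psi> T" using WT by (rule extended_classI[OF M])
qed

end

section \<open>Localization of modules\<close>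

lemma left_module_functions:
  assumes "left_module R M"
  shows "left_module R \<lparr>carrier = UNIV \<rightarrow> carrier M, monoid.mult = undefined, one = undefined,
    ring.zero = (\<lambda>_. \<zero>\<^bsub>M\<^esub>), add = (\<lambda>f g t. f t \<oplus>\<^bsub>M\<^esub> g t), smult = (\<lambda>a f t. a \<odot>\<^bsub>M\<^esub> f t)\<rparr>"
    (is "left_module R ?F")
proof -
  interpret M: left_module R M by fact
  have "abelian_group ?F"
  proof (rule abelian_groupI)
    fix f assume f: "f \<in> carrier ?F"
    have "(\<lambda>t. \<ominus>\<^bsub>M\<^esub> f t) \<in> carrier ?F" "(\<lambda>t. \<ominus>\<^bsub>M\<^esub> f t) \<oplus>\<^bsub>?F\<^esub> f = \<zero>\<^bsub>?F\<^esub>"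
      using f by (auto simp: Pi_iff M.M.l_neg fun_eq_iff)
    then show "\<exists>g\<in>carrier ?F. g \<oplus>\<^bsub>?F\<^esub> f = \<zero>\<^bsub>?F\<^esub>" by blast
  qed (auto simp: Pi_iff M.M.a_ac fun_eq_iff)
  then show ?thesis
    by (intro left_module.intro left_module_axioms.intro M.R.ring_axioms)
      (auto simp: Pi_iff fun_eq_iff M.smult_closed M.smult_l_distr M.smult_r_distr M.smult_assoc1 M.smult_one)
qed

text \<open>Localization at the nonzero elements of \<open>R\<close>. A fraction \<open>v = y / s\<close> is represented by the
  function \<open>g t = t v\<close>, which takes values in \<open>M\<close> on the multiples of \<open>s\<close>; that is, by a function
  with \<open>g (s t) = t g s\<close> for all \<open>t\<close>. Functions are identified when they agree on the multiples of
  some nonzero \<open>s\<close>. The module structure is then inherited from the functions.\<close>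

lemma localized_module_exists:
  fixes R :: "('r, 'm) ring_scheme" and \<Lambda> :: "('l, 'p) ring_scheme" and M :: "('l, 'b, 'n) module_scheme"
  assumes A: "module_finite_algebra R \<Lambda> \<phi>" and "domain R" and M: "left_module \<Lambda> M"
  obtains V :: "('l, ('r \<Rightarrow> 'b) set) module" and u where "left_module \<Lambda> V" "u \<in> module_hom \<Lambda> M V"
    "\<And>r v. \<lbrakk>r \<in> carrier R - {\<zero>\<^bsub>R\<^esub>}; v \<in> carrier V; \<phi> r \<odot>\<^bsub>V\<^esub> v = \<zero>\<^bsub>V\<^esub>\<rbrakk> \<Longrightarrow> v = \<zero>\<^bsub>V\<^esub>"
    "\<And>r v. \<lbrakk>r \<in> carrier R - {\<zero>\<^bsub>R\<^esub>}; v \<in> carrier V\<rbrakk> \<Longrightarrow> \<exists>w\<in>carrier V. \<phi> r \<odot>\<^bsub>V\<^esub> w = v"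
    "\<And>x. \<lbrakk>x \<in> carrier M; u x = \<zero>\<^bsub>V\<^esub>\<rbrakk> \<Longrightarrow> \<exists>r\<in>carrier R - {\<zero>\<^bsub>R\<^esub>}. \<phi> r \<odot>\<^bsub>M\<^esub> x = \<zero>\<^bsub>M\<^esub>"
    "\<And>v. v \<in> carrier V \<Longrightarrow> \<exists>r\<in>carrier R - {\<zero>\<^bsub>R\<^esub>}. \<exists>x\<in>carrier M. \<phi> r \<odot>\<^bsub>V\<^esub> v = u x"
proof -
  interpret base: domain R by fact
  interpret alg: module_finite_algebra R \<Lambda> \<phi> by fact
  interpret M: left_module \<Lambda> M by fact
  define S where "S = carrier R - {\<zero>\<^bsub>R\<^esub>}"
  have S_mult: "r \<otimes>\<^bsub>R\<^esub> s \<in> S" if "r \<in> S" "s \<in> S" for r s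
    using that by (auto simp: S_def base.integral_iff)
  have S_R: "r \<in> carrier R" if "r \<in> S" for r using that by (simp add: S_def)
  have S_one: "\<one>\<^bsub>R\<^esub> \<in> S" by (simp add: S_def)
  have \<phi>_mult: "\<phi> (r \<otimes>\<^bsub>R\<^esub> s) \<odot>\<^bsub>M\<^esub> x = \<phi> r \<odot>\<^bsub>M\<^esub> (\<phi> s \<odot>\<^bsub>M\<^esub> x)"
    if "r \<in> carrier R" "s \<in> carrier R" "x \<in> carrier M" for r s x
    using that by (simp add: M.smult_assoc1)
  have \<phi>_comm: "\<phi> r \<odot>\<^bsub>M\<^esub> (a \<odot>\<^bsub>M\<^esub> x) = a \<odot>\<^bsub>M\<^esub> (\<phi> r \<odot>\<^bsub>M\<^esub> x)"
    if "r \<in> carrier R" "a \<in> carrier \<Lambda>" "x \<in> carrier M" for r a x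
    using that alg.central[of r a] by (simp add: M.smult_assoc1[symmetric])
  define F :: "('l, 'r \<Rightarrow> 'b) module" where
    "F = \<lparr>carrier = UNIV \<rightarrow> carrier M, monoid.mult = undefined, one = undefined,
      ring.zero = (\<lambda>_. \<zero>\<^bsub>M\<^esub>), add = (\<lambda>f g t. f t \<oplus>\<^bsub>M\<^esub> g t), smult = (\<lambda>a f t. a \<odot>\<^bsub>M\<^esub> f t)\<rparr>"
  have F: "left_module \<Lambda> F" unfolding F_def by (rule left_module_functions[OF M])
  have F_simps: "f \<in> carrier F \<longleftrightarrow> (\<forall>t. f t \<in> carrier M)" "\<zero>\<^bsub>F\<^esub> = (\<lambda>_. \<zero>\<^bsub>M\<^esub>)"
    "f \<oplus>\<^bsub>F\<^esub> g = (\<lambda>t. f t \<oplus>\<^bsub>M\<^esub> g t)" "a \<odot>\<^bsub>F\<^esub> f = (\<lambda>t. a \<odot>\<^bsub>M\<^esub> f t)" for f g a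
    by (auto simp: F_def)
  define den where "den g s \<longleftrightarrow> s \<in> S \<and> (\<forall>t\<in>S. g (s \<otimes>\<^bsub>R\<^esub> t) = \<phi> t \<odot>\<^bsub>M\<^esub> g s)" for g s
  define P where "P = {g \<in> carrier F. \<exists>s. den g s}"
  have den_mult: "den g (s \<otimes>\<^bsub>R\<^esub> r)" if g: "g \<in> carrier F" "den g s" "r \<in> S" for g s r
  proof -
    have "g (s \<otimes>\<^bsub>R\<^esub> r \<otimes>\<^bsub>R\<^esub> t) = \<phi> t \<odot>\<^bsub>M\<^esub> g (s \<otimes>\<^bsub>R\<^esub> r)" if t: "t \<in> S" for t
    proof -
      have "g (s \<otimes>\<^bsub>R\<^esub> r \<otimes>\<^bsub>R\<^esub> t) = g (s \<otimes>\<^bsub>R\<^esub> (r \<otimes>\<^bsub>R\<^esub> t))"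
        using g t S_R by (auto simp: base.m_assoc den_def)
      also have "\<dots> = \<phi> (t \<otimes>\<^bsub>R\<^esub> r) \<odot>\<^bsub>M\<^esub> g s"
        using g t S_R S_mult by (simp add: den_def base.m_comm)
      also have "\<dots> = \<phi> t \<odot>\<^bsub>M\<^esub> g (s \<otimes>\<^bsub>R\<^esub> r)"
        using g t S_R by (simp add: den_def M.smult_assoc1 F_simps)
      finally show ?thesis .
    qed
    then show ?thesis using g S_mult by (auto simp: den_def)
  qed
  have P: "left_submodule \<Lambda> F P"
  proof (rule left_submoduleI)
    show "\<zero>\<^bsub>F\<^esub> \<in> P"
      using S_one S_R by (auto simp: P_def F_simps den_def M.smult_zero_right intro!: exI[of _ "\<one>\<^bsub>R\<^esub>"])
    fix f g assume fg: "f \<in> P" "g \<in> P"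
    then obtain s s' where s: "f \<in> carrier F" "den f s" "g \<in> carrier F" "den g s'" by (auto simp: P_def)
    have ss: "s \<in> S" "s' \<in> S" using s by (auto simp: den_def)
    have "den f (s \<otimes>\<^bsub>R\<^esub> s')" "den g (s \<otimes>\<^bsub>R\<^esub> s')"
      using den_mult[OF s(1,2) ss(2)] den_mult[OF s(3,4) ss(1)] base.m_comm S_R[OF ss(1)] S_R[OF ss(2)] by auto
    moreover have "den (f \<oplus>\<^bsub>F\<^esub> g) p" if "den f p" "den g p" for p
      using s that S_R by (auto simp: den_def F_simps M.smult_r_distr)
    ultimately have "den (f \<oplus>\<^bsub>F\<^esub> g) (s \<otimes>\<^bsub>R\<^esub> s')" by blast
    then show "f \<oplus>\<^bsub>F\<^esub> g \<in> P" using s by (auto simp: P_def F_simps)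
  next
    fix a f assume a: "a \<in> carrier \<Lambda>" and f: "f \<in> P"
    then obtain s where "f \<in> carrier F" "den f s" by (auto simp: P_def)
    then have "a \<odot>\<^bsub>F\<^esub> f \<in> carrier F" "den (a \<odot>\<^bsub>F\<^esub> f) s"
      using a S_R by (auto simp: den_def F_simps \<phi>_comm M.smult_closed)
    then show "a \<odot>\<^bsub>F\<^esub> f \<in> P" by (auto simp: P_def)
  qed (auto simp: P_def)
  note PF = left_module_restrict[OF F P]
  interpret PF: left_module \<Lambda> "F\<lparr>carrier := P\<rparr>" by (rule PF)
  define vanish where "vanish g s \<longleftrightarrow> s \<in> S \<and> (\<forall>t\<in>S. g (s \<otimes>\<^bsub>R\<^esub> t) = \<zero>\<^bsub>M\<^esub>)" for g s
  have vanish_mult: "vanish g (s \<otimes>\<^bsub>R\<^esub> r)" if "vanish g s" "r \<in> S" for g s r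
    using that S_mult S_R unfolding vanish_def by (auto simp: base.m_assoc)
  define N where "N = {g \<in> P. \<exists>s. vanish g s}"
  have N: "left_submodule \<Lambda> (F\<lparr>carrier := P\<rparr>) N"
  proof (rule left_submoduleI)
    show "\<zero>\<^bsub>F\<lparr>carrier := P\<rparr>\<^esub> \<in> N"
      using left_submoduleD(2)[OF P] S_one by (auto simp: N_def F_simps vanish_def intro!: exI[of _ "\<one>\<^bsub>R\<^esub>"])
    fix f g assume fg: "f \<in> N" "g \<in> N"
    then obtain s s' where s: "f \<in> P" "vanish f s" "g \<in> P" "vanish g s'" by (auto simp: N_def)
    have ss: "s \<in> S" "s' \<in> S" using s by (auto simp: vanish_def)
    have "vanish f (s \<otimes>\<^bsub>R\<^esub> s')" "vanish g (s \<otimes>\<^bsub>R\<^esub> s')"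
      using vanish_mult[OF s(2) ss(2)] vanish_mult[OF s(4) ss(1)] base.m_comm S_R[OF ss(1)] S_R[OF ss(2)] by auto
    then have "vanish (f \<oplus>\<^bsub>F\<^esub> g) (s \<otimes>\<^bsub>R\<^esub> s')" by (auto simp: vanish_def F_simps)
    then show "f \<oplus>\<^bsub>F\<lparr>carrier := P\<rparr>\<^esub> g \<in> N" using s left_submoduleD(3)[OF P] by (auto simp: N_def)
  next
    fix a f assume a: "a \<in> carrier \<Lambda>" and f: "f \<in> N"
    then obtain s where "f \<in> P" "vanish f s" by (auto simp: N_def)
    moreover from this have "vanish (a \<odot>\<^bsub>F\<^esub> f) s" using a by (auto simp: vanish_def F_simps M.smult_zero_right)
    ultimately show "a \<odot>\<^bsub>F\<lparr>carrier := P\<rparr>\<^esub> f \<in> N" using a left_submoduleD(4)[OF P] by (auto simp: N_def)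
  qed (auto simp: N_def)
  obtain V :: "('l, ('r \<Rightarrow> 'b) set) module" and q where V: "left_module \<Lambda> V"
    and q: "q \<in> module_hom \<Lambda> (F\<lparr>carrier := P\<rparr>) V" "q ` P = carrier V"
    and kerq: "\<And>g. g \<in> P \<Longrightarrow> q g = \<zero>\<^bsub>V\<^esub> \<longleftrightarrow> g \<in> N"
    using quotient_module_exists[OF PF N] by auto
  interpret V: left_module \<Lambda> V by (rule V)
  note qD = module_homD[OF q(1), simplified]
  have PD: "f t \<in> carrier M" if "f \<in> P" for f t using that by (simp add: P_def F_simps)
  have q_eq: "q f = q g" if fg: "f \<in> P" "g \<in> P" and s: "s \<in> S" "\<And>t. t \<in> S \<Longrightarrow> f (s \<otimes>\<^bsub>R\<^esub> t) = g (s \<otimes>\<^bsub>R\<^esub> t)" for f g s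
  proof -
    define d where "d = (\<ominus>\<^bsub>\<Lambda>\<^esub> \<one>\<^bsub>\<Lambda>\<^esub>) \<odot>\<^bsub>F\<^esub> g"
    have d: "d \<in> P" using left_submoduleD(4)[OF P] fg by (simp add: d_def)
    have "vanish (f \<oplus>\<^bsub>F\<^esub> d) s"
      using s PD[OF fg(2)] M.add_smult_minus_one by (auto simp: vanish_def F_simps d_def)
    then have "q (f \<oplus>\<^bsub>F\<^esub> d) = \<zero>\<^bsub>V\<^esub>"
      using kerq[of "f \<oplus>\<^bsub>F\<^esub> d"] left_submoduleD(3)[OF P fg(1) d] unfolding N_def by blast
    then have "q f \<oplus>\<^bsub>V\<^esub> (\<ominus>\<^bsub>\<Lambda>\<^esub> \<one>\<^bsub>\<Lambda>\<^esub>) \<odot>\<^bsub>V\<^esub> q g = \<zero>\<^bsub>V\<^esub>"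
      using qD(2)[OF fg(1) d] qD(3)[OF _ fg(2), of "\<ominus>\<^bsub>\<Lambda>\<^esub> \<one>\<^bsub>\<Lambda>\<^esub>"] by (simp add: d_def)
    moreover have "q g \<oplus>\<^bsub>V\<^esub> (\<ominus>\<^bsub>\<Lambda>\<^esub> \<one>\<^bsub>\<Lambda>\<^esub>) \<odot>\<^bsub>V\<^esub> q g = \<zero>\<^bsub>V\<^esub>"
      by (rule V.add_smult_minus_one[OF qD(1)[OF fg(2)]])
    ultimately show ?thesis
      using qD(1)[OF fg(1)] qD(1)[OF fg(2)] V.smult_closed[of "\<ominus>\<^bsub>\<Lambda>\<^esub> \<one>\<^bsub>\<Lambda>\<^esub>" "q g"]
      by (metis V.M.add.r_cancel alg.S.a_inv_closed alg.S.one_closed)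
  qed
  define i where "i x t = (if t \<in> carrier R then \<phi> t \<odot>\<^bsub>M\<^esub> x else \<zero>\<^bsub>M\<^esub>)" for x t
  have iP: "i x \<in> P" if "x \<in> carrier M" for x
  proof -
    have "den (i x) \<one>\<^bsub>R\<^esub>"
      using that S_one S_R by (auto simp: den_def i_def M.smult_one)
    then show ?thesis using that by (auto simp: P_def F_simps i_def M.smult_closed)
  qed
  have "i \<in> module_hom \<Lambda> M (F\<lparr>carrier := P\<rparr>)"
    by (rule module_homI) (auto simp: iP F_simps i_def fun_eq_iff M.smult_r_distr M.smult_zero_right \<phi>_comm)
  note u = module_hom_compose[OF this q(1)]
  show thesis
  proof (rule that[OF V u])
    fix r v assume r: "r \<in> carrier R - {\<zero>\<^bsub>R\<^esub>}" and v: "v \<in> carrier V"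
    have rS: "r \<in> S" using r by (simp add: S_def)
    have \<phi>r: "\<phi> r \<in> carrier \<Lambda>" using r by simp
    obtain g where g: "g \<in> P" "v = q g" using v unfolding q(2)[symmetric] by blast
    then obtain s where s: "den g s" "g \<in> carrier F" by (auto simp: P_def)
    have sS: "s \<in> S" using s by (simp add: den_def)
    have gD: "g (s \<otimes>\<^bsub>R\<^esub> t) = \<phi> t \<odot>\<^bsub>M\<^esub> g s" if "t \<in> S" for t using s(1) that by (simp add: den_def)
    note c = S_R[OF rS] S_R[OF sS]
    {
      assume "\<phi> r \<odot>\<^bsub>V\<^esub> v = \<zero>\<^bsub>V\<^esub>"
      then have "\<phi> r \<odot>\<^bsub>F\<^esub> g \<in> N"
        using kerq[OF left_submoduleD(4)[OF P \<phi>r g(1)]] qD(3)[OF \<phi>r g(1)] g(2) by simp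
      then obtain s' where s': "s' \<in> S" "\<And>t. t \<in> S \<Longrightarrow> \<phi> r \<odot>\<^bsub>M\<^esub> g (s' \<otimes>\<^bsub>R\<^esub> t) = \<zero>\<^bsub>M\<^esub>"
        by (auto simp: N_def vanish_def F_simps)
      have "g ((s \<otimes>\<^bsub>R\<^esub> (r \<otimes>\<^bsub>R\<^esub> s')) \<otimes>\<^bsub>R\<^esub> t) = \<zero>\<^bsub>M\<^esub>" if t: "t \<in> S" for t
      proof -
        note c' = c S_R[OF s'(1)] S_R[OF t]
        have "g ((s \<otimes>\<^bsub>R\<^esub> (r \<otimes>\<^bsub>R\<^esub> s')) \<otimes>\<^bsub>R\<^esub> t) = g (s \<otimes>\<^bsub>R\<^esub> (r \<otimes>\<^bsub>R\<^esub> (s' \<otimes>\<^bsub>R\<^esub> t)))"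
          using c' by (simp add: base.m_assoc)
        also have "\<dots> = \<phi> (r \<otimes>\<^bsub>R\<^esub> (s' \<otimes>\<^bsub>R\<^esub> t)) \<odot>\<^bsub>M\<^esub> g s"
          using S_mult rS s' t by (intro gD) auto
        also have "\<dots> = \<phi> r \<odot>\<^bsub>M\<^esub> (\<phi> (s' \<otimes>\<^bsub>R\<^esub> t) \<odot>\<^bsub>M\<^esub> g s)"
          using c' PD[OF g(1)] by (intro \<phi>_mult) auto
        also have "\<phi> (s' \<otimes>\<^bsub>R\<^esub> t) \<odot>\<^bsub>M\<^esub> g s = g (s' \<otimes>\<^bsub>R\<^esub> (s \<otimes>\<^bsub>R\<^esub> t))"
          using gD[OF S_mult[OF s'(1) t]] c' by (simp add: base.m_lcomm)
        finally show ?thesis using s'(2)[OF S_mult[OF sS t]] by simp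
      qed
      then have "vanish g (s \<otimes>\<^bsub>R\<^esub> (r \<otimes>\<^bsub>R\<^esub> s'))" using S_mult sS rS s'(1) by (simp add: vanish_def)
      then show "v = \<zero>\<^bsub>V\<^esub>" using kerq[OF g(1)] g by (auto simp: N_def)
    }
    show "\<exists>w\<in>carrier V. \<phi> r \<odot>\<^bsub>V\<^esub> w = v"
    proof -
      define g' where "g' t = (if \<exists>t'\<in>carrier R. t = r \<otimes>\<^bsub>R\<^esub> t' then g (THE t'. t' \<in> carrier R \<and> t = r \<otimes>\<^bsub>R\<^esub> t') else \<zero>\<^bsub>M\<^esub>)" for t
      have g'r: "g' (r \<otimes>\<^bsub>R\<^esub> t) = g t" if t: "t \<in> carrier R" for t
      proof -
        have "(THE t'. t' \<in> carrier R \<and> r \<otimes>\<^bsub>R\<^esub> t = r \<otimes>\<^bsub>R\<^esub> t') = t"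
          using t r base.m_lcancel by (intro the_equality) auto
        then show ?thesis using t by (auto simp: g'_def)
      qed
      have g'_den: "g' (r \<otimes>\<^bsub>R\<^esub> s \<otimes>\<^bsub>R\<^esub> t) = \<phi> t \<odot>\<^bsub>M\<^esub> g s" if "t \<in> S" for t
        using g'r[of "s \<otimes>\<^bsub>R\<^esub> t"] c S_R[OF that] gD[OF that] by (simp add: base.m_assoc)
      have "den g' (r \<otimes>\<^bsub>R\<^esub> s)"
        using g'_den g'r[OF c(2)] S_mult[OF rS sS] by (simp add: den_def)
      moreover have "g' t \<in> carrier M" for t using PD[OF g(1)] by (simp add: g'_def)
      ultimately have g'P: "g' \<in> P" by (auto simp: P_def F_simps)
      have "q (\<phi> r \<odot>\<^bsub>F\<^esub> g') = q g"
      proof (rule q_eq[OF left_submoduleD(4)[OF P \<phi>r g'P] g(1) S_mult[OF rS sS]])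
        fix t assume t: "t \<in> S"
        have "g (r \<otimes>\<^bsub>R\<^esub> s \<otimes>\<^bsub>R\<^esub> t) = g (s \<otimes>\<^bsub>R\<^esub> (r \<otimes>\<^bsub>R\<^esub> t))"
          using c S_R[OF t] by (simp add: base.m_ac)
        also have "\<dots> = \<phi> r \<odot>\<^bsub>M\<^esub> (\<phi> t \<odot>\<^bsub>M\<^esub> g s)"
          using gD[OF S_mult[OF rS t]] \<phi>_mult[OF c(1) S_R[OF t] PD[OF g(1)]] by simp
        finally show "(\<phi> r \<odot>\<^bsub>F\<^esub> g') (r \<otimes>\<^bsub>R\<^esub> s \<otimes>\<^bsub>R\<^esub> t) = g (r \<otimes>\<^bsub>R\<^esub> s \<otimes>\<^bsub>R\<^esub> t)"
          using g'_den[OF t] by (simp add: F_simps)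
      qed
      then show ?thesis using qD(3)[OF \<phi>r g'P] qD(1)[OF g'P] g(2) by (intro bexI[of _ "q g'"]) auto
    qed
  next
    fix x assume x: "x \<in> carrier M" "q (i x) = \<zero>\<^bsub>V\<^esub>"
    then have "i x \<in> N" using kerq[OF iP] by blast
    then obtain s where s: "s \<in> S" "i x (s \<otimes>\<^bsub>R\<^esub> \<one>\<^bsub>R\<^esub>) = \<zero>\<^bsub>M\<^esub>" using S_one by (auto simp: N_def vanish_def)
    then show "\<exists>r\<in>carrier R - {\<zero>\<^bsub>R\<^esub>}. \<phi> r \<odot>\<^bsub>M\<^esub> x = \<zero>\<^bsub>M\<^esub>"
      using S_R[OF s(1)] by (intro bexI[of _ s]) (auto simp: i_def S_def)
  next
    fix v assume "v \<in> carrier V"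
    then obtain g where g: "g \<in> P" "v = q g" unfolding q(2)[symmetric] by blast
    then obtain s where s: "den g s" by (auto simp: P_def)
    have sS: "s \<in> S" using s by (simp add: den_def)
    have \<phi>s: "\<phi> s \<in> carrier \<Lambda>" using S_R[OF sS] by simp
    have "q (\<phi> s \<odot>\<^bsub>F\<^esub> g) = q (i (g s))"
    proof (rule q_eq[OF left_submoduleD(4)[OF P \<phi>s g(1)] iP[OF PD[OF g(1)]] sS])
      fix t assume t: "t \<in> S"
      have "g (s \<otimes>\<^bsub>R\<^esub> t) = \<phi> t \<odot>\<^bsub>M\<^esub> g s" using s t by (simp add: den_def)
      then show "(\<phi> s \<odot>\<^bsub>F\<^esub> g) (s \<otimes>\<^bsub>R\<^esub> t) = i (g s) (s \<otimes>\<^bsub>R\<^esub> t)"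
        using S_R[OF sS] S_R[OF t] \<phi>_mult[OF S_R[OF sS] S_R[OF t] PD[OF g(1)]] by (simp add: F_simps i_def)
    qed
    then show "\<exists>r\<in>carrier R - {\<zero>\<^bsub>R\<^esub>}. \<exists>x\<in>carrier M. \<phi> r \<odot>\<^bsub>V\<^esub> v = q (i x)"
      using qD(3)[OF \<phi>s g(1)] g(2) PD[OF g(1)] sS unfolding S_def by metis
  qed
qed

section \<open>The algebra \<open>K \<otimes>\<^sub>R \<Lambda>\<close>\<close>

lemma frag_extend_add_fun: "frag_extend (\<lambda>x. f x + g x) u = frag_extend f u + frag_extend g u"
  by (rule frag_induction[of u UNIV]) (auto simp: frag_extend_diff)

lemma frag_extend_diff_fun: "frag_extend (\<lambda>x. f x - g x) u = frag_extend f u - frag_extend g u"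
  by (rule frag_induction[of u UNIV]) (auto simp: frag_extend_diff)

text \<open>A module-finite algebra over a domain with field of fractions \<open>K\<close>.\<close>

locale fraction_algebra = frac: fraction_field R K \<iota> + alg: module_finite_algebra R \<Lambda> \<phi>
  for R :: "('r, 'm) ring_scheme" (structure) and K :: "('k, 'n) ring_scheme" (structure)
    and \<Lambda> :: "('l, 'p) ring_scheme" (structure) and \<iota> and \<phi>
begin

text \<open>\<open>C = F / I\<close> is the tensor product \<open>K \<otimes>\<^sub>R \<Lambda>\<close>, where \<open>F\<close> is the free abelian group on
  \<open>B = K \<times> \<Lambda>\<close> and \<open>I\<close> is generated by the bilinearity relations.\<close>

definition F where "F = tensor_free K \<Lambda>"

definition B where "B = carrier K \<times> carrier \<Lambda>"

definition I where "I = generate (add_monoid F) (tensor_relations R K \<Lambda> \<iota> \<phi>)"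

definition C where "C = tensor_algebra R K \<Lambda> \<iota> \<phi>"

lemma C_eq: "C = F Quot I"
  by (simp add: C_def F_def I_def tensor_algebra_def)

text \<open>The componentwise product on \<open>B\<close>, of which the product on \<open>F\<close> is the biadditive extension.\<close>

definition pm where "pm p q = (fst p \<otimes>\<^bsub>K\<^esub> fst q, snd p \<otimes>\<^bsub>\<Lambda>\<^esub> snd q)"

lemma F_simps:
  "u \<in> carrier F \<longleftrightarrow> Poly_Mapping.keys u \<subseteq> B" "\<zero>\<^bsub>F\<^esub> = 0" "u \<oplus>\<^bsub>F\<^esub> v = u + v"
  "\<one>\<^bsub>F\<^esub> = frag_of (\<one>\<^bsub>K\<^esub>, \<one>\<^bsub>\<Lambda>\<^esub>)"
  "u \<otimes>\<^bsub>F\<^esub> v = frag_extend (\<lambda>p. frag_extend (\<lambda>q. frag_of (pm p q)) v) u"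
  by (simp_all add: F_def B_def tensor_free_def pm_def case_prod_beta')

lemma mult_frag_of: "frag_of p \<otimes>\<^bsub>F\<^esub> frag_of q = frag_of (pm p q)"
  by (simp add: F_simps)

lemma mult_diff:
  "(u - v) \<otimes>\<^bsub>F\<^esub> w = u \<otimes>\<^bsub>F\<^esub> w - v \<otimes>\<^bsub>F\<^esub> w" "u \<otimes>\<^bsub>F\<^esub> (v - w) = u \<otimes>\<^bsub>F\<^esub> v - u \<otimes>\<^bsub>F\<^esub> w"
  by (simp_all add: F_simps frag_extend_diff frag_extend_diff_fun)

lemma mult_add:
  "(u + v) \<otimes>\<^bsub>F\<^esub> w = u \<otimes>\<^bsub>F\<^esub> w + v \<otimes>\<^bsub>F\<^esub> w" "u \<otimes>\<^bsub>F\<^esub> (v + w) = u \<otimes>\<^bsub>F\<^esub> v + u \<otimes>\<^bsub>F\<^esub> w"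
  by (simp_all add: F_simps frag_extend_add frag_extend_add_fun)

lemma mult_zero: "0 \<otimes>\<^bsub>F\<^esub> w = 0" "w \<otimes>\<^bsub>F\<^esub> 0 = 0"
  using mult_diff(1)[of 0 0 w] mult_diff(2)[of w 0 0] by auto

lemma pm_closed: "\<lbrakk>p \<in> B; q \<in> B\<rbrakk> \<Longrightarrow> pm p q \<in> B"
  by (auto simp: B_def pm_def)

lemma frag_of_B: "p \<in> B \<Longrightarrow> frag_of p \<in> carrier F"
  by (simp add: F_simps)

lemma diff_closed: "\<lbrakk>u \<in> carrier F; v \<in> carrier F\<rbrakk> \<Longrightarrow> u - v \<in> carrier F"
  unfolding F_simps using keys_diff[of u v] by blast

lemma zero_closed: "0 \<in> carrier F"
  by (simp add: F_simps)

lemma F_induct [consumes 1, case_names zero frag diff]: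
  assumes "u \<in> carrier F" "P 0" "\<And>p. p \<in> B \<Longrightarrow> P (frag_of p)"
    "\<And>u v. \<lbrakk>u \<in> carrier F; v \<in> carrier F; P u; P v\<rbrakk> \<Longrightarrow> P (u - v)"
  shows "P u"
  using assms(1) unfolding F_simps
  by (rule free_Abelian_group_induct) (use assms in \<open>auto simp: F_simps\<close>)

lemma mult_closed:
  assumes "u \<in> carrier F" "v \<in> carrier F"
  shows "u \<otimes>\<^bsub>F\<^esub> v \<in> carrier F"
  using assms(1)
proof (induction u rule: F_induct)
  case (frag p)
  show ?case
    using assms(2)
    by (induction v rule: F_induct)
      (auto simp: mult_diff mult_zero mult_frag_of diff_closed pm_closed frag frag_of_B zero_closed)
qed (auto simp: mult_diff mult_zero diff_closed zero_closed)

lemma ring_F: "ring F"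
proof (rule ringI)
  show "abelian_group F"
  proof (rule abelian_groupI)
    fix u v assume u: "u \<in> carrier F" and v: "v \<in> carrier F"
    show "u \<oplus>\<^bsub>F\<^esub> v \<in> carrier F"
      using keys_add[of u v] u v unfolding F_simps by blast
    show "\<exists>v\<in>carrier F. v \<oplus>\<^bsub>F\<^esub> u = \<zero>\<^bsub>F\<^esub>"
      using diff_closed[of 0 u] u by (intro bexI[of _ "-u"]) (auto simp: F_simps)
  qed (auto simp: F_simps algebra_simps)
  show "monoid F"
  proof
    show "\<one>\<^bsub>F\<^esub> \<in> carrier F" by (simp add: F_simps B_def)
    fix u assume u: "u \<in> carrier F"
    show "\<one>\<^bsub>F\<^esub> \<otimes>\<^bsub>F\<^esub> u = u"
      using u by (induction u rule: F_induct)
        (auto simp: mult_diff mult_zero mult_frag_of F_simps(4), auto simp: pm_def B_def)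
    show "u \<otimes>\<^bsub>F\<^esub> \<one>\<^bsub>F\<^esub> = u"
      using u by (induction u rule: F_induct)
        (auto simp: mult_diff mult_zero mult_frag_of F_simps(4), auto simp: pm_def B_def)
    fix v assume v: "v \<in> carrier F"
    show "u \<otimes>\<^bsub>F\<^esub> v \<in> carrier F" by (rule mult_closed[OF u v])
    fix w assume w: "w \<in> carrier F"
    have pm: "pm (pm p q) r = pm p (pm q r)" if "p \<in> B" "q \<in> B" "r \<in> B" for p q r
      using that by (auto simp: pm_def B_def frac.S.m_assoc alg.S.m_assoc)
    show "u \<otimes>\<^bsub>F\<^esub> v \<otimes>\<^bsub>F\<^esub> w = u \<otimes>\<^bsub>F\<^esub> (v \<otimes>\<^bsub>F\<^esub> w)"
      using u
    proof (induction u rule: F_induct)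
      case (frag p)
      note p = this
      show ?case
        using v
      proof (induction v rule: F_induct)
        case (frag q)
        show ?case
          using w by (induction w rule: F_induct)
            (auto simp: mult_diff mult_zero mult_frag_of pm[OF p frag])
      qed (auto simp: mult_diff mult_zero)
    qed (auto simp: mult_diff mult_zero)
  qed
qed (simp_all add: F_simps(3) mult_add)

sublocale F: ring F by (rule ring_F)

lemma uminus_F: "u \<in> carrier F \<Longrightarrow> \<ominus>\<^bsub>F\<^esub> u = - u"
  using diff_closed[of 0 u] by (intro F.minus_equality) (auto simp: F_simps)

lemma relations_subset: "tensor_relations R K \<Lambda> \<iota> \<phi> \<subseteq> carrier F"
  unfolding tensor_relations_def
  by (auto intro!: diff_closed simp: F_simps(1) B_def)

lemma subgroup_I: "subgroup I (add_monoid F)"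
  unfolding I_def using relations_subset by (intro F.add.generate_is_subgroup) simp

lemma I_subset: "u \<in> I \<Longrightarrow> u \<in> carrier F"
  using subgroup.mem_carrier[OF subgroup_I] by simp

lemma I_zero: "0 \<in> I"
  using subgroup.one_closed[OF subgroup_I] by (simp add: F_simps)

lemma I_diff: "\<lbrakk>u \<in> I; v \<in> I\<rbrakk> \<Longrightarrow> u - v \<in> I"
  using subgroup.m_closed[OF subgroup_I, of u "\<ominus>\<^bsub>F\<^esub> v"] subgroup.m_inv_closed[OF subgroup_I, of v]
    uminus_F[OF I_subset, of v] by (simp add: F_simps a_inv_def)

lemma I_induct [consumes 1, case_names zero rel diff]:
  assumes "u \<in> I" "P 0" "\<And>u. u \<in> tensor_relations R K \<Lambda> \<iota> \<phi> \<Longrightarrow> P u"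
    "\<And>u v. \<lbrakk>u \<in> I; v \<in> I; P u; P v\<rbrakk> \<Longrightarrow> P (u - v)"
  shows "P u"
proof -
  have neg: "P (- u) \<and> - u \<in> I" if "u \<in> I" "P u" for u
    using assms(4)[OF I_zero that(1) assms(2) that(2)] I_diff[OF I_zero that(1)] by simp
  have incl: "h \<in> I" if "h \<in> tensor_relations R K \<Lambda> \<iota> \<phi>" for h
    unfolding I_def using that by (rule generate.incl)
  have "P u \<and> u \<in> I"
    using assms(1)[unfolded I_def]
  proof (induction rule: generate.induct)
    case one
    then show ?case using assms(2) I_zero by (simp add: F_simps)
  next
    case (incl h)
    then show ?case using assms(3) \<open>\<And>h. h \<in> tensor_relations R K \<Lambda> \<iota> \<phi> \<Longrightarrow> h \<in> I\<close> by blast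
  next
    case (inv h)
    have "inv\<^bsub>add_monoid F\<^esub> h = - h"
      using uminus_F[of h] inv relations_subset by (auto simp: a_inv_def)
    then show ?case using neg[of h] assms(3)[OF inv] incl[OF inv] by simp
  next
    case (eng u v)
    have "u - (- v) \<in> I" "P (u - (- v))"
      using eng.IH neg[of v] I_diff[of u "-v"] assms(4)[of u "- v"] by auto
    then show ?case by (simp add: F_simps)
  qed
  then show ?thesis ..
qed

lemma relation_cases:
  assumes "u \<in> tensor_relations R K \<Lambda> \<iota> \<phi>"
  obtains (left) b b' c where "b \<in> carrier K" "b' \<in> carrier K" "c \<in> carrier \<Lambda>"
      "u = frag_of (b \<oplus>\<^bsub>K\<^esub> b', c) - frag_of (b, c) - frag_of (b', c)"
    | (right) b c c' where "b \<in> carrier K" "c \<in> carrier \<Lambda>" "c' \<in> carrier \<Lambda>"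
      "u = frag_of (b, c \<oplus>\<^bsub>\<Lambda>\<^esub> c') - frag_of (b, c) - frag_of (b, c')"
    | (base) r b c where "r \<in> carrier R" "b \<in> carrier K" "c \<in> carrier \<Lambda>"
      "u = frag_of (\<iota> r \<otimes>\<^bsub>K\<^esub> b, c) - frag_of (b, \<phi> r \<otimes>\<^bsub>\<Lambda>\<^esub> c)"
  using assms unfolding tensor_relations_def
  by (elim UnE CollectE exE conjE) (rule left right base; assumption)+

lemma I_relations:
  "\<lbrakk>b \<in> carrier K; b' \<in> carrier K; c \<in> carrier \<Lambda>\<rbrakk> \<Longrightarrow>
    frag_of (b \<oplus>\<^bsub>K\<^esub> b', c) - frag_of (b, c) - frag_of (b', c) \<in> I"
  "\<lbrakk>b \<in> carrier K; c \<in> carrier \<Lambda>; c' \<in> carrier \<Lambda>\<rbrakk> \<Longrightarrow>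
    frag_of (b, c \<oplus>\<^bsub>\<Lambda>\<^esub> c') - frag_of (b, c) - frag_of (b, c') \<in> I"
  "\<lbrakk>r \<in> carrier R; b \<in> carrier K; c \<in> carrier \<Lambda>\<rbrakk> \<Longrightarrow>
    frag_of (\<iota> r \<otimes>\<^bsub>K\<^esub> b, c) - frag_of (b, \<phi> r \<otimes>\<^bsub>\<Lambda>\<^esub> c) \<in> I"
  unfolding I_def tensor_relations_def by (rule generate.incl; blast)+

text \<open>The relations are stable under multiplication by elements of \<open>B\<close>; for the third kind this uses that
  \<open>\<phi>\<close> has central image.\<close>

lemma relation_mult_frag:
  assumes u: "u \<in> tensor_relations R K \<Lambda> \<iota> \<phi>" and p: "p \<in> B"
  shows "frag_of p \<otimes>\<^bsub>F\<^esub> u \<in> I" "u \<otimes>\<^bsub>F\<^esub> frag_of p \<in> I"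
proof -
  obtain k l where p: "p = (k, l)" "k \<in> carrier K" "l \<in> carrier \<Lambda>" using p by (auto simp: B_def)
  show "frag_of p \<otimes>\<^bsub>F\<^esub> u \<in> I"
    using u
  proof (cases rule: relation_cases)
    case (left b b' c)
    then show ?thesis
      using I_relations(1)[of "k \<otimes>\<^bsub>K\<^esub> b" "k \<otimes>\<^bsub>K\<^esub> b'" "l \<otimes>\<^bsub>\<Lambda>\<^esub> c"] p
      by (simp add: mult_diff mult_frag_of pm_def frac.S.r_distr)
  next
    case (right b c c')
    then show ?thesis
      using I_relations(2)[of "k \<otimes>\<^bsub>K\<^esub> b" "l \<otimes>\<^bsub>\<Lambda>\<^esub> c" "l \<otimes>\<^bsub>\<Lambda>\<^esub> c'"] p
      by (simp add: mult_diff mult_frag_of pm_def alg.S.r_distr)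
  next
    case (base r b c)
    have "k \<otimes>\<^bsub>K\<^esub> (\<iota> r \<otimes>\<^bsub>K\<^esub> b) = \<iota> r \<otimes>\<^bsub>K\<^esub> (k \<otimes>\<^bsub>K\<^esub> b)"
      using base p by (simp add: frac.K.m_lcomm)
    moreover have "l \<otimes>\<^bsub>\<Lambda>\<^esub> (\<phi> r \<otimes>\<^bsub>\<Lambda>\<^esub> c) = \<phi> r \<otimes>\<^bsub>\<Lambda>\<^esub> (l \<otimes>\<^bsub>\<Lambda>\<^esub> c)"
      using base p alg.central[of r l] by (simp add: alg.S.m_assoc[symmetric])
    ultimately show ?thesis
      using I_relations(3)[of r "k \<otimes>\<^bsub>K\<^esub> b" "l \<otimes>\<^bsub>\<Lambda>\<^esub> c"] p base
      by (simp add: mult_diff mult_frag_of pm_def)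
  qed
  show "u \<otimes>\<^bsub>F\<^esub> frag_of p \<in> I"
    using u
  proof (cases rule: relation_cases)
    case (left b b' c)
    then show ?thesis
      using I_relations(1)[of "b \<otimes>\<^bsub>K\<^esub> k" "b' \<otimes>\<^bsub>K\<^esub> k" "c \<otimes>\<^bsub>\<Lambda>\<^esub> l"] p
      by (simp add: mult_diff mult_frag_of pm_def frac.S.l_distr)
  next
    case (right b c c')
    then show ?thesis
      using I_relations(2)[of "b \<otimes>\<^bsub>K\<^esub> k" "c \<otimes>\<^bsub>\<Lambda>\<^esub> l" "c' \<otimes>\<^bsub>\<Lambda>\<^esub> l"] p
      by (simp add: mult_diff mult_frag_of pm_def alg.S.l_distr)
  next
    case (base r b c)
    then show ?thesis
      using I_relations(3)[of r "b \<otimes>\<^bsub>K\<^esub> k" "c \<otimes>\<^bsub>\<Lambda>\<^esub> l"] p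
      by (simp add: mult_diff mult_frag_of pm_def frac.S.m_assoc alg.S.m_assoc)
  qed
qed

lemma ideal_I: "ideal I F"
proof (rule idealI[OF ring_F subgroup_I])
  fix u x assume u: "u \<in> I" and x: "x \<in> carrier F"
  show "x \<otimes>\<^bsub>F\<^esub> u \<in> I"
    using x
  proof (induction x rule: F_induct)
    case (frag p)
    show ?case using u
      by (induction u rule: I_induct) (auto simp: mult_zero mult_diff I_zero I_diff relation_mult_frag frag)
  qed (auto simp: mult_zero mult_diff I_zero I_diff)
  show "u \<otimes>\<^bsub>F\<^esub> x \<in> I"
    using x
  proof (induction x rule: F_induct)
    case (frag p)
    show ?case using u
      by (induction u rule: I_induct) (auto simp: mult_zero mult_diff I_zero I_diff relation_mult_frag frag)
  qed (auto simp: mult_zero mult_diff I_zero I_diff)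
qed

text \<open>The projection \<open>F \<rightarrow> C\<close>.\<close>

definition cls where "cls u = I +>\<^bsub>F\<^esub> u"

lemma cls_hom: "ring_hom_ring F C cls"
  using ideal.rcos_ring_hom_ring[OF ideal_I] unfolding C_eq cls_def[abs_def] .

sublocale cls: ring_hom_ring F C cls by (rule cls_hom)

lemma cls_surj: "cls ` carrier F = carrier C"
  by (auto simp: C_eq FactRing_def A_RCOSETS_def' cls_def)

lemma cls_eq_iff:
  assumes "u \<in> carrier F" "v \<in> carrier F"
  shows "cls u = cls v \<longleftrightarrow> u - v \<in> I"
proof -
  have "u \<ominus>\<^bsub>F\<^esub> v = u - v" using uminus_F[OF assms(2)] by (simp add: a_minus_def F_simps)
  then show ?thesis
    unfolding cls_def using F.quotient_eq_iff_same_a_r_cos[OF ideal_I assms] by metis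
qed

text \<open>The pure tensor \<open>k \<otimes> l\<close>.\<close>

definition cf where "cf k l = cls (frag_of (k, l))"

lemma cf_closed: "\<lbrakk>k \<in> carrier K; l \<in> carrier \<Lambda>\<rbrakk> \<Longrightarrow> cf k l \<in> carrier C"
  unfolding cf_def using frag_of_B by (simp add: B_def)

lemma cls_add: "\<lbrakk>u \<in> carrier F; v \<in> carrier F\<rbrakk> \<Longrightarrow> cls (u + v) = cls u \<oplus>\<^bsub>C\<^esub> cls v"
  using cls.hom_add[of u v] by (simp add: F_simps)

lemma cf_mult:
  assumes "k \<in> carrier K" "l \<in> carrier \<Lambda>" "k' \<in> carrier K" "l' \<in> carrier \<Lambda>"
  shows "cf k l \<otimes>\<^bsub>C\<^esub> cf k' l' = cf (k \<otimes>\<^bsub>K\<^esub> k') (l \<otimes>\<^bsub>\<Lambda>\<^esub> l')"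
  using cls.hom_mult[of "frag_of (k, l)" "frag_of (k', l')"] frag_of_B assms
  by (simp add: cf_def mult_frag_of pm_def B_def)

lemma cf_one: "cf \<one>\<^bsub>K\<^esub> \<one>\<^bsub>\<Lambda>\<^esub> = \<one>\<^bsub>C\<^esub>"
  using cls.hom_one by (simp add: cf_def F_simps)

lemma cf_add:
  assumes "k \<in> carrier K" "l \<in> carrier \<Lambda>" "l' \<in> carrier \<Lambda>"
  shows "cf k (l \<oplus>\<^bsub>\<Lambda>\<^esub> l') = cf k l \<oplus>\<^bsub>C\<^esub> cf k l'"
proof -
  have c: "frag_of (k, l) \<in> carrier F" "frag_of (k, l') \<in> carrier F" "frag_of (k, l \<oplus>\<^bsub>\<Lambda>\<^esub> l') \<in> carrier F"
    using assms by (auto intro!: frag_of_B simp: B_def)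
  have "cls (frag_of (k, l \<oplus>\<^bsub>\<Lambda>\<^esub> l')) = cls (frag_of (k, l) + frag_of (k, l'))"
    using I_relations(2)[OF assms] c F.a_closed[OF c(1,2)]
    by (subst cls_eq_iff) (auto simp: F_simps algebra_simps)
  then show ?thesis using cls_add[OF c(1,2)] by (simp add: cf_def)
qed

lemma cf_base:
  assumes "r \<in> carrier R" "k \<in> carrier K" "l \<in> carrier \<Lambda>"
  shows "cf (\<iota> r \<otimes>\<^bsub>K\<^esub> k) l = cf k (\<phi> r \<otimes>\<^bsub>\<Lambda>\<^esub> l)"
  unfolding cf_def using I_relations(3)[OF assms] assms
  by (subst cls_eq_iff) (auto intro!: frag_of_B simp: B_def)

text \<open>The structure map \<open>\<Lambda> \<rightarrow> K \<otimes>\<^sub>R \<Lambda>\<close>.\<close>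

definition \<psi> where "\<psi> l = cf \<one>\<^bsub>K\<^esub> l"

lemma \<psi>_hom: "ring_hom_ring \<Lambda> C \<psi>"
  by (rule ring_hom_ringI)
    (auto simp: \<psi>_def cf_mult cf_one cf_add cf_closed alg.S.ring_axioms cls.S.ring_axioms)

lemma \<psi>_\<phi>: "r \<in> carrier R \<Longrightarrow> \<psi> (\<phi> r) = cf (\<iota> r) \<one>\<^bsub>\<Lambda>\<^esub>"
  using cf_base[of r "\<one>\<^bsub>K\<^esub>" "\<one>\<^bsub>\<Lambda>\<^esub>"] by (simp add: \<psi>_def)

lemma \<iota>_nonzero: "r \<in> carrier R - {\<zero>} \<Longrightarrow> \<iota> r \<in> carrier K - {\<zero>\<^bsub>K\<^esub>}"
  using inj_onD[OF frac.inj, of r \<zero>] by auto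

lemma fraction_obtain:
  assumes "k \<in> carrier K"
  obtains a b where "a \<in> carrier R" "b \<in> carrier R - {\<zero>}" "\<iota> a = k \<otimes>\<^bsub>K\<^esub> \<iota> b"
proof -
  obtain a b where ab: "a \<in> carrier R" "b \<in> carrier R - {\<zero>}" "k = \<iota> a \<otimes>\<^bsub>K\<^esub> inv\<^bsub>K\<^esub> \<iota> b"
    using frac.fraction[OF assms] by blast
  have "\<iota> b \<in> Units K" using \<iota>_nonzero[OF ab(2)] frac.K.field_Units by simp
  then have "k \<otimes>\<^bsub>K\<^esub> \<iota> b = \<iota> a" using ab by (simp add: frac.S.m_assoc)
  then show ?thesis using that ab by metis
qed

text \<open>The inverse of \<open>1 \<otimes> r\<close> is \<open>r\<^sup>-\<^sup>1 \<otimes> 1\<close>, and \<open>(1 \<otimes> b) (a / b \<otimes> l) = 1 \<otimes> a l\<close>; denominators of sums are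
  multiplied.\<close>

sublocale loc: base_localization R \<Lambda> \<phi> C \<psi>
proof (intro base_localization.intro base_localization_axioms.intro)
  show "module_finite_algebra R \<Lambda> \<phi>" by (rule alg.module_finite_algebra_axioms)
  show "domain R" by (rule frac.domain_axioms)
  show h: "ring_hom_ring \<Lambda> C \<psi>" by (rule \<psi>_hom)
  then interpret \<psi>: ring_hom_ring \<Lambda> C \<psi> .
  {
    fix r assume r: "r \<in> carrier R - {\<zero>}"
    have u: "\<iota> r \<in> Units K" using \<iota>_nonzero[OF r] frac.K.field_Units by simp
    then have "cf (inv\<^bsub>K\<^esub> \<iota> r) \<one>\<^bsub>\<Lambda>\<^esub> \<otimes>\<^bsub>C\<^esub> \<psi> (\<phi> r) = \<one>\<^bsub>C\<^esub>" "\<psi> (\<phi> r) \<otimes>\<^bsub>C\<^esub> cf (inv\<^bsub>K\<^esub> \<iota> r) \<one>\<^bsub>\<Lambda>\<^esub> = \<one>\<^bsub>C\<^esub>"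
      using r by (simp_all add: \<psi>_\<phi> cf_mult cf_one)
    then show "\<exists>c\<in>carrier C. c \<otimes>\<^bsub>C\<^esub> \<psi> (\<phi> r) = \<one>\<^bsub>C\<^esub> \<and> \<psi> (\<phi> r) \<otimes>\<^bsub>C\<^esub> c = \<one>\<^bsub>C\<^esub>"
      using cf_closed[of "inv\<^bsub>K\<^esub> \<iota> r" "\<one>\<^bsub>\<Lambda>\<^esub>"] u by auto
  }
  fix c assume "c \<in> carrier C"
  then obtain u where u: "u \<in> carrier F" "c = cls u" unfolding cls_surj[symmetric] by blast
  have "\<exists>r\<in>carrier R - {\<zero>}. \<exists>a\<in>carrier \<Lambda>. \<psi> (\<phi> r) \<otimes>\<^bsub>C\<^esub> cls u = \<psi> a"
    using u(1)
  proof (induction u rule: F_induct)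
    case zero
    have "cls 0 = \<zero>\<^bsub>C\<^esub>" using cls.hom_zero by (simp add: F_simps)
    then show ?case by (intro bexI[of _ \<one>] bexI[of _ "\<zero>\<^bsub>\<Lambda>\<^esub>"]) auto
  next
    case (frag p)
    then obtain k l where p: "p = (k, l)" "k \<in> carrier K" "l \<in> carrier \<Lambda>" by (auto simp: B_def)
    obtain a b where ab: "a \<in> carrier R" "b \<in> carrier R - {\<zero>}" "\<iota> a = k \<otimes>\<^bsub>K\<^esub> \<iota> b"
      by (rule fraction_obtain[OF p(2)])
    have "\<psi> (\<phi> b) \<otimes>\<^bsub>C\<^esub> cls (frag_of p) = cf (\<iota> b \<otimes>\<^bsub>K\<^esub> k) l"
      using ab p by (simp add: \<psi>_\<phi> cf_def[symmetric] cf_mult)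
    also have "\<iota> b \<otimes>\<^bsub>K\<^esub> k = \<iota> a \<otimes>\<^bsub>K\<^esub> \<one>\<^bsub>K\<^esub>" using ab p by (simp add: frac.K.m_comm)
    also have "cf (\<iota> a \<otimes>\<^bsub>K\<^esub> \<one>\<^bsub>K\<^esub>) l = \<psi> (\<phi> a \<otimes>\<^bsub>\<Lambda>\<^esub> l)"
      unfolding \<psi>_def using ab p by (intro cf_base) auto
    finally show ?case using ab p by (intro bexI[of _ b] bexI[of _ "\<phi> a \<otimes>\<^bsub>\<Lambda>\<^esub> l"]) auto
  next
    case (diff u v)
    then obtain r a s b where r: "r \<in> carrier R - {\<zero>}" "a \<in> carrier \<Lambda>" "\<psi> (\<phi> r) \<otimes>\<^bsub>C\<^esub> cls u = \<psi> a"
      and s: "s \<in> carrier R - {\<zero>}" "b \<in> carrier \<Lambda>" "\<psi> (\<phi> s) \<otimes>\<^bsub>C\<^esub> cls v = \<psi> b" by blast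
    have c: "cls u \<in> carrier C" "cls v \<in> carrier C" "\<psi> (\<phi> r) \<in> carrier C" "\<psi> (\<phi> s) \<in> carrier C"
      using diff r s by auto
    have uv: "cls (u - v) = cls u \<oplus>\<^bsub>C\<^esub> (\<ominus>\<^bsub>C\<^esub> cls v)"
    proof -
      have "u - v = u \<oplus>\<^bsub>F\<^esub> \<ominus>\<^bsub>F\<^esub> v" using uminus_F[of v] diff by (simp add: F_simps)
      then show ?thesis using diff by simp
    qed
    have "\<phi> r \<otimes>\<^bsub>\<Lambda>\<^esub> \<phi> s = \<phi> s \<otimes>\<^bsub>\<Lambda>\<^esub> \<phi> r" using r s by (intro alg.central) auto
    then have comm: "\<psi> (\<phi> r) \<otimes>\<^bsub>C\<^esub> \<psi> (\<phi> s) = \<psi> (\<phi> s) \<otimes>\<^bsub>C\<^esub> \<psi> (\<phi> r)"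
      using r s \<psi>.hom_mult[of "\<phi> r" "\<phi> s"] \<psi>.hom_mult[of "\<phi> s" "\<phi> r"] by simp
    have "\<psi> (\<phi> (s \<otimes> r)) \<otimes>\<^bsub>C\<^esub> cls (u - v) = \<psi> (\<phi> s) \<otimes>\<^bsub>C\<^esub> \<psi> (\<phi> r) \<otimes>\<^bsub>C\<^esub> cls u \<oplus>\<^bsub>C\<^esub>
        \<ominus>\<^bsub>C\<^esub> (\<psi> (\<phi> r) \<otimes>\<^bsub>C\<^esub> \<psi> (\<phi> s) \<otimes>\<^bsub>C\<^esub> cls v)"
      using r s c by (simp add: uv cls.S.r_distr cls.S.r_minus comm)
    also have "\<dots> = \<psi> (\<phi> s) \<otimes>\<^bsub>C\<^esub> \<psi> a \<oplus>\<^bsub>C\<^esub> \<ominus>\<^bsub>C\<^esub> (\<psi> (\<phi> r) \<otimes>\<^bsub>C\<^esub> \<psi> b)"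
      using r s c by (simp add: cls.S.m_assoc)
    also have "\<dots> = \<psi> (\<phi> s \<otimes>\<^bsub>\<Lambda>\<^esub> a \<oplus>\<^bsub>\<Lambda>\<^esub> \<ominus>\<^bsub>\<Lambda>\<^esub> (\<phi> r \<otimes>\<^bsub>\<Lambda>\<^esub> b))"
      using r s by simp
    finally show ?case
      using r s frac.integral_iff[of s r]
      by (intro bexI[of _ "s \<otimes> r"] bexI[of _ "\<phi> s \<otimes>\<^bsub>\<Lambda>\<^esub> a \<oplus>\<^bsub>\<Lambda>\<^esub> \<ominus>\<^bsub>\<Lambda>\<^esub> (\<phi> r \<otimes>\<^bsub>\<Lambda>\<^esub> b)"]) auto
  qed
  then show "\<exists>r\<in>carrier R - {\<zero>}. \<exists>a\<in>carrier \<Lambda>. \<psi> (\<phi> r) \<otimes>\<^bsub>C\<^esub> c = \<psi> a" using u by simp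
qed

end

text \<open>A \<open>\<Lambda>\<close>-module on which the nonzero elements of \<open>R\<close> act bijectively is a module over
  \<open>K \<otimes>\<^sub>R \<Lambda>\<close>: the free abelian group on \<open>K \<times> \<Lambda>\<close> acts on it by \<open>(a / b, l) v = b\<^sup>-\<^sup>1 a l v\<close>, and the
  relations act by zero.\<close>

lemma (in fraction_algebra) tensor_module_exists:
  fixes V :: "('l, 'g, 'z) module_scheme"
  assumes V: "left_module \<Lambda> V"
    and inj: "\<And>r v. \<lbrakk>r \<in> carrier R - {\<zero>}; v \<in> carrier V; \<phi> r \<odot>\<^bsub>V\<^esub> v = \<zero>\<^bsub>V\<^esub>\<rbrakk> \<Longrightarrow> v = \<zero>\<^bsub>V\<^esub>"
    and surj: "\<And>r v. \<lbrakk>r \<in> carrier R - {\<zero>}; v \<in> carrier V\<rbrakk> \<Longrightarrow> \<exists>w\<in>carrier V. \<phi> r \<odot>\<^bsub>V\<^esub> w = v"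
  obtains N :: "(('k \<times> 'l \<Rightarrow>\<^sub>0 int) set, 'g) module" where "left_module C N" "carrier N = carrier V"
    "\<zero>\<^bsub>N\<^esub> = \<zero>\<^bsub>V\<^esub>" "(\<lambda>x. x) \<in> module_hom \<Lambda> V (restrict_scalars \<psi> N)"
proof -
  interpret V: left_module \<Lambda> V by fact
  note [simp] = V.smult_closed
  have scale_cancel: "w = w'" if b: "b \<in> carrier R - {\<zero>}" and w: "w \<in> carrier V" "w' \<in> carrier V" "\<phi> b \<odot>\<^bsub>V\<^esub> w = \<phi> b \<odot>\<^bsub>V\<^esub> w'"
    for b w w'
  proof -
    have "b \<in> carrier R" using b by simp
    from module_hom_diff_in_kernel[OF V V module_hom_central_smult[OF alg.module_finite_algebra_axioms V this] w]
    obtain z where "z \<in> carrier V" "\<phi> b \<odot>\<^bsub>V\<^esub> z = \<zero>\<^bsub>V\<^esub>" "w = w' \<oplus>\<^bsub>V\<^esub> z" by blast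
    then show ?thesis using inj[OF b] w by simp
  qed
  have \<phi>_mult: "\<phi> (r \<otimes> s) \<odot>\<^bsub>V\<^esub> x = \<phi> r \<odot>\<^bsub>V\<^esub> (\<phi> s \<odot>\<^bsub>V\<^esub> x)"
    if "r \<in> carrier R" "s \<in> carrier R" "x \<in> carrier V" for r s x
    using that by (simp add: V.smult_assoc1)
  have \<phi>_comm: "\<phi> r \<odot>\<^bsub>V\<^esub> (a \<odot>\<^bsub>V\<^esub> x) = a \<odot>\<^bsub>V\<^esub> (\<phi> r \<odot>\<^bsub>V\<^esub> x)"
    if "r \<in> carrier R" "a \<in> carrier \<Lambda>" "x \<in> carrier V" for r a x
    using that alg.central[of r a] by (simp add: V.smult_assoc1[symmetric])
  \<comment> \<open>\<open>w = k v\<close>, as computed with some representation \<open>k = a / b\<close>\<close>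
  define quot where "quot k v w \<longleftrightarrow> w \<in> carrier V \<and>
    (\<exists>a\<in>carrier R. \<exists>b\<in>carrier R - {\<zero>}. \<iota> a = k \<otimes>\<^bsub>K\<^esub> \<iota> b \<and> \<phi> b \<odot>\<^bsub>V\<^esub> w = \<phi> a \<odot>\<^bsub>V\<^esub> v)" for k v w
  define sc where "sc k v = (THE w. quot k v w)" for k v
  have quot_unique: "w = w'" if k: "k \<in> carrier K" and v: "v \<in> carrier V" and q: "quot k v w" "quot k v w'" for k v w w'
  proof -
    obtain a b where ab: "a \<in> carrier R" "b \<in> carrier R - {\<zero>}" "\<iota> a = k \<otimes>\<^bsub>K\<^esub> \<iota> b" "\<phi> b \<odot>\<^bsub>V\<^esub> w = \<phi> a \<odot>\<^bsub>V\<^esub> v"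
      using q(1) unfolding quot_def by blast
    obtain a' b' where ab': "a' \<in> carrier R" "b' \<in> carrier R - {\<zero>}" "\<iota> a' = k \<otimes>\<^bsub>K\<^esub> \<iota> b'" "\<phi> b' \<odot>\<^bsub>V\<^esub> w' = \<phi> a' \<odot>\<^bsub>V\<^esub> v"
      using q(2) unfolding quot_def by blast
    have w: "w \<in> carrier V" "w' \<in> carrier V" using q unfolding quot_def by blast+
    have bR: "b \<in> carrier R" "b' \<in> carrier R" using ab ab' by auto
    have "\<iota> (b' \<otimes> a) = \<iota> (b \<otimes> a')"
      using ab(1,3) ab'(1,3) bR k by (simp add: frac.K.m_comm frac.K.m_lcomm frac.S.m_assoc)
    then have eq: "b' \<otimes> a = b \<otimes> a'" using inj_onD[OF frac.inj] ab ab' bR by simp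
    have "\<phi> (b' \<otimes> b) \<odot>\<^bsub>V\<^esub> w = \<phi> (b' \<otimes> a) \<odot>\<^bsub>V\<^esub> v"
      using \<phi>_mult[OF bR(2,1) w(1)] \<phi>_mult[OF bR(2) ab(1) v] ab(4) by simp
    also have "\<dots> = \<phi> (b \<otimes> b') \<odot>\<^bsub>V\<^esub> w'"
      unfolding eq using \<phi>_mult[OF bR(1,2) w(2)] \<phi>_mult[OF bR(1) ab'(1) v] ab'(4) by simp
    also have "b \<otimes> b' = b' \<otimes> b" using bR by (rule frac.m_comm)
    finally show ?thesis by (rule scale_cancel[OF loc.nonzero_mult[OF ab'(2) ab(2)] w])
  qed
  have sc_eqI: "sc k v = w" if "k \<in> carrier K" "v \<in> carrier V" "w \<in> carrier V" "a \<in> carrier R" "b \<in> carrier R - {\<zero>}"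
    "\<iota> a = k \<otimes>\<^bsub>K\<^esub> \<iota> b" "\<phi> b \<odot>\<^bsub>V\<^esub> w = \<phi> a \<odot>\<^bsub>V\<^esub> v" for k v w a b
  proof -
    have "quot k v w" using that unfolding quot_def by blast
    then show ?thesis unfolding sc_def using quot_unique[OF that(1,2)] by (intro the_equality) blast+
  qed
  have sc: "sc k v \<in> carrier V" "\<phi> b \<odot>\<^bsub>V\<^esub> sc k v = \<phi> a \<odot>\<^bsub>V\<^esub> v"
    if kv: "k \<in> carrier K" "v \<in> carrier V" "a \<in> carrier R" "b \<in> carrier R - {\<zero>}" "\<iota> a = k \<otimes>\<^bsub>K\<^esub> \<iota> b" for k v a b
  proof -
    have "\<phi> a \<odot>\<^bsub>V\<^esub> v \<in> carrier V" using kv by simp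
    then obtain w where "w \<in> carrier V" "\<phi> b \<odot>\<^bsub>V\<^esub> w = \<phi> a \<odot>\<^bsub>V\<^esub> v" using surj[OF kv(4)] by blast
    moreover from this have "sc k v = w" using sc_eqI[OF kv(1,2) _ kv(3,4,5)] by blast
    ultimately show "sc k v \<in> carrier V" "\<phi> b \<odot>\<^bsub>V\<^esub> sc k v = \<phi> a \<odot>\<^bsub>V\<^esub> v" by auto
  qed
  have sc_closed[simp]: "sc k v \<in> carrier V" if "k \<in> carrier K" "v \<in> carrier V" for k v
    using fraction_obtain[OF that(1)] sc(1)[OF that] by metis
  have sc_add: "sc k (v \<oplus>\<^bsub>V\<^esub> w) = sc k v \<oplus>\<^bsub>V\<^esub> sc k w" if k: "k \<in> carrier K" "v \<in> carrier V" "w \<in> carrier V" for k v w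
  proof -
    obtain a b where ab: "a \<in> carrier R" "b \<in> carrier R - {\<zero>}" "\<iota> a = k \<otimes>\<^bsub>K\<^esub> \<iota> b" by (rule fraction_obtain[OF k(1)])
    show ?thesis
      using k ab sc(2)[OF k(1,2) ab] sc(2)[OF k(1,3) ab] by (intro sc_eqI[OF k(1) _ _ ab]) (auto simp: V.smult_r_distr)
  qed
  have sc_smult: "sc k (l \<odot>\<^bsub>V\<^esub> v) = l \<odot>\<^bsub>V\<^esub> sc k v" if k: "k \<in> carrier K" "v \<in> carrier V" and l: "l \<in> carrier \<Lambda>" for k l v
  proof -
    obtain a b where ab: "a \<in> carrier R" "b \<in> carrier R - {\<zero>}" "\<iota> a = k \<otimes>\<^bsub>K\<^esub> \<iota> b" by (rule fraction_obtain[OF k(1)])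
    show ?thesis
      using k l ab sc(2)[OF k ab] by (intro sc_eqI[OF k(1) _ _ ab]) (auto simp: \<phi>_comm)
  qed
  have sc_add_left: "sc (k \<oplus>\<^bsub>K\<^esub> k') v = sc k v \<oplus>\<^bsub>V\<^esub> sc k' v"
    if k: "k \<in> carrier K" "k' \<in> carrier K" and v: "v \<in> carrier V" for k k' v
  proof -
    obtain a b where ab: "a \<in> carrier R" "b \<in> carrier R - {\<zero>}" "\<iota> a = k \<otimes>\<^bsub>K\<^esub> \<iota> b" by (rule fraction_obtain[OF k(1)])
    obtain a' b' where ab': "a' \<in> carrier R" "b' \<in> carrier R - {\<zero>}" "\<iota> a' = k' \<otimes>\<^bsub>K\<^esub> \<iota> b'" by (rule fraction_obtain[OF k(2)])
    have bR: "b \<in> carrier R" "b' \<in> carrier R" using ab ab' by auto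
    note s = sc(2)[OF k(1) v ab] sc(2)[OF k(2) v ab']
    show ?thesis
    proof (rule sc_eqI[of _ _ _ "b' \<otimes> a \<oplus> b \<otimes> a'" "b \<otimes> b'"])
      show "b \<otimes> b' \<in> carrier R - {\<zero>}" by (rule loc.nonzero_mult[OF ab(2) ab'(2)])
      show "\<iota> (b' \<otimes> a \<oplus> b \<otimes> a') = (k \<oplus>\<^bsub>K\<^esub> k') \<otimes>\<^bsub>K\<^esub> \<iota> (b \<otimes> b')"
        using ab ab' bR k frac.S.l_distr[of k k' "\<iota> b \<otimes>\<^bsub>K\<^esub> \<iota> b'"]
        by (simp add: frac.K.m_comm frac.K.m_lcomm frac.S.m_assoc)
      have "\<phi> (b \<otimes> b') \<odot>\<^bsub>V\<^esub> sc k' v = \<phi> (b \<otimes> a') \<odot>\<^bsub>V\<^esub> v"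
        using \<phi>_mult[OF bR sc_closed[OF k(2) v]] \<phi>_mult[OF bR(1) ab'(1) v] s by simp
      moreover have "\<phi> (b \<otimes> b') \<odot>\<^bsub>V\<^esub> sc k v = \<phi> (b' \<otimes> a) \<odot>\<^bsub>V\<^esub> v"
        unfolding frac.m_comm[OF bR] using \<phi>_mult[OF bR(2,1) sc_closed[OF k(1) v]] \<phi>_mult[OF bR(2) ab(1) v] s by simp
      ultimately have "\<phi> (b \<otimes> b') \<odot>\<^bsub>V\<^esub> (sc k v \<oplus>\<^bsub>V\<^esub> sc k' v) = \<phi> (b' \<otimes> a) \<odot>\<^bsub>V\<^esub> v \<oplus>\<^bsub>V\<^esub> \<phi> (b \<otimes> a') \<odot>\<^bsub>V\<^esub> v"
        using bR k v V.smult_r_distr[of "\<phi> (b \<otimes> b')" "sc k v" "sc k' v"] by simp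
      then show "\<phi> (b \<otimes> b') \<odot>\<^bsub>V\<^esub> (sc k v \<oplus>\<^bsub>V\<^esub> sc k' v) = \<phi> (b' \<otimes> a \<oplus> b \<otimes> a') \<odot>\<^bsub>V\<^esub> v"
        using bR ab(1) ab'(1) v by (simp add: V.smult_l_distr)
    qed (use ab ab' bR k v in auto)
  qed
  have sc_mult: "sc (k \<otimes>\<^bsub>K\<^esub> k') v = sc k (sc k' v)"
    if k: "k \<in> carrier K" "k' \<in> carrier K" and v: "v \<in> carrier V" for k k' v
  proof -
    obtain a b where ab: "a \<in> carrier R" "b \<in> carrier R - {\<zero>}" "\<iota> a = k \<otimes>\<^bsub>K\<^esub> \<iota> b" by (rule fraction_obtain[OF k(1)])
    obtain a' b' where ab': "a' \<in> carrier R" "b' \<in> carrier R - {\<zero>}" "\<iota> a' = k' \<otimes>\<^bsub>K\<^esub> \<iota> b'" by (rule fraction_obtain[OF k(2)])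
    have bR: "b \<in> carrier R" "b' \<in> carrier R" using ab ab' by auto
    note s = sc(2)[OF k(1) sc_closed[OF k(2) v] ab] sc(2)[OF k(2) v ab']
    show ?thesis
    proof (rule sc_eqI[of _ _ _ "a \<otimes> a'" "b' \<otimes> b"])
      show "b' \<otimes> b \<in> carrier R - {\<zero>}" by (rule loc.nonzero_mult[OF ab'(2) ab(2)])
      show "\<iota> (a \<otimes> a') = k \<otimes>\<^bsub>K\<^esub> k' \<otimes>\<^bsub>K\<^esub> \<iota> (b' \<otimes> b)"
        using ab ab' bR k by (simp add: frac.K.m_comm frac.K.m_lcomm frac.S.m_assoc)
      have "\<phi> (b' \<otimes> b) \<odot>\<^bsub>V\<^esub> sc k (sc k' v) = \<phi> b' \<odot>\<^bsub>V\<^esub> (\<phi> a \<odot>\<^bsub>V\<^esub> sc k' v)"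
        using \<phi>_mult[OF bR(2,1), of "sc k (sc k' v)"] k v s by simp
      also have "\<dots> = \<phi> a \<odot>\<^bsub>V\<^esub> (\<phi> a' \<odot>\<^bsub>V\<^esub> v)"
        using \<phi>_comm[OF bR(2), of "\<phi> a" "sc k' v"] ab(1) k v s by simp
      finally show "\<phi> (b' \<otimes> b) \<odot>\<^bsub>V\<^esub> sc k (sc k' v) = \<phi> (a \<otimes> a') \<odot>\<^bsub>V\<^esub> v"
        using \<phi>_mult[OF ab(1) ab'(1) v] by simp
    qed (use ab ab' bR k v in auto)
  qed
  have sc_base: "sc (\<iota> r) v = \<phi> r \<odot>\<^bsub>V\<^esub> v" if "r \<in> carrier R" "v \<in> carrier V" for r v
    using that by (intro sc_eqI[of _ _ _ r \<one>]) (auto simp: V.smult_one)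
  have sc_one: "sc \<one>\<^bsub>K\<^esub> v = v" if "v \<in> carrier V" for v
    using sc_base[OF _ that, of \<one>] that by (simp add: V.smult_one)
  \<comment> \<open>\<open>H v\<close> maps \<open>\<Sum> (k\<^sub>i, l\<^sub>i)\<close> to \<open>\<Sum> k\<^sub>i (l\<^sub>i v)\<close>.\<close>
  have "\<forall>v\<in>carrier V. \<exists>h. h \<in> hom (free_Abelian_group B) (add_monoid V) \<and>
    (\<forall>p\<in>B. h (frag_of p) = sc (fst p) (snd p \<odot>\<^bsub>V\<^esub> v))"
  proof
    fix v assume v: "v \<in> carrier V"
    have "(\<lambda>p. sc (fst p) (snd p \<odot>\<^bsub>V\<^esub> v)) ` B \<subseteq> carrier (add_monoid V)" using v by (auto simp: B_def)
    from V.M.a_comm_group this show "\<exists>h. h \<in> hom (free_Abelian_group B) (add_monoid V) \<and>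
        (\<forall>p\<in>B. h (frag_of p) = sc (fst p) (snd p \<odot>\<^bsub>V\<^esub> v))"
    proof (rule comm_group.free_Abelian_group_universal)
      fix h assume "h \<in> hom (free_Abelian_group B) (add_monoid V)"
        "\<And>p. p \<in> B \<Longrightarrow> h (frag_of p) = sc (fst p) (snd p \<odot>\<^bsub>V\<^esub> v)"
      then show ?thesis by (intro exI[of _ h] conjI ballI)
    qed
  qed
  then obtain H where hom: "\<And>v. v \<in> carrier V \<Longrightarrow> H v \<in> hom (free_Abelian_group B) (add_monoid V)"
    and H_frag: "\<And>v p. \<lbrakk>v \<in> carrier V; p \<in> B\<rbrakk> \<Longrightarrow> H v (frag_of p) = sc (fst p) (snd p \<odot>\<^bsub>V\<^esub> v)"
    using bchoice[of "carrier V"] by metis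
  have H_closed[simp]: "H v f \<in> carrier V" if "v \<in> carrier V" "f \<in> carrier F" for v f
    using hom_in_carrier[OF hom[OF that(1)], of f] that(2) by (simp add: F_simps)
  have H_add: "H v (f + g) = H v f \<oplus>\<^bsub>V\<^esub> H v g" if "v \<in> carrier V" "f \<in> carrier F" "g \<in> carrier F" for v f g
    using hom_mult[OF hom[OF that(1)], of f g] that(2,3) by (simp add: F_simps)
  have cancel: "x = z \<ominus>\<^bsub>V\<^esub> y" if "x \<in> carrier V" "y \<in> carrier V" "z = x \<oplus>\<^bsub>V\<^esub> y" for x y z
    using that by (simp add: a_minus_def V.M.a_assoc V.M.r_neg)
  have H_diff: "H v (f - g) = H v f \<ominus>\<^bsub>V\<^esub> H v g" if "v \<in> carrier V" "f \<in> carrier F" "g \<in> carrier F" for v f g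
    using H_add[OF that(1) diff_closed[OF that(2,3)] that(3)] that diff_closed[OF that(2,3)] by (intro cancel) auto
  have H_zero: "H v 0 = \<zero>\<^bsub>V\<^esub>" if "v \<in> carrier V" for v
    using H_diff[OF that zero_closed zero_closed] that zero_closed by (simp add: a_minus_def V.M.r_neg)
  have minus_hom: "t (x \<ominus>\<^bsub>V\<^esub> y) = t x \<ominus>\<^bsub>V\<^esub> t y"
    if t: "\<And>x. x \<in> carrier V \<Longrightarrow> t x \<in> carrier V" "\<And>x y. \<lbrakk>x \<in> carrier V; y \<in> carrier V\<rbrakk> \<Longrightarrow> t (x \<oplus>\<^bsub>V\<^esub> y) = t x \<oplus>\<^bsub>V\<^esub> t y"
      and xy: "x \<in> carrier V" "y \<in> carrier V" for t x y
  proof (rule cancel)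
    have "x = (x \<ominus>\<^bsub>V\<^esub> y) \<oplus>\<^bsub>V\<^esub> y" using xy by (simp add: a_minus_def V.M.a_assoc V.M.l_neg)
    then show "t x = t (x \<ominus>\<^bsub>V\<^esub> y) \<oplus>\<^bsub>V\<^esub> t y" using t(2)[of "x \<ominus>\<^bsub>V\<^esub> y" y] xy by simp
  qed (use t xy in auto)
  have H_add_vec: "H (v \<oplus>\<^bsub>V\<^esub> w) f = H v f \<oplus>\<^bsub>V\<^esub> H w f" if v: "v \<in> carrier V" "w \<in> carrier V" and f: "f \<in> carrier F" for v w f
    using f
  proof (induction f rule: F_induct)
    case zero
    then show ?case using v by (simp add: H_zero)
  next
    case (frag p)
    then show ?case using v by (auto simp: H_frag B_def V.smult_r_distr sc_add)
  next
    case (diff f g)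
    then have "H (v \<oplus>\<^bsub>V\<^esub> w) (f - g) = (H v f \<oplus>\<^bsub>V\<^esub> H w f) \<oplus>\<^bsub>V\<^esub> (\<ominus>\<^bsub>V\<^esub> H v g \<oplus>\<^bsub>V\<^esub> \<ominus>\<^bsub>V\<^esub> H w g)"
      using v by (simp add: H_diff a_minus_def V.M.minus_add)
    also have "\<dots> = (H v f \<oplus>\<^bsub>V\<^esub> \<ominus>\<^bsub>V\<^esub> H v g) \<oplus>\<^bsub>V\<^esub> (H w f \<oplus>\<^bsub>V\<^esub> \<ominus>\<^bsub>V\<^esub> H w g)"
      using v diff(1,2) by (simp add: V.M.a_ac)
    finally show ?case using v diff(1,2) by (simp add: H_diff a_minus_def)
  qed
  have H_mult: "H v (f \<otimes>\<^bsub>F\<^esub> g) = H (H v g) f" if v: "v \<in> carrier V" and f: "f \<in> carrier F" and g: "g \<in> carrier F" for v f g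
    using f
  proof (induction f rule: F_induct)
    case zero
    then show ?case using v g by (simp add: mult_zero H_zero)
  next
    case (diff a b)
    then show ?case using v g by (simp add: mult_diff H_diff mult_closed)
  next
    case (frag p)
    then have p: "fst p \<in> carrier K" "snd p \<in> carrier \<Lambda>" "frag_of p \<in> carrier F" by (auto simp: B_def frag_of_B)
    let ?t = "\<lambda>x. sc (fst p) (snd p \<odot>\<^bsub>V\<^esub> x)"
    have "H v (frag_of p \<otimes>\<^bsub>F\<^esub> g) = ?t (H v g)"
      using g
    proof (induction g rule: F_induct)
      case zero
      have "?t (\<zero>\<^bsub>V\<^esub> \<ominus>\<^bsub>V\<^esub> \<zero>\<^bsub>V\<^esub>) = ?t \<zero>\<^bsub>V\<^esub> \<ominus>\<^bsub>V\<^esub> ?t \<zero>\<^bsub>V\<^esub>"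
        using p by (intro minus_hom) (auto simp: V.smult_r_distr sc_add)
      then show ?case using v p by (simp add: mult_zero H_zero a_minus_def V.M.r_neg)
    next
      case (frag q)
      then have q: "fst q \<in> carrier K" "snd q \<in> carrier \<Lambda>" by (auto simp: B_def)
      have "H v (frag_of p \<otimes>\<^bsub>F\<^esub> frag_of q) = sc (fst p \<otimes>\<^bsub>K\<^esub> fst q) ((snd p \<otimes>\<^bsub>\<Lambda>\<^esub> snd q) \<odot>\<^bsub>V\<^esub> v)"
        using H_frag[OF v pm_closed[OF \<open>p \<in> B\<close> frag]] by (simp add: mult_frag_of pm_def)
      also have "\<dots> = ?t (H v (frag_of q))"
        using v p q by (simp add: H_frag[OF v frag] V.smult_assoc1 sc_mult sc_smult)
      finally show ?case .
    next
      case (diff a b)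
      have "?t (H v a \<ominus>\<^bsub>V\<^esub> H v b) = ?t (H v a) \<ominus>\<^bsub>V\<^esub> ?t (H v b)"
        using v p diff by (intro minus_hom) (auto simp: V.smult_r_distr sc_add)
      then show ?case using v p diff by (simp add: mult_diff H_diff mult_closed)
    qed
    then show ?case using H_frag[OF H_closed[OF v g] frag] by simp
  qed
  \<comment> \<open>This makes \<open>V\<close> a module over \<open>F\<close>, and it descends to \<open>C = F / I\<close>.\<close>
  define VF :: "('k \<times> 'l \<Rightarrow>\<^sub>0 int, 'g) module" where
    "VF = \<lparr>carrier = carrier V, monoid.mult = undefined, one = undefined, ring.zero = \<zero>\<^bsub>V\<^esub>,
      add = add V, smult = (\<lambda>f v. H v f)\<rparr>"
  have VF_simps: "carrier VF = carrier V" "\<zero>\<^bsub>VF\<^esub> = \<zero>\<^bsub>V\<^esub>" "x \<oplus>\<^bsub>VF\<^esub> y = x \<oplus>\<^bsub>V\<^esub> y" "f \<odot>\<^bsub>VF\<^esub> x = H x f" for x y f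
    by (simp_all add: VF_def)
  have one: "H v \<one>\<^bsub>F\<^esub> = v" if "v \<in> carrier V" for v
    using H_frag[OF that, of "(\<one>\<^bsub>K\<^esub>, \<one>\<^bsub>\<Lambda>\<^esub>)"] that by (simp add: F_simps(4) B_def V.smult_one sc_one)
  have "abelian_group VF"
    by (rule abelian_groupI) (auto simp: VF_simps V.M.a_ac intro: V.M.l_neg V.M.a_inv_closed)
  then have VF: "left_module F VF"
    by (intro left_module.intro left_module_axioms.intro ring_F)
      (simp_all add: VF_simps H_add H_add_vec H_mult one F_simps(3))
  have ann: "H v u = \<zero>\<^bsub>V\<^esub>" if "u \<in> I" and v: "v \<in> carrier V" for u v
    using \<open>u \<in> I\<close>
  proof (induction u rule: I_induct)
    case zero
    show ?case by (rule H_zero[OF v])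
  next
    case (diff f g)
    then show ?case using v I_subset by (simp add: H_diff a_minus_def V.M.r_neg)
  next
    case (rel u)
    have three: "(x \<oplus>\<^bsub>V\<^esub> y) \<ominus>\<^bsub>V\<^esub> x \<ominus>\<^bsub>V\<^esub> y = \<zero>\<^bsub>V\<^esub>" if "x \<in> carrier V" "y \<in> carrier V" for x y
    proof -
      have "(y \<oplus>\<^bsub>V\<^esub> x) \<ominus>\<^bsub>V\<^esub> x = y" using cancel[of y x] that by simp
      then show ?thesis using that by (simp add: V.M.a_comm[of x y] a_minus_def V.M.r_neg)
    qed
    from rel show ?case
    proof (cases rule: relation_cases)
      case (left b b' c)
      then have "frag_of (b \<oplus>\<^bsub>K\<^esub> b', c) \<in> carrier F" "frag_of (b, c) \<in> carrier F" "frag_of (b', c) \<in> carrier F"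
        by (auto intro!: frag_of_B simp: B_def)
      then show ?thesis
        using left v by (simp add: H_diff H_frag B_def diff_closed sc_add_left three)
    next
      case (right b c c')
      then have "frag_of (b, c \<oplus>\<^bsub>\<Lambda>\<^esub> c') \<in> carrier F" "frag_of (b, c) \<in> carrier F" "frag_of (b, c') \<in> carrier F"
        by (auto intro!: frag_of_B simp: B_def)
      then show ?thesis
        using right v by (simp add: H_diff H_frag B_def diff_closed V.smult_l_distr sc_add three)
    next
      case (base r b c)
      then have "frag_of (\<iota> r \<otimes>\<^bsub>K\<^esub> b, c) \<in> carrier F" "frag_of (b, \<phi> r \<otimes>\<^bsub>\<Lambda>\<^esub> c) \<in> carrier F"
        by (auto intro!: frag_of_B simp: B_def)
      moreover have "sc (\<iota> r \<otimes>\<^bsub>K\<^esub> b) (c \<odot>\<^bsub>V\<^esub> v) = sc b ((\<phi> r \<otimes>\<^bsub>\<Lambda>\<^esub> c) \<odot>\<^bsub>V\<^esub> v)"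
        using base v by (simp add: sc_mult sc_base sc_smult V.smult_assoc1 \<phi>_comm)
      ultimately show ?thesis
        using base v by (simp add: H_diff H_frag B_def a_minus_def V.M.r_neg)
    qed
  qed
  have cls0: "cls 0 = \<zero>\<^bsub>C\<^esub>" using cls.hom_zero by (simp add: F_simps)
  have ann': "u \<odot>\<^bsub>VF\<^esub> x = \<zero>\<^bsub>VF\<^esub>" if "u \<in> carrier F" "cls u = \<zero>\<^bsub>C\<^esub>" "x \<in> carrier VF" for u x
    using that cls_eq_iff[OF that(1) zero_closed] ann[of u x] by (simp add: cls0 VF_simps)
  obtain N :: "(('k \<times> 'l \<Rightarrow>\<^sub>0 int) set, 'g) module" where N: "left_module C N" "carrier N = carrier VF"
    "\<zero>\<^bsub>N\<^esub> = \<zero>\<^bsub>VF\<^esub>" "(\<lambda>x. x) \<in> module_hom F VF (restrict_scalars cls N)"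
    using descend_scalars[OF cls_hom cls_surj VF ann'] by blast
  have "(\<lambda>x. x) \<in> module_hom \<Lambda> V (restrict_scalars \<psi> N)"
  proof (rule module_homI)
    fix l x assume l: "l \<in> carrier \<Lambda>" and x: "x \<in> carrier V"
    have "\<psi> l \<odot>\<^bsub>N\<^esub> x = H x (frag_of (\<one>\<^bsub>K\<^esub>, l))"
      using module_homD(3)[OF N(4), of "frag_of (\<one>\<^bsub>K\<^esub>, l)" x] l x frag_of_B[of "(\<one>\<^bsub>K\<^esub>, l)"]
      by (simp add: \<psi>_def cf_def VF_simps B_def)
    also have "\<dots> = l \<odot>\<^bsub>V\<^esub> x" using H_frag[OF x, of "(\<one>\<^bsub>K\<^esub>, l)"] l x by (simp add: B_def sc_one)
    finally show "l \<odot>\<^bsub>V\<^esub> x = l \<odot>\<^bsub>restrict_scalars \<psi> N\<^esub> x" by simp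
  qed (use N(2) module_homD(2)[OF N(4)] in \<open>auto simp: VF_simps\<close>)
  then show thesis using that N(1-3) by (simp add: VF_simps)
qed

text \<open>The module \<open>V = K \<otimes>\<^sub>R M\<close> with \<open>u x = 1 \<otimes> x\<close>: the kernel of \<open>u\<close> is the torsion submodule of \<open>M\<close>, and
  the image is a lattice.\<close>

lemma (in fraction_algebra) localization_exists:
  fixes M :: "('l, 'g, 'z) module_scheme"
  assumes M: "left_module \<Lambda> M"
  obtains V :: "(('k \<times> 'l \<Rightarrow>\<^sub>0 int) set, ('r \<Rightarrow> 'g) set) module" and u where "left_module C V"
    "u \<in> module_hom \<Lambda> M (restrict_scalars \<psi> V)"
    "\<And>x. \<lbrakk>x \<in> carrier M; u x = \<zero>\<^bsub>V\<^esub>\<rbrakk> \<Longrightarrow> \<exists>r\<in>carrier R - {\<zero>}. \<phi> r \<odot>\<^bsub>M\<^esub> x = \<zero>\<^bsub>M\<^esub>"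
    "\<And>v. v \<in> carrier V \<Longrightarrow> \<exists>r\<in>carrier R - {\<zero>}. \<exists>x\<in>carrier M. \<psi> (\<phi> r) \<odot>\<^bsub>V\<^esub> v = u x"
proof (rule localized_module_exists[OF alg.module_finite_algebra_axioms frac.domain_axioms M])
  fix W :: "('l, ('r \<Rightarrow> 'g) set) module" and u
  assume W: "left_module \<Lambda> W" "u \<in> module_hom \<Lambda> M W"
    and inj: "\<And>r v. \<lbrakk>r \<in> carrier R - {\<zero>}; v \<in> carrier W; \<phi> r \<odot>\<^bsub>W\<^esub> v = \<zero>\<^bsub>W\<^esub>\<rbrakk> \<Longrightarrow> v = \<zero>\<^bsub>W\<^esub>"
    and surj: "\<And>r v. \<lbrakk>r \<in> carrier R - {\<zero>}; v \<in> carrier W\<rbrakk> \<Longrightarrow> \<exists>w\<in>carrier W. \<phi> r \<odot>\<^bsub>W\<^esub> w = v"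
    and ker: "\<And>x. \<lbrakk>x \<in> carrier M; u x = \<zero>\<^bsub>W\<^esub>\<rbrakk> \<Longrightarrow> \<exists>r\<in>carrier R - {\<zero>}. \<phi> r \<odot>\<^bsub>M\<^esub> x = \<zero>\<^bsub>M\<^esub>"
    and dense: "\<And>v. v \<in> carrier W \<Longrightarrow> \<exists>r\<in>carrier R - {\<zero>}. \<exists>x\<in>carrier M. \<phi> r \<odot>\<^bsub>W\<^esub> v = u x"
  obtain V :: "(('k \<times> 'l \<Rightarrow>\<^sub>0 int) set, ('r \<Rightarrow> 'g) set) module" where V: "left_module C V"
    "carrier V = carrier W" "\<zero>\<^bsub>V\<^esub> = \<zero>\<^bsub>W\<^esub>" and id: "(\<lambda>x. x) \<in> module_hom \<Lambda> W (restrict_scalars \<psi> V)"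
    by (rule tensor_module_exists[OF W(1) inj surj])
  show thesis
  proof (rule that[OF V(1) module_hom_compose[OF W(2) id]])
    show "\<exists>r\<in>carrier R - {\<zero>}. \<phi> r \<odot>\<^bsub>M\<^esub> x = \<zero>\<^bsub>M\<^esub>" if "x \<in> carrier M" "u x = \<zero>\<^bsub>V\<^esub>" for x
      using ker that V(3) by simp
    fix v assume v: "v \<in> carrier V"
    then obtain r x where r: "r \<in> carrier R - {\<zero>}" "x \<in> carrier M" "\<phi> r \<odot>\<^bsub>W\<^esub> v = u x"
      using dense V(2) by blast
    have "\<phi> r \<odot>\<^bsub>W\<^esub> v = \<psi> (\<phi> r) \<odot>\<^bsub>V\<^esub> v"
      using module_homD(3)[OF id, of "\<phi> r" v] r v V(2) by simp
    then show "\<exists>r\<in>carrier R - {\<zero>}. \<exists>x\<in>carrier M. \<psi> (\<phi> r) \<odot>\<^bsub>V\<^esub> v = u x" using r by metis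
  qed
qed

section \<open>Torsion classes are determined by their extensions\<close>

lemma ideal_extend_ideal:
  assumes A: "module_finite_algebra R \<Lambda> \<phi>" and "ideal J R"
  shows "ideal (extend_ideal \<Lambda> \<phi> J) \<Lambda>"
proof -
  interpret alg: module_finite_algebra R \<Lambda> \<phi> by fact
  interpret J: ideal J R by fact
  let ?J = "extend_ideal \<Lambda> \<phi> J"
  have JR: "r \<in> carrier R" if "r \<in> J" for r using that by (rule J.Icarr)
  have gen: "\<phi> r \<otimes>\<^bsub>\<Lambda>\<^esub> x \<in> ?J" if "r \<in> J" "x \<in> carrier \<Lambda>" for r x
    unfolding extend_ideal_def using that by (intro ideal_prod.prod) auto
  have add: "a \<oplus>\<^bsub>\<Lambda>\<^esub> b \<in> ?J" if "a \<in> ?J" "b \<in> ?J" for a b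
    using that unfolding extend_ideal_def by (rule ideal_prod.sum)
  have induct: "P a" if "a \<in> ?J" "\<And>r x. \<lbrakk>r \<in> J; x \<in> carrier \<Lambda>\<rbrakk> \<Longrightarrow> P (\<phi> r \<otimes>\<^bsub>\<Lambda>\<^esub> x)"
    "\<And>a b. \<lbrakk>a \<in> ?J; b \<in> ?J; P a; P b\<rbrakk> \<Longrightarrow> P (a \<oplus>\<^bsub>\<Lambda>\<^esub> b)" for P a
    using that(1) unfolding extend_ideal_def
    by (induction rule: ideal_prod.induct) (use that in \<open>auto simp: extend_ideal_def\<close>)
  have carr: "a \<in> carrier \<Lambda>" if "a \<in> ?J" for a
    using that by (rule induct) (auto dest: JR)
  show ?thesis
  proof (rule idealI[OF alg.S.ring_axioms])
    show "subgroup ?J (add_monoid \<Lambda>)"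
    proof (rule alg.S.add.subgroupI)
      show "?J \<subseteq> carrier \<Lambda>" using carr by blast
      show "?J \<noteq> {}" using gen[OF J.zero_closed alg.S.one_closed] by blast
      show "a \<oplus>\<^bsub>\<Lambda>\<^esub> b \<in> ?J" if "a \<in> ?J" "b \<in> ?J" for a b using add that .
      show "\<ominus>\<^bsub>\<Lambda>\<^esub> a \<in> ?J" if "a \<in> ?J" for a
        using that
      proof (rule induct)
        fix r x assume "r \<in> J" "x \<in> carrier \<Lambda>"
        then show "\<ominus>\<^bsub>\<Lambda>\<^esub> (\<phi> r \<otimes>\<^bsub>\<Lambda>\<^esub> x) \<in> ?J"
          using gen[of r "\<ominus>\<^bsub>\<Lambda>\<^esub> x"] JR by (simp add: alg.S.r_minus)
      next
        fix a b assume "a \<in> ?J" "b \<in> ?J" "\<ominus>\<^bsub>\<Lambda>\<^esub> a \<in> ?J" "\<ominus>\<^bsub>\<Lambda>\<^esub> b \<in> ?J"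
        then show "\<ominus>\<^bsub>\<Lambda>\<^esub> (a \<oplus>\<^bsub>\<Lambda>\<^esub> b) \<in> ?J"
          using add carr by (simp add: alg.S.minus_add)
      qed
    qed
    fix a y assume a: "a \<in> ?J" and y: "y \<in> carrier \<Lambda>"
    show "y \<otimes>\<^bsub>\<Lambda>\<^esub> a \<in> ?J"
      using a
    proof (rule induct)
      fix r x assume "r \<in> J" "x \<in> carrier \<Lambda>"
      then have "y \<otimes>\<^bsub>\<Lambda>\<^esub> (\<phi> r \<otimes>\<^bsub>\<Lambda>\<^esub> x) = \<phi> r \<otimes>\<^bsub>\<Lambda>\<^esub> (y \<otimes>\<^bsub>\<Lambda>\<^esub> x)"
        using y JR alg.central[of r y] by (simp add: alg.S.m_assoc[symmetric])
      then show "y \<otimes>\<^bsub>\<Lambda>\<^esub> (\<phi> r \<otimes>\<^bsub>\<Lambda>\<^esub> x) \<in> ?J"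
        using gen \<open>r \<in> J\<close> \<open>x \<in> carrier \<Lambda>\<close> y by simp
    qed (use y add carr in \<open>simp add: alg.S.r_distr\<close>)
    show "a \<otimes>\<^bsub>\<Lambda>\<^esub> y \<in> ?J"
      using a
    proof (rule induct)
      fix r x assume "r \<in> J" "x \<in> carrier \<Lambda>"
      then show "\<phi> r \<otimes>\<^bsub>\<Lambda>\<^esub> x \<otimes>\<^bsub>\<Lambda>\<^esub> y \<in> ?J"
        using gen[of r "x \<otimes>\<^bsub>\<Lambda>\<^esub> y"] y JR by (simp add: alg.S.m_assoc)
    qed (use y add carr in \<open>simp add: alg.S.l_distr\<close>)
  qed
qed

lemma left_submodule_ideal_smult:
  assumes A: "module_finite_algebra R \<Lambda> \<phi>" and M: "left_module \<Lambda> M" and J: "J \<subseteq> carrier R"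
  shows "left_submodule \<Lambda> M (ideal_smult \<Lambda> \<phi> J M)"
proof -
  interpret alg: module_finite_algebra R \<Lambda> \<phi> by fact
  interpret M: left_module \<Lambda> M by fact
  show ?thesis
    unfolding ideal_smult_def using J by (intro left_submodule_lspan[OF M]) (auto intro!: M.smult_closed)
qed

lemma extend_ideal_smult:
  assumes A: "module_finite_algebra R \<Lambda> \<phi>" and M: "left_module \<Lambda> M" and J: "ideal J R"
    and a: "a \<in> extend_ideal \<Lambda> \<phi> J" and x: "x \<in> carrier M"
  shows "a \<odot>\<^bsub>M\<^esub> x \<in> ideal_smult \<Lambda> \<phi> J M"
proof -
  interpret alg: module_finite_algebra R \<Lambda> \<phi> by fact
  interpret M: left_module \<Lambda> M by fact
  have JR: "J \<subseteq> carrier R" using J by (auto dest: ideal.Icarr)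
  note D = left_submoduleD[OF left_submodule_ideal_smult[OF A M JR]]
  have "a \<in> carrier \<Lambda> \<and> a \<odot>\<^bsub>M\<^esub> x \<in> ideal_smult \<Lambda> \<phi> J M"
    using a unfolding extend_ideal_def
  proof (induction rule: ideal_prod.induct)
    case (prod i j)
    then obtain r where r: "r \<in> J" "i = \<phi> r" by blast
    have "\<phi> r \<odot>\<^bsub>M\<^esub> (j \<odot>\<^bsub>M\<^esub> x) \<in> ideal_smult \<Lambda> \<phi> J M"
      unfolding ideal_smult_def using r(1) prod(2) x
      by (intro subsetD[OF lspan_superset] CollectI exI[of _ r] exI[of _ "j \<odot>\<^bsub>M\<^esub> x"])
        (auto simp: M.smult_closed)
    then show ?case using r prod(2) x JR by (auto simp: M.smult_assoc1)
  next
    case (sum a b)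
    then show ?case using D(3) x by (simp add: M.smult_l_distr)
  qed
  then show ?thesis ..
qed

lemma nonzero_principal_ideal:
  assumes "domain R" "r \<in> carrier R - {\<zero>\<^bsub>R\<^esub>}"
  shows "ideal (PIdl\<^bsub>R\<^esub> r) R" "PIdl\<^bsub>R\<^esub> r \<noteq> {\<zero>\<^bsub>R\<^esub>}"
proof -
  interpret domain R by fact
  show "ideal (PIdl\<^bsub>R\<^esub> r) R" "PIdl\<^bsub>R\<^esub> r \<noteq> {\<zero>\<^bsub>R\<^esub>}"
    using cgenideal_ideal[of r] cgenideal_self[of r] assms(2) by auto
qed

text \<open>Let \<open>Y\<close> be in \<open>T\<close>. As \<open>Y / \<mm> Y\<close> lies in \<open>T'\<close>, so does \<open>Y / s Y\<close> for every nonzero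
  \<open>s \<in> R\<close>. As \<open>K \<otimes> Y\<close> contains a lattice \<open>Z\<close> in \<open>T'\<close>, a nonzero multiple of \<open>Z\<close> maps onto a
  submodule \<open>D\<close> of \<open>Y\<close> with torsion quotient, so that \<open>s Y \<subseteq> D \<subseteq> Y\<close> for some \<open>s \<noteq> 0\<close>. Both \<open>D\<close>
  and \<open>Y / D\<close> lie in \<open>T'\<close>, hence so does \<open>Y\<close>.\<close>

lemma (in fraction_algebra) torsion_class_le_if_extended_le:
  assumes "noetherian_domain R"
    and primes: "\<And>P. \<lbrakk>primeideal P R; P \<noteq> {\<zero>}\<rbrakk> \<Longrightarrow> P = \<mm>"
    and \<mm>: "ideal \<mm> R"
    and T: "torsion_class \<Lambda> T" and T': "torsion_class \<Lambda> T'"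
    and factor: "extended_class \<Lambda> (\<Lambda> Quot extend_ideal \<Lambda> \<phi> \<mm>) (a_r_coset \<Lambda> (extend_ideal \<Lambda> \<phi> \<mm>)) T \<subseteq>
      extended_class \<Lambda> (\<Lambda> Quot extend_ideal \<Lambda> \<phi> \<mm>) (a_r_coset \<Lambda> (extend_ideal \<Lambda> \<phi> \<mm>)) T'"
    and generic: "extended_class \<Lambda> C \<psi> T \<subseteq> extended_class \<Lambda> C \<psi> T'"
  shows "T \<subseteq> T'"
proof
  fix Y assume YT: "Y \<in> T"
  note A = alg.module_finite_algebra_axioms
  have Yfg: "Y \<in> fg_modules \<Lambda>" by (rule torsion_class_fg[OF T YT])
  then have Y: "left_module \<Lambda> Y" "fin_gen_module \<Lambda> Y" by (auto simp: fg_modules_def)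
  interpret Y: left_module \<Lambda> Y by (rule Y)
  note CY = left_submodule_carrier[OF Y(1)] and YYT = subquot_in_member[OF T YT]
  have zY: "left_submodule \<Lambda> Y {\<zero>\<^bsub>Y\<^esub>}" by (rule left_submodule_zero[OF Y(1)])
  have \<mm>R: "\<mm> \<subseteq> carrier R" using \<mm> by (auto dest: ideal.Icarr)
  have ext: "\<phi> r \<odot>\<^bsub>Y\<^esub> x \<in> H" if "left_submodule \<Lambda> Y H" "r \<in> carrier R" "x \<in> H" for H r x
    using left_submoduleD(4)[OF that(1) _ that(3)] that(2) by simp
  \<comment> \<open>\<open>Y / \<mm> Y\<close> is a module over \<open>\<Lambda> / \<mm> \<Lambda>\<close>, over which every lattice is the whole module.\<close>
  have "subquot_in \<Lambda> T' Y (carrier Y) (ideal_smult \<Lambda> \<phi> \<mm> Y)"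
  proof -
    define J where "J = extend_ideal \<Lambda> \<phi> \<mm>"
    define c where "c = a_r_coset \<Lambda> J"
    interpret J: ideal J \<Lambda> unfolding J_def by (rule ideal_extend_ideal[OF A \<mm>])
    have J: "ideal J \<Lambda>" by unfold_locales
    have h: "ring_hom_ring \<Lambda> (\<Lambda> Quot J) c" unfolding c_def by (rule J.rcos_ring_hom_ring)
    have surj: "c ` carrier \<Lambda> = carrier (\<Lambda> Quot J)"
      by (auto simp: FactRing_def A_RCOSETS_def' c_def)
    note sub = left_submodule_ideal_smult[OF A Y(1) \<mm>R]
    obtain Q :: "('l, (nat \<Rightarrow> 'l) set set) module" and q where Q: "left_module \<Lambda> Q"
      and q: "q \<in> module_hom \<Lambda> Y Q" "q ` carrier Y = carrier Q"
      and kerq: "\<And>x. x \<in> carrier Y \<Longrightarrow> q x = \<zero>\<^bsub>Q\<^esub> \<longleftrightarrow> x \<in> ideal_smult \<Lambda> \<phi> \<mm> Y"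
      using quotient_module_exists[OF Y(1) sub] by blast
    have ann: "a \<odot>\<^bsub>Q\<^esub> x = \<zero>\<^bsub>Q\<^esub>" if a: "a \<in> carrier \<Lambda>" "c a = \<zero>\<^bsub>\<Lambda> Quot J\<^esub>" and x: "x \<in> carrier Q" for a x
    proof -
      have "a \<in> J" using a alg.S.a_rcos_zero[OF J] J.rcos_const_imp_mem[OF a(1)]
        by (auto simp: c_def FactRing_def)
      obtain y where y: "y \<in> carrier Y" "x = q y" using x unfolding q(2)[symmetric] by blast
      have "a \<odot>\<^bsub>Y\<^esub> y \<in> ideal_smult \<Lambda> \<phi> \<mm> Y"
        using extend_ideal_smult[OF A Y(1) \<mm> _ y(1)] \<open>a \<in> J\<close> by (simp add: J_def)
      then show ?thesis using kerq[of "a \<odot>\<^bsub>Y\<^esub> y"] module_homD(3)[OF q(1) a(1) y(1)] y a(1) Y.smult_closed by simp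
    qed
    obtain N :: "('l set, (nat \<Rightarrow> 'l) set set) module" where N: "left_module (\<Lambda> Quot J) N"
      "carrier N = carrier Q" "\<zero>\<^bsub>N\<^esub> = \<zero>\<^bsub>Q\<^esub>" and id: "(\<lambda>x. x) \<in> module_hom \<Lambda> Q (restrict_scalars c N)"
      by (rule descend_scalars[OF h surj Q ann])
    note q' = module_hom_compose[OF q(1) id]
    note N' = left_module_restrict_scalars[OF h N(1)]
    have qY: "q ` carrier Y = carrier N" using q(2) N(2) by simp
    have "subquot_in \<Lambda> T (restrict_scalars c N) (q ` carrier Y) {\<zero>\<^bsub>restrict_scalars c N\<^esub>}"
      using module_hom_zero[OF Y(1) Q q(1)] N(3) by (intro subquot_in_image_zero[OF T Y(1) N' YYT q']) simp
    then have NT: "subquot_in \<Lambda> T (restrict_scalars c N) (carrier N) {\<zero>\<^bsub>N\<^esub>}" by (simp add: qY)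
    have lat: "lattice_in \<Lambda> (\<Lambda> Quot J) c N (carrier N)"
      using lattice_in_surj[OF h surj N(1)] by blast
    obtain W where W: "lattice_in \<Lambda> (\<Lambda> Quot J) c N W" "subquot_in \<Lambda> T' (restrict_scalars c N) W {\<zero>\<^bsub>N\<^esub>}"
      using extended_class_transfer[OF h T T' factor[folded J_def c_def] N(1) lat NT] by blast
    have "W = carrier N" using W(1) lattice_in_surj[OF h surj N(1)] by blast
    show ?thesis
    proof (rule subquot_in_vimage[OF W(2) CY module_hom_restrict[OF q' CY]])
      show "q ` carrier Y = W" using q(2) N(2) \<open>W = carrier N\<close> by simp
      show "{x \<in> carrier Y. q x \<in> {\<zero>\<^bsub>N\<^esub>}} = ideal_smult \<Lambda> \<phi> \<mm> Y"
        using kerq N(3) left_submoduleD(1)[OF sub] by auto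
    qed
  qed
  note torsion_part = subquot_in_ideal_smult[OF A \<open>noetherian_domain R\<close> primes T' Y(1) this]
  \<comment> \<open>\<open>V = K \<otimes> Y\<close> contains the lattice \<open>u Y\<close>, a quotient of \<open>Y \<in> T\<close>, hence also a lattice \<open>Z\<close> in \<open>T'\<close>.\<close>
  obtain V :: "(('k \<times> 'l \<Rightarrow>\<^sub>0 int) set, ('r \<Rightarrow> (nat \<Rightarrow> 'l) set) set) module" and u where V: "left_module C V"
    and u: "u \<in> module_hom \<Lambda> Y (restrict_scalars \<psi> V)"
    and keru: "\<And>x. \<lbrakk>x \<in> carrier Y; u x = \<zero>\<^bsub>V\<^esub>\<rbrakk> \<Longrightarrow> \<exists>r\<in>carrier R - {\<zero>}. \<phi> r \<odot>\<^bsub>Y\<^esub> x = \<zero>\<^bsub>Y\<^esub>"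
    and dense: "\<And>v. v \<in> carrier V \<Longrightarrow> \<exists>r\<in>carrier R - {\<zero>}. \<exists>x\<in>carrier Y. \<psi> (\<phi> r) \<odot>\<^bsub>V\<^esub> v = u x"
    using localization_exists[OF Y(1)] by blast
  interpret V: left_module C V by (rule V)
  note V' = left_module_restrict_scalars[OF \<psi>_hom V]
  interpret V': left_module \<Lambda> "restrict_scalars \<psi> V" by (rule V')
  have u_zero: "u \<zero>\<^bsub>Y\<^esub> = \<zero>\<^bsub>V\<^esub>" using module_hom_zero[OF Y(1) V' u] by simp
  have u_closed: "u x \<in> carrier V" if "x \<in> carrier Y" for x using module_homD(1)[OF u that] by simp
  have u_smult: "u (\<phi> r \<odot>\<^bsub>Y\<^esub> x) = \<psi> (\<phi> r) \<odot>\<^bsub>V\<^esub> u x" if "r \<in> carrier R" "x \<in> carrier Y" for r x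
    using module_homD(3)[OF u, of "\<phi> r" x] that by simp
  define uY where "uY = u ` carrier Y"
  have uY: "left_submodule \<Lambda> (restrict_scalars \<psi> V) uY"
    unfolding uY_def by (rule left_submodule_image[OF Y(1) V' u CY])
  have zV: "left_submodule \<Lambda> (restrict_scalars \<psi> V) {\<zero>\<^bsub>V\<^esub>}" using left_submodule_zero[OF V'] by simp
  have lat: "lattice_in \<Lambda> C \<psi> V uY"
    using loc.lattice_in_iff[OF V uY] dense unfolding uY_def by blast
  have uYT: "subquot_in \<Lambda> T (restrict_scalars \<psi> V) uY {\<zero>\<^bsub>V\<^esub>}"
    using subquot_in_image_zero[OF T Y(1) V' YYT u] u_zero by (simp add: uY_def)
  obtain Z where Z: "lattice_in \<Lambda> C \<psi> V Z" "subquot_in \<Lambda> T' (restrict_scalars \<psi> V) Z {\<zero>\<^bsub>V\<^esub>}"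
    using extended_class_transfer[OF \<psi>_hom T T' generic V lat uYT] by blast
  have sZ: "left_submodule \<Lambda> (restrict_scalars \<psi> V) Z" using Z(1) by (simp add: lattice_in_def)
  have ZV: "z \<in> carrier V" if "z \<in> Z" for z using left_submoduleD(1)[OF sZ that] by simp
  \<comment> \<open>\<open>r1 Z \<subseteq> u Y\<close>\<close>
  let ?Z = "(restrict_scalars \<psi> V)\<lparr>carrier := Z\<rparr>"
  note mZ = left_module_restrict[OF V' sZ]
  have fgZ: "fin_gen_module \<Lambda> ?Z"
    using subquot_in_zero_fin_gen[OF T' V'] Z(2) by simp
  have "\<exists>r\<in>carrier R - {\<zero>}. \<phi> r \<odot>\<^bsub>?Z\<^esub> z \<in> Z \<inter> uY" if "z \<in> Z" for z
  proof -
    obtain r where r: "r \<in> carrier R - {\<zero>}" "\<psi> (\<phi> r) \<odot>\<^bsub>V\<^esub> z \<in> uY"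
      using lat loc.lattice_in_iff[OF V uY] ZV[OF \<open>z \<in> Z\<close>] by blast
    moreover have "\<psi> (\<phi> r) \<odot>\<^bsub>V\<^esub> z \<in> Z" using left_submoduleD(4)[OF sZ _ \<open>z \<in> Z\<close>, of "\<phi> r"] r(1) by simp
    ultimately show ?thesis by auto
  qed
  moreover have "left_submodule \<Lambda> ?Z Z" "left_submodule \<Lambda> ?Z (Z \<inter> uY)"
    using sZ left_submodule_Int[OF sZ uY] by (simp_all add: left_submodule_restrict_iff[OF sZ])
  ultimately obtain r1 where r1: "r1 \<in> carrier R - {\<zero>}"
    and r1Z: "\<And>z. z \<in> Z \<Longrightarrow> \<phi> r1 \<odot>\<^bsub>?Z\<^esub> z \<in> Z \<inter> uY"
    using bounded_torsion[OF A frac.domain_axioms mZ fgZ] by blast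
  have r1R: "r1 \<in> carrier R" using r1 by simp
  \<comment> \<open>\<open>r2\<close> annihilates the torsion submodule \<open>tY\<close>, the kernel of \<open>u\<close>.\<close>
  define tY where "tY = {x \<in> carrier Y. u x = \<zero>\<^bsub>V\<^esub>}"
  have tY: "left_submodule \<Lambda> Y tY"
    using left_submodule_vimage[OF Y(1) V' u zV] by (simp add: tY_def)
  have "\<exists>r\<in>carrier R - {\<zero>}. \<phi> r \<odot>\<^bsub>Y\<^esub> x \<in> {\<zero>\<^bsub>Y\<^esub>}" if "x \<in> tY" for x
    using keru[of x] that by (simp add: tY_def)
  then obtain r2 where r2: "r2 \<in> carrier R - {\<zero>}" and r2t: "\<And>x. x \<in> tY \<Longrightarrow> \<phi> r2 \<odot>\<^bsub>Y\<^esub> x \<in> {\<zero>\<^bsub>Y\<^esub>}"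
    using bounded_torsion[OF A frac.domain_axioms Y tY zY] by blast
  have r2R: "r2 \<in> carrier R" using r2 by simp
  \<comment> \<open>With \<open>P\<close> the preimage of \<open>r1 Z\<close>, multiplication by \<open>r2\<close> maps \<open>P / tY \<cong> r1 Z\<close> onto \<open>D = r2 P\<close>.\<close>
  define r1Zs where "r1Zs = (\<lambda>z. \<psi> (\<phi> r1) \<odot>\<^bsub>V\<^esub> z) ` Z"
  have r1Zs: "left_submodule \<Lambda> (restrict_scalars \<psi> V) r1Zs"
    unfolding r1Zs_def by (rule left_submodule_image[OF V' V' loc.scale_hom[OF V r1R] sZ])
  have r1Zs_uY: "r1Zs \<subseteq> uY" using r1Z by (auto simp: r1Zs_def)
  have r1ZsT: "subquot_in \<Lambda> T' (restrict_scalars \<psi> V) r1Zs {\<zero>\<^bsub>V\<^esub>}"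
    using subquot_in_image_zero[OF T' V' V' Z(2) loc.scale_hom[OF V r1R]] r1R
    by (simp add: r1Zs_def V.smult_zero_right)
  define P where "P = {x \<in> carrier Y. u x \<in> r1Zs}"
  have P: "left_submodule \<Lambda> Y P"
    unfolding P_def by (rule left_submodule_vimage[OF Y(1) V' u r1Zs])
  have "subquot_in \<Lambda> T' Y P tY"
  proof (rule subquot_in_vimage[OF r1ZsT P module_hom_restrict[OF u P]])
    show "u ` P = r1Zs" using r1Zs_uY by (auto simp: P_def uY_def)
    show "{x \<in> P. u x \<in> {\<zero>\<^bsub>V\<^esub>}} = tY"
      using left_submoduleD(2)[OF r1Zs] by (auto simp: P_def tY_def)
  qed
  note PT = this
  note scale = module_hom_central_smult[OF A Y(1) r2R]
  define D where "D = (\<lambda>x. \<phi> r2 \<odot>\<^bsub>Y\<^esub> x) ` P"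
  have D: "left_submodule \<Lambda> Y D"
    unfolding D_def by (rule left_submodule_image[OF Y(1) Y(1) scale P])
  have DT: "subquot_in \<Lambda> T' Y D {\<zero>\<^bsub>Y\<^esub>}"
    unfolding D_def using subquot_in_image_zero[OF T' Y(1) Y(1) PT scale] r2t by simp
  have "\<exists>r\<in>carrier R - {\<zero>}. \<phi> r \<odot>\<^bsub>Y\<^esub> x \<in> D" if x: "x \<in> carrier Y" for x
  proof -
    obtain s where s: "s \<in> carrier R - {\<zero>}" "\<psi> (\<phi> s) \<odot>\<^bsub>V\<^esub> u x \<in> Z"
      using Z(1) loc.lattice_in_iff[OF V sZ] u_closed[OF x] by blast
    have sR: "s \<in> carrier R" using s by simp
    have "u (\<phi> (r1 \<otimes> s) \<odot>\<^bsub>Y\<^esub> x) = \<psi> (\<phi> r1) \<odot>\<^bsub>V\<^esub> (\<psi> (\<phi> s) \<odot>\<^bsub>V\<^esub> u x)"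
      using u_smult[of "r1 \<otimes> s" x] loc.scale_mult[OF V r1R sR u_closed[OF x]] r1R sR x by simp
    then have "\<phi> (r1 \<otimes> s) \<odot>\<^bsub>Y\<^esub> x \<in> P"
      using s(2) r1R sR x Y.smult_closed[of "\<phi> (r1 \<otimes> s)" x] unfolding P_def r1Zs_def by auto
    then have "\<phi> r2 \<odot>\<^bsub>Y\<^esub> (\<phi> (r1 \<otimes> s) \<odot>\<^bsub>Y\<^esub> x) \<in> D" unfolding D_def by blast
    then have "\<phi> (r2 \<otimes> (r1 \<otimes> s)) \<odot>\<^bsub>Y\<^esub> x \<in> D"
      using r1R r2R sR x by (simp add: Y.smult_assoc1)
    then show ?thesis using loc.nonzero_mult[OF r2 loc.nonzero_mult[OF r1 s(1)]] by blast
  qed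
  then obtain r3 where r3: "r3 \<in> carrier R - {\<zero>}" and r3D: "\<And>x. x \<in> carrier Y \<Longrightarrow> \<phi> r3 \<odot>\<^bsub>Y\<^esub> x \<in> D"
    using bounded_torsion[OF A frac.domain_axioms Y CY D] by blast
  have r3R: "r3 \<in> carrier R" using r3 by simp
  have s3: "subquot_in \<Lambda> T' Y (carrier Y) (ideal_smult \<Lambda> \<phi> (PIdl r3) Y)"
    using nonzero_principal_ideal[OF frac.domain_axioms r3] by (intro torsion_part)
  have "ideal_smult \<Lambda> \<phi> (PIdl r3) Y \<subseteq> D"
    unfolding ideal_smult_def
  proof (rule lspan_minimal[OF D], rule subsetI)
    fix y assume "y \<in> {\<phi> a \<odot>\<^bsub>Y\<^esub> x | a x. a \<in> PIdl r3 \<and> x \<in> carrier Y}"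
    then obtain a x where a: "a \<in> PIdl r3" and x: "x \<in> carrier Y" and y: "y = \<phi> a \<odot>\<^bsub>Y\<^esub> x" by blast
    obtain b where b: "b \<in> carrier R" "a = b \<otimes> r3" using a unfolding cgenideal_def by blast
    have "y = \<phi> b \<odot>\<^bsub>Y\<^esub> (\<phi> r3 \<odot>\<^bsub>Y\<^esub> x)" using b r3R x y by (simp add: Y.smult_assoc1)
    then show "y \<in> D" using ext[OF D b(1) r3D[OF x]] by simp
  qed
  from subquot_in_mono[OF T' Y(1) s3 D this] left_submoduleD(1)[OF D]
  have "subquot_in \<Lambda> T' Y (carrier Y) D" by blast
  from subquot_in_trans[OF T' Y(1) this DT] show "Y \<in> T'"
    by (rule subquot_in_zero_member[OF T' Yfg])
qed

theorem corollary1p8: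
  fixes R :: "('r, 'm) ring_scheme" and K :: "('k, 'n) ring_scheme"
    and \<Lambda> :: "('l, 'p) ring_scheme"
    and \<mm> :: "'r set" and \<iota> :: "'r \<Rightarrow> 'k" and \<phi> :: "'r \<Rightarrow> 'l"
  assumes "complete_local_ring \<mm> R"
    and "noetherian_domain R"
    and "krull_dim R = 1"
    and "fraction_field R K \<iota>"
    and "module_finite_algebra R \<Lambda> \<phi>"
  shows "finite (tors \<Lambda>) \<longleftrightarrow>
    finite (tors (\<Lambda> Quot extend_ideal \<Lambda> \<phi> \<mm>)) \<and>
    finite (tors (tensor_algebra R K \<Lambda> \<iota> \<phi>))"
proof -
  interpret fraction_algebra R K \<Lambda> \<iota> \<phi> by (rule fraction_algebra.intro[OF assms(4,5)])
  have local: "local_ring \<mm> R" using assms(1) by (simp add: complete_local_ring_def)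
  then have "maximalideal \<mm> R" by (simp add: local_ring_def)
  then have \<mm>: "ideal \<mm> R" by (simp add: maximalideal_def)
  define \<Gamma> where "\<Gamma> = \<Lambda> Quot extend_ideal \<Lambda> \<phi> \<mm>"
  define c where "c = a_r_coset \<Lambda> (extend_ideal \<Lambda> \<phi> \<mm>)"
  have h: "ring_hom_ring \<Lambda> \<Gamma> c"
    unfolding \<Gamma>_def c_def by (rule ideal.rcos_ring_hom_ring[OF ideal_extend_ideal[OF assms(5) \<mm>]])
  have surj: "c ` carrier \<Lambda> = carrier \<Gamma>"
    by (auto simp: \<Gamma>_def FactRing_def A_RCOSETS_def' c_def)
  have le: "T \<subseteq> T'"
    if "T \<in> tors \<Lambda>" "T' \<in> tors \<Lambda>" "extended_class \<Lambda> \<Gamma> c T = extended_class \<Lambda> \<Gamma> c T'"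
      "extended_class \<Lambda> C \<psi> T = extended_class \<Lambda> C \<psi> T'" for T T'
    using that nonzero_prime_is_maximal[OF local assms(2,3)]
    by (intro torsion_class_le_if_extended_le[OF assms(2) _ \<mm>]) (auto simp: tors_def \<Gamma>_def c_def)
  show ?thesis
    unfolding \<Gamma>_def[symmetric] C_def[symmetric]
  proof
    assume "finite (tors \<Lambda>)"
    then show "finite (tors \<Gamma>) \<and> finite (tors C)"
      using finite_tors_surj[OF h surj] loc.finite_tors_localization by blast
  next
    assume fin: "finite (tors \<Gamma>) \<and> finite (tors C)"
    let ?f = "\<lambda>T. (extended_class \<Lambda> \<Gamma> c T, extended_class \<Lambda> C \<psi> T)"
    have "inj_on ?f (tors \<Lambda>)"
      using le by (intro inj_onI subset_antisym) auto
    moreover have "?f ` tors \<Lambda> \<subseteq> tors \<Gamma> \<times> tors C"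
      using torsion_class_extended_surj[OF h surj] loc.torsion_class_extended_localization
      by (auto simp: tors_def)
    ultimately show "finite (tors \<Lambda>)"
      using fin by (meson finite_SigmaI inj_on_finite)
  qed
qed

end
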